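(* For the primes $p$ and integers $a$ below, $\langle a\rangle(\mathcal E_p)=\mathfrak T_p[b_1,\dots,b_{(p-1)/2}]$ with: $p=5$: $\langle1\rangle\mapsto[2,-3]$, $\langle2\rangle\mapsto[-3,2]$. $p=7$: $\langle1\rangle\mapsto[1,0,-2]$, $\langle2\rangle\mapsto[-2,1,0]$, $\langle3\rangle\mapsto[0,-2,1]$. $p=11$: $\langle1\rangle\mapsto[0,1,0,-1,-1]$, $\langle2\rangle\mapsto[-1,0,0,1,-1]$, $\langle3\rangle\mapsto[1,-1,-1,0,0]$, $\langle5\rangle\mapsto[0,-1,1,-1,0]$, $\langle7\rangle\mapsto[-1,0,-1,0,1]$. $p=13$: $\langle1\rangle\mapsto[1,0,0,-1,0,-1]$, $\langle2\rangle\mapsto[-1,-1,0,1,0,0]$, $\langle3\rangle\mapsto[0,0,-1,0,1,-1]$, $\langle4\rangle\mapsto[0,1,-1,-1,0,0]$, $\langle5\rangle\mapsto[0,-1,1,0,-1,0]$, $\langle7\rangle\mapsto[-1,0,0,0,-1,1]$. $p=17$: $\langle1\rangle\mapsto[1,0,0,0,0,-1,-1,0]$, $\langle2\rangle\mapsto[0,-1,0,0,1,0,0,-1]$, $\langle3\rangle\mapsto[0,0,0,-1,0,1,0,-1]$, $\langle5\rangle\mapsto[0,0,0,1,-1,-1,0,0]$, $\langle7\rangle\mapsto[0,-1,1,0,0,0,-1,0]$, $\langle8\rangle\mapsto[0,0,-1,0,-1,0,0,1]$, $\langle11\rangle\mapsto[-1,1,-1,0,0,0,0,0]$, $\langle13\rangle\mapsto[-1,0,0,-1,0,0,1,0]$.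 $p=19$: $\langle1\rangle\mapsto[1,1,0,0,-1,-1,-1,0,0]$, $\langle2\rangle\mapsto[0,-1,-1,0,1,1,0,-1,0]$, $\langle3\rangle\mapsto[1,-1,0,0,-1,0,1,0,-1]$, $\langle4\rangle\mapsto[0,0,1,-1,0,-1,0,1,-1]$, $\langle5\rangle\mapsto[0,0,-1,1,0,0,-1,1,-1]$, $\langle7\rangle\mapsto[0,0,1,-1,-1,1,0,-1,0]$, $\langle9\rangle\mapsto[-1,-1,0,-1,0,0,1,0,1]$, $\langle11\rangle\mapsto[-1,0,0,1,0,0,-1,-1,1]$, $\langle13\rangle\mapsto[-1,1,-1,0,1,-1,0,0,0]$.
   Context: $q=e^{2\pi i\tau}$, $\tau$ in the upper half plane; $\eta(\tau)=q^{1/24}\prod_{n\ge1}(1-q^n)$. For real $\epsilon,\epsilon'$, $\theta\left[{\epsilon\atop\epsilon'}\right](z,\tau)=\sum_{n\in\mathbb Z}\exp 2\pi i\left\{\tfrac12(n+\tfrac{\epsilon}{2})^2\tau+(n+\tfrac{\epsilon}{2})(z+\tfrac{\epsilon'}{2})\right\}$. For odd $p$ and $1\le k\le(p-1)/2$, $\varphi_{p,k}(\tau)=\theta\left[{(2k-1)/p\atop 1}\right](0,p\tau)$. For $(b_1,\dots,b_{(p-1)/2})\in\mathbb Z^{(p-1)/2}$, $\mathfrak T_p[b_1,\dots,b_{(p-1)/2}](\tau)=\eta^3(p\tau)\prod_{k=1}^{(p-1)/2}\exp\left(-\frac{\pi i b_k(2k-1)}{2p}\right)\varphi_{p,k}(\tau)^{b_k}$.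 For an odd Dirichlet character $\chi$ mod $p$, $E_{1,\chi}(\tau)=1+\frac{2}{L(0,\chi)}\sum_{n\ge1}\chi(n)\frac{q^n}{1-q^n}$ ($L(0,\chi)$ the value at $0$ of the continued $L$-function); $\mathcal E_p=\frac{2}{p-1}\sum_{\chi\text{ odd}}E_{1,\chi}$; and for $a$ coprime to $p$, $\langle a\rangle(\mathcal E_p)(\tau)=(\gamma_{21}\tau+\gamma_{22})^{-1}\mathcal E_p(\gamma\tau)$ for any $\gamma\in SL(2,\mathbb Z)$ with $\gamma_{21}\equiv0$, $\gamma_{22}\equiv a\pmod p$ (equivalently $\frac{2}{p-1}\sum_{\chi\text{ odd}}\chi(a)E_{1,\chi}$). *)

theory Defs
  imports "HOL-Complex_Analysis.Complex_Analysis" "HOL-Number_Theory.Cong"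
begin

definition nome :: "complex \<Rightarrow> complex" where
  "nome \<tau> = exp (2 * of_real pi * \<i> * \<tau>)"

(* q^(1/24) means exp (2 pi i tau / 24), not the principal branch of a power of q *)
definition dedekind_eta :: "complex \<Rightarrow> complex" where
  "dedekind_eta \<tau> = exp (2 * of_real pi * \<i> * \<tau> / 24) * (\<Prod>n. 1 - nome \<tau> ^ Suc n)"

definition theta_char :: "real \<Rightarrow> real \<Rightarrow> complex \<Rightarrow> complex \<Rightarrow> complex" where
  "theta_char \<epsilon> \<epsilon>' z \<tau> =
     (\<Sum>\<^sub>\<infinity>n\<in>(UNIV :: int set).
        exp (2 * of_real pi * \<i> *
          ((of_int n + of_real \<epsilon> / 2)\<^sup>2 * \<tau> / 2
           + (of_int n + of_real \<epsilon> / 2) * (z + of_real \<epsilon>' / 2))))"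

definition theta_phi :: "nat \<Rightarrow> nat \<Rightarrow> complex \<Rightarrow> complex" where
  "theta_phi p k \<tau> = theta_char ((2 * real k - 1) / real p) 1 0 (of_nat p * \<tau>)"

(* the list b holds b_1, ..., b_((p-1)/2), so b_k is b ! (k - 1) *)
definition theta_quot :: "nat \<Rightarrow> int list \<Rightarrow> complex \<Rightarrow> complex" where
  "theta_quot p b \<tau> =
     dedekind_eta (of_nat p * \<tau>) ^ 3 *
     (\<Prod>k = 1..(p - 1) div 2.
        exp (- (of_real pi * \<i> * of_int (b ! (k - 1)) * (2 * of_nat k - 1) / (2 * of_nat p)))
        * theta_phi p k \<tau> powi (b ! (k - 1)))"

definition dirichlet_character :: "nat \<Rightarrow> (int \<Rightarrow> complex) \<Rightarrow> bool" where
  "dirichlet_character p chi \<longleftrightarrow>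
     (\<forall>m n. chi (m * n) = chi m * chi n) \<and>
     (\<forall>n. chi (n + int p) = chi n) \<and>
     (\<forall>n. chi n \<noteq> 0 \<longleftrightarrow> coprime n (int p))"

definition odd_characters :: "nat \<Rightarrow> (int \<Rightarrow> complex) set" where
  "odd_characters p = {chi. dirichlet_character p chi \<and> chi (- 1) = - 1}"

(* The analytic continuation of the Dirichlet series. Excluding 1 accommodates the pole for
   principal characters; by the identity theorem all values off 1 are uniquely determined. *)
definition dirichlet_L :: "(int \<Rightarrow> complex) \<Rightarrow> complex \<Rightarrow> complex" where
  "dirichlet_L chi =
     (SOME L. L holomorphic_on (- {1}) \<and>
        (\<forall>s. Re s > 1 \<longrightarrow> (\<lambda>n. chi (int (Suc n)) * of_nat (Suc n) powr (- s)) sums L s))"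

definition eisenstein1 :: "(int \<Rightarrow> complex) \<Rightarrow> complex \<Rightarrow> complex" where
  "eisenstein1 chi \<tau> =
     1 + 2 / dirichlet_L chi 0 *
       (\<Sum>n. chi (int (Suc n)) * (nome \<tau> ^ Suc n / (1 - nome \<tau> ^ Suc n)))"

definition eisenstein_avg :: "nat \<Rightarrow> complex \<Rightarrow> complex" where
  "eisenstein_avg p \<tau> = 2 / (of_nat p - 1) * (\<Sum>chi\<in>odd_characters p. eisenstein1 chi \<tau>)"

definition automorphy :: "int^2^2 \<Rightarrow> complex \<Rightarrow> complex" where
  "automorphy \<gamma> \<tau> = of_int (\<gamma> $ 2 $ 1) * \<tau> + of_int (\<gamma> $ 2 $ 2)"

definition sl2_act :: "int^2^2 \<Rightarrow> complex \<Rightarrow> complex" where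
  "sl2_act \<gamma> \<tau> = (of_int (\<gamma> $ 1 $ 1) * \<tau> + of_int (\<gamma> $ 1 $ 2)) / automorphy \<gamma> \<tau>"

(* The weight-one diamond operator <a> at level p: the common value taken over all
   admissible matrices, so that an identity for it includes independence of the matrix. *)
definition diamond :: "nat \<Rightarrow> int \<Rightarrow> (complex \<Rightarrow> complex) \<Rightarrow> complex \<Rightarrow> complex" where
  "diamond p a f \<tau> =
     (THE w. \<forall>\<gamma> :: int^2^2.
        det \<gamma> = 1 \<and> [\<gamma> $ 2 $ 1 = 0] (mod int p) \<and> [\<gamma> $ 2 $ 2 = a] (mod int p)
        \<longrightarrow> w = inverse (automorphy \<gamma> \<tau>) * f (sl2_act \<gamma> \<tau>))"

end

theory Submission
  imports Defs "HOL-Number_Theory.Residue_Primitive_Roots"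
begin

text \<open>
  Write \<open>\<theta>\<close> for the theta function of the lattice spanned by \<open>1\<close> and \<open>p \<tau>\<close>.  The function
  \<open>K(x, y, z) = \<theta>'(0) \<theta>(x+y) \<theta>(y+z) \<theta>(z+x) / (\<theta>(x) \<theta>(y) \<theta>(z) \<theta>(x+y+z))\<close> is elliptic in each variable and,
  by comparing zeros and poles, equals \<open>\<zeta>(x) + \<zeta>(y) + \<zeta>(z) - \<zeta>(x+y+z)\<close> up to normalisation, where \<open>\<zeta>\<close> is the
  logarithmic derivative of \<open>\<theta>\<close>.  At multiples of \<open>\<tau>\<close> the right-hand side is a Lambert series whose
  coefficients depend on the residue modulo \<open>p\<close>; orthogonality of odd characters and
  \<open>L(0, \<chi>) = - (1/p) \<Sum> m \<chi>(m)\<close> identify it with \<open>\<E>\<^sub>p\<close> when \<open>(x, y, z)\<close> is \<open>(1,1,1)\<close>, \<open>(1,1,2)\<close>, \<open>(1,2,3)\<close>,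
  \<open>(1,3,4)\<close>, \<open>(2,3,5)\<close>, \<open>(3,4,5)\<close> times \<open>\<tau>\<close> for \<open>p = 5, 7, 11, 13, 17, 19\<close>.  Since \<open>K\<close> depends only on the lattice
  and is homogeneous of degree \<open>-1\<close>, the operator \<open>\<langle>a\<rangle>\<close> merely divides the triple by \<open>a\<close> modulo \<open>p\<close>, and
  Jacobi's triple product turns the theta factors into the \<open>\<phi>\<^sub>p\<^sub>,\<^sub>k\<close>.
\<close>

section \<open>Odd Dirichlet characters modulo a prime\<close>

text \<open>The obstacle is that the average over odd characters carries the weights 2 / L(0, chi),
  a different number for each chi, so orthogonality does not apply directly. The triple (x, y, z)
  removes it: for every odd chi at once, 2 / L(0, chi) equals chi(x)^-1 + chi(y)^-1 + chi(z)^-1 -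
  chi(x+y+z)^-1. Because L(0, chi) is a first moment of chi, this amounts to {xt/p} + {yt/p} +
  {zt/p} - {(x+y+z)t/p} being 1 for all t prime to p, except 0 at t = 1 and 2 at t = -1: a finite
  check for each p. No multiplier system has to be computed. The arguments x+y, y+z, z+x upstairs in
  K and x, y, z, x+y+z downstairs have the same sum and the same sum of squares, so Gaussian factors
  exp(alpha x^2 + beta x) cancel whatever their coefficients are. This identity serves twice: for
  the modular transformation, where only the existence of such a factor is proved, and for replacing
  theta values by Klein forms. K has one theta factor more below than above, and this matches
  exponents b_k with sum -1 against the factor eta^3.\<close>

lemma sum_powers_roots_minus_one:
  assumes h: "h > 0"
  shows "(\<Sum>w | w ^ h = (-1::complex). w ^ k) = (if h dvd k then of_nat h * (-1) ^ (k div h) else 0)"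
proof (cases "h dvd k")
  case True
  then obtain m where k: "k = h * m" by blast
  have "(\<Sum>w | w ^ h = (-1::complex). w ^ k) = (\<Sum>w | w ^ h = (-1::complex). (-1) ^ m)"
    by (intro sum.cong) (auto simp: k power_mult)
  also have "\<dots> = of_nat h * (-1) ^ m"
    using h by (simp add: card_nth_roots)
  finally show ?thesis using h k by simp
next
  case False
  \<comment> \<open>Multiplying by a primitive h-th root of unity permutes the h-th roots of -1 and
    scales the sum by its k-th power, which is not 1 here.\<close>
  define \<zeta> where "\<zeta> = cis (2 * pi / real h)"
  have "\<zeta> ^ h = cis (real h * (2 * pi / real h))" unfolding \<zeta>_def by (rule Complex.DeMoivre)
  then have z1: "\<zeta> ^ h = 1" using h by simp
  have zk: "\<zeta> ^ k \<noteq> 1"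
  proof
    assume "\<zeta> ^ k = 1"
    then have "cis (2 * pi * real k / real h) = 1" by (simp add: \<zeta>_def Complex.DeMoivre mult_ac)
    then obtain j :: int where "2 * pi * real k / real h = 2 * pi * of_int j"
      by (auto simp: complex_eq_iff cos_one_2pi_int)
    then have "real k = real h * of_int j" using h by (simp add: field_simps)
    then have "of_int (int k) = (of_int (int h * j) :: real)" by simp
    then have "int k = int h * j" by (simp only: of_int_eq_iff)
    then have "int h dvd int k" by simp
    with False show False by simp
  qed
  have "(\<Sum>w | w ^ h = (-1::complex). w ^ k) = (\<Sum>w | w ^ h = (-1::complex). (\<zeta> * w) ^ k)"
    by (rule sum.reindex_bij_witness[of _ "\<lambda>w. \<zeta> * w" "\<lambda>w. w / \<zeta>"])
       (use z1 in \<open>auto simp: \<zeta>_def power_mult_distrib power_divide\<close>)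
  also have "\<dots> = \<zeta> ^ k * (\<Sum>w | w ^ h = (-1::complex). w ^ k)"
    by (simp add: power_mult_distrib sum_distrib_left)
  finally show ?thesis using zk False by simp
qed

lemma dirichlet_character_cong:
  assumes "dirichlet_character p chi" "[m = n] (mod int p)"
  shows "chi m = chi n"
proof -
  have per: "chi (n + int p) = chi n" for n
    using assms(1) by (simp add: dirichlet_character_def)
  have pern: "chi (n + int p * int k) = chi n" for n k
  proof (induction k)
    case (Suc k)
    show ?case using per[of "n + int p * int k"] Suc by (simp add: algebra_simps)
  qed simp
  from assms(2) have "int p dvd m - n" by (simp add: cong_iff_dvd_diff)
  then obtain j where "m - n = int p * j" by blast
  then have j: "m = n + int p * j" by simp
  show ?thesis
  proof (cases "j \<ge> 0")
    case True
    then show ?thesis using pern[of n "nat j"] j by simp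
  next
    case False
    then show ?thesis using pern[of m "nat (-j)"] j by simp
  qed
qed

lemma dirichlet_character_1:
  assumes "dirichlet_character p chi" shows "chi 1 = 1"
proof -
  have "chi 1 * chi 1 = chi 1" "chi 1 \<noteq> 0"
    using assms unfolding dirichlet_character_def by (metis mult_1_left) (use assms in \<open>auto simp: dirichlet_character_def\<close>)
  then show ?thesis by simp
qed

lemma dirichlet_character_power:
  assumes "dirichlet_character p chi" shows "chi (n ^ k) = chi n ^ k"
  using assms by (induction k) (auto simp: dirichlet_character_1, simp add: dirichlet_character_def)

lemma primitive_root_dlog:
  assumes p: "prime p" "p > 2"
  obtains g where "coprime (int g) (int p)"
    "\<And>i j. [int g ^ i = int g ^ j] (mod int p) \<longleftrightarrow> [i = j] (mod (p - 1))"
    "\<And>n. coprime n (int p) \<Longrightarrow> \<exists>k. [n = int g ^ k] (mod int p)"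
    "[int g ^ ((p - 1) div 2) = -1] (mod int p)"
proof -
  obtain g where g: "residue_primroot p g"
    using residue_primroot_odd_prime_power_exists[of p] p prime_odd_nat[of p]
    by (metis power_one_right zero_less_one)
  have o: "ord p g = p - 1" and c: "coprime p g"
    using g p by (auto simp: residue_primroot_def totient_prime)
  have eq: "[int g ^ i = int g ^ j] (mod int p) \<longleftrightarrow> [i = j] (mod (p - 1))" for i j
    using order_divides_expdiff[OF c, of i j] o by (simp flip: of_nat_power add: cong_int_iff)
  have ex: "\<exists>k. [n = int g ^ k] (mod int p)" if n: "coprime n (int p)" for n
  proof -
    define m where "m = nat (n mod int p)"
    have m: "int m = n mod int p" using p by (simp add: m_def)
    have "coprime (int m) (int p)" unfolding m using n p by simp
    then have "coprime m p" by simp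
    moreover have "m < p" using pos_mod_bound[of "int p" n] p m by linarith
    ultimately have "m \<in> totatives p" using p
      by (cases "m = 0") (auto simp: in_totatives_iff)
    then have "m \<in> (\<lambda>i. g ^ i mod p) ` {..<totient p}"
      using residue_primroot_is_generator[OF _ g] p by (auto simp: bij_betw_def)
    then obtain k where "m = g ^ k mod p" by blast
    then have "int m = int g ^ k mod int p" by (simp add: of_nat_mod)
    then show ?thesis using m by (auto simp: cong_def)
  qed
  define h where "h = (p - 1) div 2"
  have h2: "p - 1 = 2 * h" "h > 0" using p prime_odd_nat[of p] by (auto simp: h_def elim: oddE)
  have "[int g ^ (2 * h) = 1] (mod int p)" using eq[of "2*h" 0] h2 by (simp add: cong_def)
  then have "int p dvd (int g ^ h - 1) * (int g ^ h + 1)"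
    by (simp add: cong_iff_dvd_diff algebra_simps flip: power_add mult_2)
  then have "int p dvd int g ^ h - 1 \<or> int p dvd int g ^ h + 1"
    using p prime_dvd_mult_iff[of "int p"] by simp
  moreover have "\<not> [int g ^ h = 1] (mod int p)" using eq[of h 0] h2 by (simp add: cong_def)
  ultimately have "[int g ^ h = -1] (mod int p)" by (simp add: cong_iff_dvd_diff)
  with that[of g] c eq ex show thesis by (simp add: h_def coprime_commute)
qed

text \<open>A character is determined by its value w at a primitive root g. Since g^h = -1 for h =
  (p-1)/2, it is odd exactly when w^h = -1. For n = g^k the sum becomes that of w^k over the h-th
  roots of -1.\<close>

lemma sum_odd_characters:
  assumes p: "prime p" "p > 2" and n: "coprime n (int p)"
  shows "(\<Sum>chi\<in>odd_characters p. chi n) =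
    of_nat ((p - 1) div 2) * (of_bool [n = 1] (mod int p) - of_bool [n = -1] (mod int p))"
proof -
  obtain g where c: "coprime (int g) (int p)"
    and eq: "\<And>i j. [int g ^ i = int g ^ j] (mod int p) \<longleftrightarrow> [i = j] (mod (p - 1))"
    and ex: "\<And>n. coprime n (int p) \<Longrightarrow> \<exists>k. [n = int g ^ k] (mod int p)"
    and half: "[int g ^ ((p - 1) div 2) = -1] (mod int p)"
    by (rule primitive_root_dlog[OF p]) blast
  define h where "h = (p - 1) div 2"
  have h2: "p - 1 = 2 * h" "h > 0" using p prime_odd_nat[of p] by (auto simp: h_def elim: oddE)
  define dl where "dl n = (SOME k. [n = int g ^ k] (mod int p))" for n
  have dl: "[n = int g ^ dl n] (mod int p)" if "coprime n (int p)" for n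
    using someI_ex[OF ex[OF that]] by (simp add: dl_def)
  define ch where "ch w n = (if coprime n (int p) then w ^ dl n else 0)" for w :: complex and n
  have wp: "w ^ i = w ^ j" if "w ^ h = -1" "[i = j] (mod (p - 1))" for w :: complex and i j
  proof -
    have w1: "w ^ (2 * h) = 1" using that(1) by (simp add: mult.commute power_mult)
    have *: "w ^ i = w ^ (i mod (2*h))" for i
    proof -
      have "w ^ i = w ^ ((2*h) * (i div (2*h)) + i mod (2*h))" by simp
      also have "\<dots> = w ^ (i mod (2*h))" by (simp only: power_add power_mult[of w "2*h"] w1) simp
      finally show ?thesis .
    qed
    show ?thesis using *[of i] *[of j] that(2) h2 by (simp add: cong_def)
  qed
  have cheq: "ch w n = w ^ k" if "w ^ h = -1" "[n = int g ^ k] (mod int p)" for w n k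
  proof -
    have "coprime (int g ^ k) (int p)" using c by simp
    then have cp: "coprime n (int p)" by (rule cong_imp_coprime[OF cong_sym[OF that(2)]])
    have "[dl n = k] (mod (p - 1))" using cong_trans[OF cong_sym[OF dl[OF cp]] that(2)] by (simp only: eq)
    then show ?thesis using wp[OF that(1)] cp by (simp add: ch_def)
  qed
  have oddch: "ch w \<in> odd_characters p" if w: "w ^ h = -1" for w
    unfolding odd_characters_def dirichlet_character_def mem_Collect_eq
  proof (intro conjI allI)
    fix m n
    show "ch w (m * n) = ch w m * ch w n"
    proof (cases "coprime m (int p) \<and> coprime n (int p)")
      case True
      then have "[m * n = int g ^ (dl m + dl n)] (mod int p)"
        using cong_mult[OF dl dl] by (simp add: power_add)
      from cheq[OF w this] True show ?thesis by (simp add: ch_def power_add)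
    qed (auto simp: ch_def)
  next
    fix n
    show "ch w (n + int p) = ch w n"
    proof (cases "coprime n (int p)")
      case True
      then have "[n + int p = int g ^ dl n] (mod int p)" using dl[OF True] by (simp add: cong_def)
      from cheq[OF w this] True show ?thesis by (simp add: ch_def)
    next
      case False
      then show ?thesis by (simp add: ch_def coprime_iff_gcd_eq_1)
    qed
  next
    fix n
    have "w \<noteq> 0" using w h2 by (auto simp: power_0_left)
    then show "(ch w n \<noteq> 0) = coprime n (int p)" by (simp add: ch_def)
  next
    show "ch w (-1) = -1" using cheq[OF w, of "-1" h] half w by (simp add: h_def cong_sym_eq)
  qed
  obtain k where k: "[n = int g ^ k] (mod int p)" using ex[OF n] by blast
  have "(\<Sum>chi\<in>odd_characters p. chi n) = (\<Sum>w | w ^ h = -1. w ^ k)"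
  proof (rule sum.reindex_bij_witness[of _ ch "\<lambda>chi. chi (int g)"])
    fix chi assume chi: "chi \<in> odd_characters p"
    then have dc: "dirichlet_character p chi" by (simp add: odd_characters_def)
    have "chi (int g) ^ h = chi (int g ^ h)" using dirichlet_character_power[OF dc] by simp
    also have "\<dots> = chi (-1)" using dirichlet_character_cong[OF dc] half by (simp add: h_def)
    finally have w: "chi (int g) ^ h = -1" using chi by (simp add: odd_characters_def)
    then show "chi (int g) \<in> {w. w ^ h = -1}" by simp
    show "ch (chi (int g)) = chi"
    proof
      fix n
      show "ch (chi (int g)) n = chi n"
        using dirichlet_character_cong[OF dc dl] dirichlet_character_power[OF dc] dc
        by (auto simp: ch_def dirichlet_character_def)
    qed
    show "chi (int g) ^ k = chi n"
      using dirichlet_character_cong[OF dc k] dirichlet_character_power[OF dc] by simp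
  next
    fix w assume "w \<in> {w :: complex. w ^ h = -1}"
    then show "ch w \<in> odd_characters p" "ch w (int g) = w"
      using oddch cheq[of w "int g" 1] by auto
  qed
  also have "\<dots> = (if h dvd k then of_nat h * (-1) ^ (k div h) else 0)"
    by (rule sum_powers_roots_minus_one) (use h2 in auto)
  also have "\<dots> = of_nat h * (of_bool [n = 1] (mod int p) - of_bool [n = -1] (mod int p))"
  proof -
    have 1: "[n = 1] (mod int p) \<longleftrightarrow> 2 * h dvd k"
    proof -
      have "[n = 1] (mod int p) \<longleftrightarrow> [int g ^ k = int g ^ 0] (mod int p)"
        using k unfolding cong_def by simp
      then show ?thesis using eq[of k 0] h2 by (simp add: cong_0_iff)
    qed
    have "[n = -1] (mod int p) \<longleftrightarrow> [int g ^ k = int g ^ h] (mod int p)"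
      using k half unfolding h_def cong_def by simp
    also have "\<dots> \<longleftrightarrow> [k = h] (mod (2 * h))" using eq h2 by simp
    finally have 2: "[n = -1] (mod int p) \<longleftrightarrow> [k = h] (mod (2 * h))" .
    show ?thesis
    \<comment> \<open>\<open>h\<close> divides \<open>k\<close> exactly when n is 1 or -1 modulo p,
      and the parity of the quotient decides which.\<close>
    proof (cases "h dvd k")
      case True
      then obtain m where m: "k = h * m" by blast
      have a: "2 * h dvd k \<longleftrightarrow> even m" using h2 m by (simp add: mult.commute)
      have "[k = h] (mod (2 * h)) \<longleftrightarrow> odd m"
      proof -
        have "[k = h] (mod (2 * h)) \<longleftrightarrow> [m * h = 1 * h] (mod (2 * h))" using m by (simp add: mult.commute)
        also have "\<dots> \<longleftrightarrow> [m = 1] (mod 2)" using h2 by (simp add: cong_def mod_mult_mult2 del: mult_1_left mult_1)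
        also have "\<dots> \<longleftrightarrow> odd m" by (simp add: cong_def odd_iff_mod_2_eq_one)
        finally show ?thesis .
      qed
      then show ?thesis using 1 2 a m h2 by (cases "even m") auto
    next
      case False
      then have "\<not> 2 * h dvd k" by (meson dvd_mult_right)
      moreover have "\<not> [k = h] (mod (2 * h))"
      proof
        assume "[k = h] (mod (2 * h))"
        then have "[k = h] (mod h)" by (metis cong_modulus_mult_nat mult.commute)
        then have "h dvd k" by (simp add: cong_def dvd_eq_mod_eq_0)
        with False show False by simp
      qed
      ultimately show ?thesis using 1 2 False by simp
    qed
  qed
  finally show ?thesis by (simp add: h_def)
qed

lemma card_odd_characters:
  assumes "prime p" "p > 2"
  shows "card (odd_characters p) = (p - 1) div 2"
proof -
  have np: "\<not> [1 = -1] (mod int p)" using assms by (auto simp: cong_iff_dvd_diff dest: zdvd_imp_le)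
  have "(\<Sum>chi\<in>odd_characters p. chi 1) = (\<Sum>chi\<in>odd_characters p. 1)"
    by (intro sum.cong) (auto simp: odd_characters_def dirichlet_character_1)
  with sum_odd_characters[OF assms, of 1] np
  have "of_nat (card (odd_characters p)) = (of_nat ((p - 1) div 2) :: complex)" by simp
  then show ?thesis by (simp only: of_nat_eq_iff)
qed

section \<open>The value at 0 of an odd Dirichlet L-function\<close>

text \<open>This is (-1)^N times the N-th forward difference of x^(-s). Each difference gains a
  factor 1/x in size, which moves the region of convergence of the Dirichlet series one unit to the
  left.\<close>

primrec powr_diff :: "nat \<Rightarrow> complex \<Rightarrow> real \<Rightarrow> complex" where
  "powr_diff 0 s x = of_real x powr (- s)"
| "powr_diff (Suc N) s x = powr_diff N s x - powr_diff N s (x + 1)"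

lemma powr_diff_has_vector_derivative:
  assumes "x > 0"
  shows "(powr_diff N s has_vector_derivative (- s * powr_diff N (s + 1) x)) (at x within A)"
  using assms
proof (induction N arbitrary: x A)
  case 0
  have "((\<lambda>z. z powr (- s)) has_field_derivative (- s * of_real x powr (- s - 1))) (at (of_real x))"
    using 0 by (auto intro!: derivative_eq_intros simp: complex_nonpos_Reals_iff)
  from has_vector_derivative_at_within[OF has_vector_derivative_real_field[OF this]]
  have "((\<lambda>x. of_real x powr (- s)) has_vector_derivative (- s * of_real x powr (- s - 1))) (at x within A)" .
  moreover have "powr_diff 0 s = (\<lambda>x. of_real x powr (- s))" by auto
  ultimately show ?case by simp
next
  case (Suc N)
  have "((\<lambda>x. powr_diff N s (x + 1)) has_vector_derivative (- s * powr_diff N (s + 1) (x + 1))) (at x within A)"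
  proof -
    have "((powr_diff N s \<circ> (\<lambda>x. x + 1)) has_vector_derivative (1 *\<^sub>R (- s * powr_diff N (s + 1) (x + 1)))) (at x within A)"
      by (rule vector_diff_chain_within) (use Suc.prems Suc.IH[of "x + 1"] in \<open>auto intro!: derivative_eq_intros\<close>)
    then show ?thesis by (simp add: o_def)
  qed
  from has_vector_derivative_diff[OF Suc.IH[OF Suc.prems] this]
  show ?case by (simp add: algebra_simps)
qed

text \<open>Mean value estimate: the next difference is an increment over a unit interval, and
  differentiating \<open>powr_diff N s\<close> gives -s times the same difference at s + 1. The
  condition on Re s makes the bounding powers decreasing, so their value at the left end
  suffices.\<close>

lemma norm_powr_diff_le:
  assumes "x > 0" "Re s + real N \<ge> 0"
  shows "norm (powr_diff N s x) \<le> (\<Prod>i<N. norm (s + of_nat i)) * x powr (- (Re s + real N))"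
  using assms
proof (induction N arbitrary: s x)
  case 0
  then show ?case by (simp add: norm_powr_real_powr)
next
  case (Suc N)
  define C where "C = norm s * ((\<Prod>i<N. norm (s + 1 + of_nat i)) * x powr (- (Re s + 1 + real N)))"
  have "norm (powr_diff N s (x + 1) - powr_diff N s x) \<le> C * (x + 1) - C * x"
  proof (rule differentiable_bound_general)
    show "continuous_on {x..x + 1} (\<lambda>x. C * x)" by (intro continuous_intros)
    show "continuous_on {x..x + 1} (powr_diff N s)"
      by (rule continuous_on_vector_derivative, rule powr_diff_has_vector_derivative) (use Suc.prems in auto)
    fix y assume y: "x < y" "y < x + 1"
    show "((*) C has_vector_derivative C) (at y)" by (auto intro!: derivative_eq_intros)
    show "(powr_diff N s has_vector_derivative (- s * powr_diff N (s + 1) y)) (at y)"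
      by (rule powr_diff_has_vector_derivative) (use y Suc.prems in auto)
    have "norm (powr_diff N (s + 1) y) \<le> (\<Prod>i<N. norm (s + 1 + of_nat i)) * y powr (- (Re (s + 1) + real N))"
      by (rule Suc.IH) (use y Suc.prems in auto)
    also have "\<dots> \<le> (\<Prod>i<N. norm (s + 1 + of_nat i)) * x powr (- (Re (s + 1) + real N))"
      using y Suc.prems by (intro mult_left_mono powr_mono2' prod_nonneg) auto
    finally show "norm (- s * powr_diff N (s + 1) y) \<le> C"
      unfolding C_def by (simp add: norm_mult mult_left_mono)
  qed auto
  also have "\<dots> = C" by (simp add: algebra_simps)
  finally have "norm (powr_diff (Suc N) s x) \<le> C" by (simp add: norm_minus_commute)
  also have "C = (\<Prod>i<Suc N. norm (s + of_nat i)) * x powr (- (Re s + real (Suc N)))"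
    unfolding C_def by (subst prod.lessThan_Suc_shift) (simp add: algebra_simps)
  finally show ?case .
qed

text \<open>At s = 0 the power is the constant 1. This is what leaves a finite expression for
  L(0).\<close>

lemma powr_diff_0: "x > 0 \<Longrightarrow> powr_diff N 0 x = (if N = 0 then 1 else 0)"
  by (induction N arbitrary: x) auto

lemma powr_diff_holomorphic: "x > 0 \<Longrightarrow> (\<lambda>s. powr_diff N s x) holomorphic_on A"
  by (induction N arbitrary: x) (auto intro!: holomorphic_intros)

definition psum_shift :: "nat \<Rightarrow> (nat \<Rightarrow> complex) \<Rightarrow> complex" where
  "psum_shift p f = - (\<Sum>n<p. \<Sum>m\<le>n. f m) / of_nat p"

text \<open>The additive constant makes each partial summation have mean zero again.\<close>

primrec psum_iter :: "nat \<Rightarrow> (nat \<Rightarrow> complex) \<Rightarrow> nat \<Rightarrow> nat \<Rightarrow> complex" where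
  "psum_iter p f 0 = f"
| "psum_iter p f (Suc N) = (\<lambda>n. psum_shift p (psum_iter p f N) + (\<Sum>m\<le>n. psum_iter p f N m))"

text \<open>Partial sums of a periodic sequence are periodic once the sum over a period is zero, and
  the shift restores that condition for the next round. Periodicity then keeps all iterates
  bounded.\<close>

lemma psum_iter_periodic:
  assumes "p > 0" "\<And>n. f (n + p) = f n" "(\<Sum>n<p. f n) = 0"
  shows "(\<forall>n. psum_iter p f N (n + p) = psum_iter p f N n) \<and> (\<Sum>n<p. psum_iter p f N n) = 0"
proof (induction N)
  case (Suc N)
  define g where "g = psum_iter p f N"
  have g: "g (n + p) = g n" "(\<Sum>n<p. g n) = 0" for n using Suc by (auto simp: g_def)
  have "(\<Sum>m\<le>n + p. g m) = (\<Sum>m\<le>n. g m)" for n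
  proof (induction n)
    case 0
    have "(\<Sum>m\<le>p. g m) = (\<Sum>m<p. g m) + g p" by (simp add: lessThan_Suc_atMost[symmetric])
    then show ?case using g(1)[of 0] g(2) by simp
  next
    case (Suc n)
    then show ?case using g(1)[of "Suc n"] by simp
  qed
  moreover have "(\<Sum>n<p. psum_shift p g + (\<Sum>m\<le>n. g m)) = 0"
    using assms(1) unfolding psum_shift_def sum.distrib by simp
  ultimately show ?case by (simp flip: g_def)
qed (use assms in auto)

lemma periodic_bounded:
  fixes g :: "nat \<Rightarrow> complex"
  assumes "p > 0" "\<And>n. g (n + p) = g n"
  obtains B where "B \<ge> 0" "\<And>n. norm (g n) \<le> B"
proof
  have "g (k * p + n) = g n" for k n
  proof (induction k)
    case (Suc k)
    then show ?case using assms(2)[of "k * p + n"] by (simp add: algebra_simps)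
  qed simp
  then have "g n = g (n mod p)" for n by (metis div_mult_mod_eq)
  then show "norm (g n) \<le> (\<Sum>m<p. norm (g m))" for n
    using member_le_sum[of "n mod p" "{..<p}" "\<lambda>m. norm (g m)"] assms(1) by simp
qed (auto intro: sum_nonneg)

context
  fixes p :: nat and f :: "nat \<Rightarrow> complex"
  assumes p: "p > 0" and per: "\<And>n. f (n + p) = f n" and mean: "(\<Sum>n<p. f n) = 0"
begin

lemma psum_iter_bounded: obtains B where "B \<ge> 0" "\<And>n. norm (psum_iter p f N n) \<le> B"
proof -
  have "psum_iter p f N (n + p) = psum_iter p f N n" for n
    using psum_iter_periodic[of p f N] p per mean by simp
  with periodic_bounded[OF p, of "psum_iter p f N"] that show thesis by blast
qed

text \<open>What the Dirichlet series of \<open>f\<close> becomes after \<open>N\<close> summations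
  by parts, boundary terms left out; index n stands for the integer n + 1. Bounded iterates give
  convergence for Re s > 1 - N.\<close>

definition L_tail :: "nat \<Rightarrow> complex \<Rightarrow> complex" where
  "L_tail N s = (\<Sum>n. psum_iter p f N n * powr_diff N s (real n + 1))"

lemma L_tail_summable:
  assumes "Re s + real N > 1"
  shows "summable (\<lambda>n. psum_iter p f N n * powr_diff N s (real n + 1))"
proof -
  obtain B where B: "B \<ge> 0" "\<And>n. norm (psum_iter p f N n) \<le> B" using psum_iter_bounded[of N] by blast
  define C where "C = (\<Prod>i<N. norm (s + of_nat i))"
  show ?thesis
  proof (rule summable_comparison_test'[where N = 0])
    have "summable (\<lambda>n. real n powr (- (Re s + real N)))"
      using assms by (subst summable_real_powr_iff) auto
    then have "summable (\<lambda>n. (real n + 1) powr (- (Re s + real N)))"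
      by (subst (asm) summable_Suc_iff[symmetric]) (simp add: add.commute)
    then show "summable (\<lambda>n. B * (C * (real n + 1) powr (- (Re s + real N))))"
      by (intro summable_mult)
    show "norm (psum_iter p f N n * powr_diff N s (real n + 1)) \<le> B * (C * (real n + 1) powr (- (Re s + real N)))" for n
      unfolding norm_mult C_def
      by (intro mult_mono B norm_powr_diff_le) (use assms in auto)
  qed
qed

lemma L_tail_holomorphic: "L_tail N holomorphic_on {s. Re s + real N > 1}"
proof (rule holomorphic_uniform_sequence[where f = "\<lambda>M s. \<Sum>n<M. psum_iter p f N n * powr_diff N s (real n + 1)"])
  show "open {s. Re s + real N > 1}"
    by (intro open_Collect_less continuous_intros)
  show "(\<lambda>s. \<Sum>n<M. psum_iter p f N n * powr_diff N s (real n + 1)) holomorphic_on {s. Re s + real N > 1}" for M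
    by (intro holomorphic_intros powr_diff_holomorphic) auto
  fix s assume "s \<in> {s. Re s + real N > 1}"
  then have s: "Re s + real N > 1" by simp
  \<comment> \<open>Half the distance from s to the line Re s = 1 - N, so that Re t + N is at least
    1 + d on the whole closed disc.\<close>
  define d where "d = (Re s + real N - 1) / 2"
  have d: "d > 0" using s by (simp add: d_def)
  obtain B where B: "B \<ge> 0" "\<And>n. norm (psum_iter p f N n) \<le> B" using psum_iter_bounded[of N] by blast
  define C where "C = (\<Prod>i<N. norm s + d + real i)"
  have re: "Re t + real N \<ge> 1 + d" if "t \<in> cball s d" for t
  proof -
    have "\<bar>Re (s - t)\<bar> \<le> d" using that abs_Re_le_cmod[of "s - t"] by (simp add: dist_norm)
    then have "Re s - Re t \<le> d" by simp
    then show ?thesis by (simp add: d_def field_simps)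
  qed
  show "\<exists>d>0. cball s d \<subseteq> {s. Re s + real N > 1} \<and>
     uniform_limit (cball s d) (\<lambda>M s. \<Sum>n<M. psum_iter p f N n * powr_diff N s (real n + 1)) (L_tail N) sequentially"
  proof (intro exI[of _ d] conjI d)
    show "cball s d \<subseteq> {s. Re s + real N > 1}" using re d by force
    show "uniform_limit (cball s d) (\<lambda>M s. \<Sum>n<M. psum_iter p f N n * powr_diff N s (real n + 1)) (L_tail N) sequentially"
      unfolding L_tail_def
    proof (rule Weierstrass_m_test)
      have "summable (\<lambda>n. real n powr (- (1 + d)))"
        using d by (subst summable_real_powr_iff) auto
      then have "summable (\<lambda>n. (real n + 1) powr (- (1 + d)))"
        by (subst (asm) summable_Suc_iff[symmetric]) (simp add: add.commute)
      then show "summable (\<lambda>n. B * (C * (real n + 1) powr (- (1 + d))))"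
        by (intro summable_mult)
      fix n t assume t: "t \<in> cball s d"
      have "norm (powr_diff N t (real n + 1)) \<le> (\<Prod>i<N. norm (t + of_nat i)) * (real n + 1) powr (- (Re t + real N))"
        by (rule norm_powr_diff_le) (use re[OF t] d in auto)
      also have "\<dots> \<le> C * (real n + 1) powr (- (1 + d))"
      proof (rule mult_mono)
        have "norm t \<le> norm s + d" using t norm_triangle_ineq2[of t s]
          by (simp add: dist_norm norm_minus_commute)
        then show "(\<Prod>i<N. norm (t + of_nat i)) \<le> C" unfolding C_def
          by (intro prod_mono conjI norm_ge_zero order.trans[OF norm_triangle_ineq]) auto
        show "(real n + 1) powr (- (Re t + real N)) \<le> (real n + 1) powr (- (1 + d))"
          using re[OF t] by (intro powr_mono) auto
        show "C \<ge> 0" unfolding C_def using d by (intro prod_nonneg) auto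
      qed auto
      finally show "norm (psum_iter p f N n * powr_diff N t (real n + 1)) \<le> B * (C * (real n + 1) powr (- (1 + d)))"
        unfolding norm_mult using B by (intro mult_mono) auto
    qed
  qed
qed

text \<open>One summation by parts. The boundary term at the start gives the constant; the one at
  the far end is a bounded factor times \<open>powr_diff N s\<close>, which tends to 0 as soon as Re
  s + N > 0. In this range the series on the left may converge only conditionally.\<close>

lemma L_tail_Suc:
  assumes s: "Re s + real N > 0"
  shows "(\<lambda>n. psum_iter p f N n * powr_diff N s (real n + 1)) sums
    (L_tail (Suc N) s - psum_shift p (psum_iter p f N) * powr_diff N s 1)"
proof -
  define c where "c = psum_shift p (psum_iter p f N)"
  define g where "g = psum_iter p f (Suc N)"
  define h where "h n = powr_diff N s (real n + 1)" for n
  have partial: "(\<Sum>n<M. psum_iter p f N n * h n) =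
      (\<Sum>n<M. g n * (h n - h (Suc n))) - c * h 0 + (c + (\<Sum>m<M. psum_iter p f N m)) * h M" for M
    by (induction M) (simp_all add: g_def c_def algebra_simps flip: lessThan_Suc_atMost)
  have 1: "(\<lambda>M. \<Sum>n<M. g n * (h n - h (Suc n))) \<longlonglongrightarrow> L_tail (Suc N) s"
  proof -
    have "summable (\<lambda>n. g n * powr_diff (Suc N) s (real n + 1))"
      unfolding g_def by (rule L_tail_summable) (use s in auto)
    then have "(\<lambda>n. g n * (h n - h (Suc n))) sums L_tail (Suc N) s"
      by (simp add: L_tail_def g_def h_def summable_sums add.commute del: psum_iter.simps)
    then show ?thesis by (simp add: sums_def)
  qed
  have 2: "(\<lambda>M. (c + (\<Sum>m<M. psum_iter p f N m)) * h M) \<longlonglongrightarrow> 0"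
  proof -
    obtain B where B: "B \<ge> 0" "\<And>n. norm (psum_iter p f (Suc N) n) \<le> B" using psum_iter_bounded[of "Suc N"] by blast
    have bd: "norm (c + (\<Sum>m<M. psum_iter p f N m)) \<le> B + norm c" for M
    proof (cases M)
      case (Suc k)
      have "c + (\<Sum>m<M. psum_iter p f N m) = psum_iter p f (Suc N) k"
        using Suc by (simp add: c_def lessThan_Suc_atMost)
      then show ?thesis using B(2)[of k] norm_ge_zero[of c] by (simp del: norm_ge_zero)
    qed (use B in auto)
    define C where "C = (\<Prod>i<N. norm (s + of_nat i))"
    have "(\<lambda>M. (real (Suc M)) powr (- (Re s + real N))) \<longlonglongrightarrow> 0"
      by (rule LIMSEQ_Suc, rule tendsto_neg_powr) (use s in \<open>auto intro: filterlim_real_sequentially\<close>)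
    then have "(\<lambda>M. (B + norm c) * (C * (real M + 1) powr (- (Re s + real N)))) \<longlonglongrightarrow> (B + norm c) * (C * 0)"
      by (intro tendsto_intros) (simp add: add.commute)
    then have lim: "(\<lambda>M. (B + norm c) * (C * (real M + 1) powr (- (Re s + real N)))) \<longlonglongrightarrow> 0" by simp
    show ?thesis
    proof (rule Lim_null_comparison[OF always_eventually lim], rule allI)
      fix M
      show "norm ((c + (\<Sum>m<M. psum_iter p f N m)) * h M) \<le> (B + norm c) * (C * (real M + 1) powr (- (Re s + real N)))"
        unfolding norm_mult h_def C_def
        by (intro mult_mono bd norm_powr_diff_le) (use s B in auto)
    qed
  qed
  have "(\<lambda>M. \<Sum>n<M. psum_iter p f N n * h n) \<longlonglongrightarrow> L_tail (Suc N) s - c * h 0 + 0"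
    unfolding partial by (intro tendsto_intros 1 2)
  then show ?thesis by (simp add: sums_def h_def c_def)
qed

text \<open>Subtracting the boundary terms collected so far makes the value independent of
  \<open>N\<close> wherever the tail converges absolutely.\<close>

definition L_approx :: "nat \<Rightarrow> complex \<Rightarrow> complex" where
  "L_approx N s = L_tail N s - (\<Sum>j<N. psum_shift p (psum_iter p f j) * powr_diff j s 1)"

lemma L_approx_eq:
  assumes "Re s + real N > 1" "N \<le> M"
  shows "L_approx M s = L_approx N s"
  using assms(2)
proof (induction M rule: dec_induct)
  case (step M)
  have "Re s + real M > 0" using step assms by (smt (verit) of_nat_le_iff)
  from sums_unique[OF L_tail_Suc[OF this]]
  have "L_tail M s = L_tail (Suc M) s - psum_shift p (psum_iter p f M) * powr_diff M s 1"
    by (simp add: L_tail_def[of M])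
  then have "L_approx (Suc M) s = L_approx M s" by (simp add: L_approx_def)
  then show ?case using step.IH by simp
qed simp

text \<open>The half-planes Re s > 1 - N exhaust the plane and the approximations agree on overlaps,
  so they glue to an entire function.\<close>

lemma periodic_L_continuation:
  obtains L where "L holomorphic_on UNIV"
    "\<And>s. Re s > 1 \<Longrightarrow> (\<lambda>n. f n * of_nat (Suc n) powr (- s)) sums L s"
    "L 0 = - (\<Sum>n<p. of_nat (Suc n) * f n) / of_nat p"
proof
  define N where "N s = nat \<lceil>2 - Re s\<rceil>" for s
  have N: "Re s + real (N s) > 1" for s unfolding N_def by linarith
  define L where "L s = L_approx (N s) s" for s
  have L: "L s = L_approx M s" if "Re s + real M > 1" for s M
    using L_approx_eq[OF that, of "N s"] L_approx_eq[OF N, of s M] by (cases "M \<le> N s") (auto simp: L_def)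
  have "L holomorphic_on {s. Re s + real M > 1}" for M
  proof (rule holomorphic_transform)
    show "L_approx M holomorphic_on {s. Re s + real M > 1}"
      unfolding L_approx_def by (intro holomorphic_intros L_tail_holomorphic powr_diff_holomorphic) auto
  qed (use L in auto)
  moreover have "open {s. Re s + real M > 1}" for M by (intro open_Collect_less continuous_intros)
  ultimately have "L field_differentiable at s" for s
    using N[of s] by (metis (mono_tags, lifting) holomorphic_on_imp_differentiable_at mem_Collect_eq)
  then show "L holomorphic_on UNIV"
    by (simp add: holomorphic_on_def field_differentiable_at_within)
  show "(\<lambda>n. f n * of_nat (Suc n) powr (- s)) sums L s" if "Re s > 1" for s
    using L[of s 0] summable_sums[OF L_tail_summable[of s 0]] that
    by (simp add: L_approx_def L_tail_def add.commute)
  \<comment> \<open>2 is the least \<open>N\<close> whose half-plane contains 0. There all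
    differences of positive order vanish, so only the boundary term of order 0 survives.\<close>
  have "L 0 = L_approx 2 0" by (rule L) auto
  also have "\<dots> = - psum_shift p f"
    by (simp add: L_approx_def L_tail_def powr_diff_0 numeral_2_eq_2 del: powr_diff.simps)
  also have "\<dots> = (\<Sum>n<p. \<Sum>m\<le>n. f m) / of_nat p" by (simp add: psum_shift_def)
  also have "(\<Sum>n<k. \<Sum>m\<le>n. f m) = of_nat k * (\<Sum>n<k. f n) - (\<Sum>n<k. of_nat n * f n)" for k
    by (induction k) (simp_all add: algebra_simps flip: lessThan_Suc_atMost)
  from this[of p] have "(\<Sum>n<p. \<Sum>m\<le>n. f m) = - (\<Sum>n<p. of_nat (Suc n) * f n)"
    using mean by (simp add: algebra_simps sum.distrib)
  finally show "L 0 = - (\<Sum>n<p. of_nat (Suc n) * f n) / of_nat p" .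
qed

end

text \<open>The reflection n -> p - n permutes a period and changes the sign of every term.\<close>

lemma odd_character_sum_zero:
  assumes "chi \<in> odd_characters p" "p > 0"
  shows "(\<Sum>n<p. chi (int (Suc n))) = 0"
proof -
  have dc: "dirichlet_character p chi" and odd: "chi (-1) = -1"
    using assms by (auto simp: odd_characters_def)
  have neg: "chi (- n) = - chi n" for n
  proof -
    have "chi (-1 * n) = chi (-1) * chi n" using dc unfolding dirichlet_character_def by blast
    then show ?thesis using odd by simp
  qed
  have "(\<Sum>n<p. chi (int (Suc n))) = (\<Sum>n<p. chi (int n))"
  proof -
    have "(\<Sum>n<Suc p. chi (int n)) = chi 0 + (\<Sum>n<p. chi (int (Suc n)))"
      by (subst sum.lessThan_Suc_shift) simp
    moreover have "chi (int p) = chi 0" by (rule dirichlet_character_cong[OF dc]) (simp add: cong_def)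
    ultimately show ?thesis by simp
  qed
  also have "\<dots> = (\<Sum>n<p. chi (int (p - Suc n)))"
    by (rule sum.nat_diff_reindex[symmetric])
  also have "\<dots> = (\<Sum>n<p. - chi (int (Suc n)))"
  proof (intro sum.cong refl)
    fix n assume "n \<in> {..<p}"
    then have "chi (int (p - Suc n)) = chi (- int (Suc n))"
      by (intro dirichlet_character_cong[OF dc]) (auto simp: cong_iff_dvd_diff of_nat_diff)
    then show "chi (int (p - Suc n)) = - chi (int (Suc n))" by (simp only: neg)
  qed
  finally show ?thesis by (simp add: sum_negf)
qed

text \<open>\<open>dirichlet_L\<close> is chosen by \<open>SOME\<close>, so the continuation just
  constructed is first needed to know that the choice has its defining properties. The identity
  theorem on the connected set of s other than 1 then carries the value at 0 over.\<close>

lemma dirichlet_L_0: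
  assumes "chi \<in> odd_characters p" "p > 0"
  shows "dirichlet_L chi 0 = - (\<Sum>n<p. of_nat (Suc n) * chi (int (Suc n))) / of_nat p"
proof -
  have dc: "dirichlet_character p chi" using assms by (auto simp: odd_characters_def)
  have per: "chi (int (Suc (n + p))) = chi (int (Suc n))" for n
    by (rule dirichlet_character_cong[OF dc]) (simp add: cong_iff_dvd_diff)
  obtain L where L: "L holomorphic_on UNIV"
    "\<And>s. Re s > 1 \<Longrightarrow> (\<lambda>n. chi (int (Suc n)) * of_nat (Suc n) powr (- s)) sums L s"
    "L 0 = - (\<Sum>n<p. of_nat (Suc n) * chi (int (Suc n))) / of_nat p"
    using periodic_L_continuation[OF assms(2), of "\<lambda>n. chi (int (Suc n))", OF per
        odd_character_sum_zero[OF assms]] by blast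
  let ?P = "\<lambda>L. L holomorphic_on (- {1}) \<and>
        (\<forall>s. Re s > 1 \<longrightarrow> (\<lambda>n. chi (int (Suc n)) * of_nat (Suc n) powr (- s)) sums L s)"
  have PL: "?P L" using L holomorphic_on_subset by blast
  then have PD: "?P (dirichlet_L chi)" unfolding dirichlet_L_def by (rule someI[of ?P])
  have "dirichlet_L chi 0 = L 0"
  proof (rule analytic_continuation_open[of "{s. Re s > 1}" "- {1}" "dirichlet_L chi" L])
    show "open {s. Re s > 1}" by (intro open_Collect_less continuous_intros)
    show "{s. Re s > 1} \<noteq> {}" by (auto intro!: exI[of _ 2])
    show "connected (- {1 :: complex})" by (rule connected_punctured_universe) simp
    show "dirichlet_L chi z = L z" if "z \<in> {s. Re s > 1}" for z
      using PD PL that sums_unique2 by blast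
  qed (use PD PL in auto)
  with L(3) show ?thesis by simp
qed

section \<open>Jacobi's triple product\<close>

definition qfact :: "complex \<Rightarrow> nat \<Rightarrow> complex" where
  "qfact q n = (\<Prod>i<n. 1 - q ^ Suc i)"

definition qbinom :: "complex \<Rightarrow> nat \<Rightarrow> nat \<Rightarrow> complex" where
  "qbinom q m k = (if k \<le> m then qfact q m / (qfact q k * qfact q (m - k)) else 0)"

definition euler_prod :: "complex \<Rightarrow> complex" where
  "euler_prod q = (\<Prod>n. 1 - q ^ Suc n)"

definition theta_prod :: "complex \<Rightarrow> complex \<Rightarrow> complex" where
  "theta_prod q u = (\<Prod>n. (1 - q ^ n * u) * (1 - q ^ Suc n / u))"

lemma one_minus_power_nonzero:
  fixes q :: complex
  assumes "norm q < 1"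
  shows "1 - q ^ Suc n \<noteq> 0"
proof
  assume "1 - q ^ Suc n = 0"
  then have "q ^ Suc n = 1" by simp
  then have "norm q ^ Suc n = 1" by (metis norm_one norm_power)
  moreover have "norm q ^ Suc n < 1" using assms by (intro power_less_one_iff[THEN iffD2]) auto
  ultimately show False by simp
qed

lemma qfact_nonzero: "norm q < 1 \<Longrightarrow> qfact q n \<noteq> 0"
  using one_minus_power_nonzero by (auto simp: qfact_def)

lemma convergent_prod_one_minus:
  fixes q c :: complex
  assumes "norm q < 1"
  shows "convergent_prod (\<lambda>n. 1 - c * q ^ n)"
proof -
  have "summable (\<lambda>n. norm c * norm q ^ n)" by (intro summable_mult summable_geometric) (use assms in auto)
  then have "abs_convergent_prod (\<lambda>n. 1 - c * q ^ n)"
    by (simp add: abs_convergent_prod_conv_summable norm_mult norm_power)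
  then show ?thesis by (rule abs_convergent_prod_imp_convergent_prod)
qed

lemma qfact_tendsto:
  assumes "norm q < 1"
  shows "qfact q \<longlonglongrightarrow> euler_prod q" "euler_prod q \<noteq> 0"
proof -
  have c: "convergent_prod (\<lambda>n. 1 - q ^ Suc n)"
    using convergent_prod_one_minus[OF assms, of q] by simp
  from convergent_prod_LIMSEQ[OF this] have "(\<lambda>n. qfact q (Suc n)) \<longlonglongrightarrow> euler_prod q"
    by (simp add: qfact_def euler_prod_def lessThan_Suc_atMost)
  then show "qfact q \<longlonglongrightarrow> euler_prod q" by (simp only: filterlim_sequentially_Suc)
  show "euler_prod q \<noteq> 0"
    unfolding euler_prod_def by (rule prodinf_nonzero[OF c]) (use one_minus_power_nonzero assms in auto)
qed

text \<open>The q-Pascal rule. With A = 1 - q^(k+1) and B = 1 - q^(m-k) it comes down to 1 - q^(m+1)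
  = 1 - (1 - A)(1 - B).\<close>

lemma qbinom_Suc_Suc:
  assumes "norm q < 1" "k \<le> m"
  shows "qbinom q (Suc m) (Suc k) = qbinom q m (Suc k) + q ^ (m - k) * qbinom q m k"
proof (cases "k = m")
  case True
  then show ?thesis using assms qfact_nonzero[OF assms(1)] by (simp add: qbinom_def)
next
  case False
  then obtain d where m: "m = k + Suc d" using assms(2) by (metis le_neq_implies_less less_imp_Suc_add add_Suc_right)
  have nz: "qfact q n \<noteq> 0" "1 - q ^ Suc n \<noteq> 0" for n
    using assms qfact_nonzero one_minus_power_nonzero by auto
  have S: "qfact q (Suc n) = qfact q n * (1 - q ^ Suc n)" for n by (simp add: qfact_def)
  have e: "q ^ (m + 1) = q ^ Suc d * q ^ Suc k" by (simp add: m power_add)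
  define A B C where "A = 1 - q ^ Suc k" and "B = 1 - q ^ Suc d" and "C = qfact q m / (qfact q k * qfact q d)"
  have AB: "A \<noteq> 0" "B \<noteq> 0" using nz by (auto simp: A_def B_def)
  have "qbinom q (Suc m) (Suc k) = qfact q (Suc m) / (qfact q (Suc k) * qfact q (Suc d))"
    by (simp add: qbinom_def m)
  also have "\<dots> = C * (1 - q ^ (m + 1)) / (A * B)"
    unfolding S by (simp add: A_def B_def C_def)
  also have "\<dots> = C * (1 - (1 - A) * (1 - B)) / (A * B)"
    unfolding e by (simp add: A_def B_def mult.commute)
  also have "\<dots> = C / A + (1 - B) * (C / B)"
    using AB by (simp add: field_simps)
  also have "\<dots> = qbinom q m (Suc k) + q ^ (m - k) * qbinom q m k"
    by (simp add: qbinom_def m S A_def B_def C_def mult_ac del: power_Suc)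
  finally show ?thesis .
qed

lemma q_binomial_theorem:
  assumes "norm q < 1"
  shows "(\<Prod>k<m. 1 + q ^ k * x) = (\<Sum>k\<le>m. q ^ (k choose 2) * qbinom q m k * x ^ k)"
proof (induction m)
  case 0
  then show ?case by (simp add: qbinom_def qfact_def binomial_eq_0)
next
  case (Suc m)
  have nz: "qfact q n \<noteq> 0" for n using assms qfact_nonzero by auto
  let ?a = "\<lambda>m k. q ^ (k choose 2) * qbinom q m k"
  have a0: "?a m 0 = 1" for m using nz by (simp add: qbinom_def qfact_def binomial_eq_0)
  have step: "?a (Suc m) (Suc k) = ?a m (Suc k) + q ^ m * ?a m k" if "k \<le> m" for k
  proof -
    have "q ^ (Suc k choose 2) * q ^ (m - k) = q ^ m * q ^ (k choose 2)"
      using that by (simp add: numeral_2_eq_2 add.commute flip: power_add)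
    then show ?thesis unfolding qbinom_Suc_Suc[OF assms that] by (simp add: algebra_simps)
  qed
  have "(\<Sum>k\<le>Suc m. ?a (Suc m) k * x ^ k) = 1 + (\<Sum>k\<le>m. ?a (Suc m) (Suc k) * x ^ Suc k)"
    by (subst sum.atMost_Suc_shift) (simp add: a0 del: power_Suc)
  also have "(\<Sum>k\<le>m. ?a (Suc m) (Suc k) * x ^ Suc k) =
      (\<Sum>k\<le>m. ?a m (Suc k) * x ^ Suc k + q ^ m * x * (?a m k * x ^ k))"
  proof (rule sum.cong)
    fix k assume "k \<in> {..m}"
    then have *: "?a (Suc m) (Suc k) = ?a m (Suc k) + q ^ m * ?a m k" by (intro step) simp
    show "?a (Suc m) (Suc k) * x ^ Suc k = ?a m (Suc k) * x ^ Suc k + q ^ m * x * (?a m k * x ^ k)"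
      unfolding * by (simp add: algebra_simps)
  qed simp
  also have "1 + \<dots> = 1 + (\<Sum>k\<le>m. ?a m (Suc k) * x ^ Suc k) + q ^ m * x * (\<Sum>k\<le>m. ?a m k * x ^ k)"
    by (simp only: sum.distrib sum_distrib_left add.assoc)
  also have "1 + (\<Sum>k\<le>m. ?a m (Suc k) * x ^ Suc k) = (\<Sum>k\<le>Suc m. ?a m k * x ^ k)"
    unfolding sum.atMost_Suc_shift a0 by simp
  also have "\<dots> = (\<Sum>k\<le>m. ?a m k * x ^ k)" by (simp add: qbinom_def)
  finally show ?case using Suc by (simp add: algebra_simps)
qed

text \<open>The q-binomial theorem with 2n factors, centred by x = -u / q^n. The last n factors
  become 1 - q^k u; from the first n, taken in reverse order, -u / q^(k+1) is pulled out and leaves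
  1 - q^(k+1) / u.\<close>

lemma theta_partial_prod:
  assumes q: "norm q < 1" "q \<noteq> 0" and u: "u \<noteq> 0"
  shows "(\<Prod>k<n. (1 - q ^ k * u) * (1 - q ^ Suc k / u)) =
    (\<Sum>j = - int n..int n. qbinom q (2 * n) (nat (int n + j)) * ((- u) powi j * q ^ nat (j * (j - 1) div 2)))"
proof -
  define x where "x = - u / q ^ n"
  define P where "P = (\<Prod>k<n. (1 - q ^ k * u) * (1 - q ^ Suc k / u))"
  have "(\<Prod>k<2 * n. 1 + q ^ k * x) = (\<Prod>k<n. 1 + q ^ k * x) * (\<Prod>k<n. 1 + q ^ (n + k) * x)"
  proof -
    have "(\<Prod>k<a + b. h k) = (\<Prod>k<a. h k) * (\<Prod>k<b. h (a + k))" for a b and h :: "nat \<Rightarrow> complex"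
      by (induction b) (simp_all add: mult_ac)
    then show ?thesis by (simp add: mult_2)
  qed
  also have "(\<Prod>k<n. 1 + q ^ (n + k) * x) = (\<Prod>k<n. 1 - q ^ k * u)"
    using q by (simp add: x_def power_add)
  also have "(\<Prod>k<n. 1 + q ^ k * x) = (\<Prod>k<n. 1 + q ^ (n - Suc k) * x)"
    by (rule prod.nat_diff_reindex[symmetric])
  also have "\<dots> = (\<Prod>k<n. - u / q ^ Suc k * (1 - q ^ Suc k / u))"
  proof (rule prod.cong)
    fix k assume "k \<in> {..<n}"
    then have "q ^ n = q ^ (n - Suc k) * q ^ Suc k" by (simp flip: power_add del: power_Suc)
    then show "1 + q ^ (n - Suc k) * x = - u / q ^ Suc k * (1 - q ^ Suc k / u)"
      using q u by (simp add: x_def field_simps)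
  qed simp
  also have "\<dots> = (\<Prod>k<n. - u / q ^ Suc k) * (\<Prod>k<n. 1 - q ^ Suc k / u)"
    by (rule prod.distrib)
  also have "(\<Prod>k<n. - u / q ^ Suc k) = (- u) ^ n / q ^ (Suc n choose 2)"
    using q by (induction n) (simp_all add: numeral_2_eq_2 power_add mult_ac)
  finally have 1: "(\<Prod>k<2 * n. 1 + q ^ k * x) = (- u) ^ n / q ^ (Suc n choose 2) * P"
    by (simp add: P_def prod.distrib)
  have "P = q ^ (Suc n choose 2) / (- u) ^ n * (\<Prod>k<2 * n. 1 + q ^ k * x)"
    unfolding 1 using q u by simp
  also have "\<dots> = (\<Sum>k\<le>2 * n. q ^ (Suc n choose 2) / (- u) ^ n * (q ^ (k choose 2) * qbinom q (2 * n) k * x ^ k))"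
    by (simp add: q_binomial_theorem[OF q(1)] sum_distrib_left)
  also have "\<dots> = (\<Sum>j = - int n..int n. qbinom q (2 * n) (nat (int n + j)) * ((- u) powi j * q ^ nat (j * (j - 1) div 2)))"
  proof (rule sum.reindex_bij_witness[of _ "\<lambda>j. nat (int n + j)" "\<lambda>k. int k - int n"])
    fix k assume "k \<in> {..2 * n}"
    define j where "j = int k - int n"
    \<comment> \<open>With k = n + j this is the completion of the square that turns q-binomial
      exponents into theta exponents j(j-1)/2.\<close>
    have e: "(k choose 2) + (Suc n choose 2) = n * k + nat (j * (j - 1) div 2)"
    proof -
      have ev: "2 * (int (m choose 2)) = int m * (int m - 1)" for m
        by (induction m) (simp_all add: numeral_2_eq_2 algebra_simps)
      have "even (j * (j - 1))" by simp
      then have "2 * (j * (j - 1) div 2) = j * (j - 1)" by simp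
      moreover have "j * (j - 1) \<ge> 0" by (cases "j \<ge> 1") (auto simp: mult_nonneg_nonneg mult_nonpos_nonpos)
      ultimately have "2 * int ((k choose 2) + (Suc n choose 2)) = 2 * int (n * k + nat (j * (j - 1) div 2))"
        using ev[of k] ev[of "Suc n"] by (simp add: j_def algebra_simps)
      then have "int ((k choose 2) + (Suc n choose 2)) = int (n * k + nat (j * (j - 1) div 2))"
        by (simp only: mult_cancel_left) simp
      then show ?thesis by (simp only: of_nat_eq_iff)
    qed
    have u': "(- u) powi j = (- u) ^ k / (- u) ^ n"
      using u by (simp add: j_def power_int_diff)
    have q': "q ^ (Suc n choose 2) * q ^ (k choose 2) = q ^ (n * k) * q ^ nat (j * (j - 1) div 2)"
      using e by (simp add: add.commute flip: power_add)
    have x': "x ^ k = (- u) ^ k / q ^ (n * k)"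
      unfolding x_def power_mult by (rule power_divide)
    have "q ^ (Suc n choose 2) / (- u) ^ n * (q ^ (k choose 2) * qbinom q (2 * n) k * x ^ k) =
        qbinom q (2 * n) k * ((- u) ^ k / (- u) ^ n * ((q ^ (Suc n choose 2) * q ^ (k choose 2)) / q ^ (n * k)))"
      unfolding x' by (simp add: mult_ac)
    also have "\<dots> = qbinom q (2 * n) k * ((- u) powi j * q ^ nat (j * (j - 1) div 2))"
      unfolding q' u' using q by simp
    finally show "qbinom q (2 * n) (nat (int n + (int k - int n))) * ((- u) powi (int k - int n) * q ^ nat ((int k - int n) * (int k - int n - 1) div 2)) =
        q ^ (Suc n choose 2) / (- u) ^ n * (q ^ (k choose 2) * qbinom q (2 * n) k * x ^ k)"
      by (simp add: j_def)
  qed auto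
  finally show ?thesis by (simp add: P_def)
qed

lemma summable_theta_terms:
  fixes r v :: real
  assumes "0 \<le> r" "r < 1" "v > 0"
  shows "(\<lambda>j :: int. v powi j * r ^ nat (j * (j - 1) div 2)) summable_on UNIV"
proof -
  have half: "summable (\<lambda>n. w ^ n * r ^ (n choose 2))" if "w \<ge> 0" for w
  proof -
    \<comment> \<open>w r^n is the ratio of consecutive terms of the half series, so the ratio test
      applies.\<close>
    have "(\<lambda>n. w * r ^ n) \<longlonglongrightarrow> w * 0"
      by (intro tendsto_intros LIMSEQ_power_zero) (use assms in auto)
    then have "eventually (\<lambda>n. w * r ^ n < 1 / 2) sequentially"
      by (intro order_tendstoD(2)[where y = "w * 0"]) auto
    then obtain N where N: "\<And>n. n \<ge> N \<Longrightarrow> w * r ^ n < 1 / 2"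
      by (auto simp: eventually_at_top_linorder)
    show ?thesis
    proof (rule summable_ratio_test[of "1/2" N])
      fix n assume n: "n \<ge> N"
      have "w ^ Suc n * r ^ (Suc n choose 2) = (w * r ^ n) * (w ^ n * r ^ (n choose 2))"
        by (simp add: numeral_2_eq_2 power_add)
      also have "\<dots> \<le> 1 / 2 * (w ^ n * r ^ (n choose 2))"
        using N[OF n] that assms by (intro mult_right_mono) auto
      finally show "norm (w ^ Suc n * r ^ (Suc n choose 2)) \<le> 1 / 2 * norm (w ^ n * r ^ (n choose 2))"
        using that assms by simp
    qed auto
  qed
  let ?f = "\<lambda>j :: int. v powi j * r ^ nat (j * (j - 1) div 2)"
  have ev: "int (m * (m - 1) div 2) = int m * (int m - 1) div 2" for m
    by (cases m) (simp_all add: zdiv_int algebra_simps)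
  have c2: "m choose 2 = m * (m - 1) div 2" for m by (rule choose_two)
  have pos: "?f summable_on range int"
  proof -
    have "(\<lambda>n. v ^ n * r ^ (n choose 2)) summable_on UNIV"
      using half[of v] assms by (subst summable_on_UNIV_nonneg_real_iff) auto
    also have "(\<lambda>n. v ^ n * r ^ (n choose 2)) = ?f \<circ> int"
      by (auto simp: fun_eq_iff c2 simp flip: ev)
    finally have "?f \<circ> int summable_on UNIV" .
    moreover have "inj int" by simp
    ultimately show ?thesis using summable_on_reindex[of int UNIV ?f] by blast
  qed
  have neg: "?f summable_on range (\<lambda>n. - int n)"
  proof -
    \<comment> \<open>For j = -n the exponent j(j-1)/2 is n + (n choose 2), so the negative half is
      the same half series with r / v in place of v.\<close>
    have "(\<lambda>n. (r / v) ^ n * r ^ (n choose 2)) summable_on UNIV"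
      using half[of "r / v"] assms by (subst summable_on_UNIV_nonneg_real_iff) auto
    also have "(\<lambda>n. (r / v) ^ n * r ^ (n choose 2)) = ?f \<circ> (\<lambda>n. - int n)"
    proof
      fix n
      have "n + (n choose 2) = Suc n choose 2" by (simp add: numeral_2_eq_2)
      also have "\<dots> = nat (int (Suc n * (Suc n - 1) div 2))" unfolding c2 by simp
      also have "int (Suc n * (Suc n - 1) div 2) = (- int n) * (- int n - 1) div 2"
        unfolding ev by (rule arg_cong[where f = "\<lambda>x. x div 2"]) (simp add: algebra_simps)
      finally have "r ^ n * r ^ (n choose 2) = r ^ nat ((- int n) * (- int n - 1) div 2)"
        by (simp flip: power_add)
      then show "(r / v) ^ n * r ^ (n choose 2) = (?f \<circ> (\<lambda>n. - int n)) n"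
        by (simp add: power_divide power_int_minus field_simps)
    qed
    finally have "?f \<circ> (\<lambda>n. - int n) summable_on UNIV" .
    moreover have "inj (\<lambda>n. - int n)" by (auto simp: inj_on_def)
    ultimately show ?thesis using summable_on_reindex[of "\<lambda>n. - int n" UNIV ?f] by blast
  qed
  have "UNIV = range int \<union> (range (\<lambda>n. - int n) - range int)"
  proof -
    have "x \<in> range int \<union> range (\<lambda>n. - int n)" for x
      by (cases x rule: int_cases2) auto
    then show ?thesis by blast
  qed
  moreover have "?f summable_on (range int \<union> (range (\<lambda>n. - int n) - range int))"
    by (rule summable_on_Un_disjoint[OF pos summable_on_subset_banach[OF neg]]) auto
  ultimately show ?thesis by simp
qed

text \<open>Let n grow in \<open>theta_partial_prod\<close>. For fixed j the q-binomial coefficient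
  tends to 1 / \<open>euler_prod q\<close>, and as \<open>qfact\<close> and its inverse are bounded,
  a constant multiple of the theta terms dominates. Tannery's theorem then exchanges limit and
  sum.\<close>

lemma jacobi_triple_product:
  assumes q: "norm q < 1" "q \<noteq> 0" and u: "u \<noteq> 0"
  shows "((\<lambda>j :: int. (- u) powi j * q ^ nat (j * (j - 1) div 2)) has_sum (euler_prod q * theta_prod q u)) UNIV"
proof -
  define t where "t j = (- u) powi j * q ^ nat (j * (j - 1) div 2)" for j
  \<comment> \<open>Extending the n-th finite sum by 0 puts all of them on the same index
    set.\<close>
  define g where "g n j = (if \<bar>j\<bar> \<le> int n then qbinom q (2 * n) (nat (int n + j)) * t j else 0)" for n j
  have E: "euler_prod q \<noteq> 0" "qfact q \<longlonglongrightarrow> euler_prod q" using qfact_tendsto[OF q(1)] by auto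
  obtain B1 where B1: "\<And>n. norm (qfact q n) \<le> B1"
    using convergent_imp_Bseq[OF convergentI[OF E(2)]] by (auto simp: Bseq_def)
  obtain B2 where B2: "\<And>n. norm (inverse (qfact q n)) \<le> B2"
    using convergent_imp_Bseq[OF convergentI[OF tendsto_inverse[OF E(2) E(1)]]] by (auto simp: Bseq_def)
  have B0: "B1 \<ge> 0" "B2 \<ge> 0" using B1[of 0] B2[of 0] norm_ge_zero order_trans by blast+
  define M where "M = B1 * B2 * B2"
  have bound: "norm (g n j) \<le> M * norm (t j)" for n j
  proof (cases "\<bar>j\<bar> \<le> int n")
    case True
    define k where "k = nat (int n + j)"
    have "k \<le> 2 * n" using True by (auto simp: k_def)
    then have "norm (qbinom q (2 * n) k) = norm (qfact q (2 * n)) * norm (inverse (qfact q k)) * norm (inverse (qfact q (2 * n - k)))"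
      by (simp add: qbinom_def norm_divide norm_mult norm_inverse divide_inverse)
    also have "\<dots> \<le> M" unfolding M_def by (intro mult_mono B1 B2 B0 mult_nonneg_nonneg norm_ge_zero)
    finally show ?thesis using True by (simp add: g_def norm_mult k_def mult_right_mono)
  next
    case False
    then show ?thesis using B0 by (simp add: g_def M_def)
  qed
  have tsum: "(\<lambda>j. norm (t j)) summable_on UNIV"
    using summable_theta_terms[of "norm q" "norm u"] q u
    by (simp add: t_def norm_mult norm_power norm_power_int)
  \<comment> \<open>Tannery's theorem is applied to series over the naturals, so the integers are
    enumerated by \<open>int_decode\<close>.\<close>
  have bij: "bij_betw int_decode UNIV UNIV" by (rule bij_int_decode)
  have "(\<lambda>k. norm (t (int_decode k))) summable_on UNIV"
    using summable_on_reindex_bij_betw[OF bij, of "\<lambda>j. norm (t j)"] tsum by simp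
  then have summ: "summable (\<lambda>k. M * norm (t (int_decode k)))"
    by (intro summable_mult) (simp add: summable_on_UNIV_nonneg_real_iff)
  have lim: "(\<lambda>n. g n j) \<longlonglongrightarrow> t j / euler_prod q" for j
  proof -
    have f: "filterlim (\<lambda>n. nat (int n + j)) sequentially sequentially" for j
    proof (unfold filterlim_at_top, intro allI)
      fix Z
      show "\<forall>\<^sub>F n in sequentially. Z \<le> nat (int n + j)"
        using eventually_ge_at_top[of "Z + nat \<bar>j\<bar>"] by eventually_elim auto
    qed
    have l2: "(\<lambda>n. qfact q (2 * n)) \<longlonglongrightarrow> euler_prod q"
      by (rule filterlim_compose[OF E(2)]) (rule mult_nat_left_at_top, simp)
    have "(\<lambda>n. qfact q (2 * n) / (qfact q (nat (int n + j)) * qfact q (nat (int n + - j))) * t j)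
        \<longlonglongrightarrow> euler_prod q / (euler_prod q * euler_prod q) * t j"
      by (intro tendsto_intros l2 filterlim_compose[OF E(2) f]) (use E in auto)
    also have "euler_prod q / (euler_prod q * euler_prod q) * t j = t j / euler_prod q" using E by simp
    finally show ?thesis
    proof (rule Lim_transform_eventually)
      show "\<forall>\<^sub>F n in sequentially. qfact q (2 * n) / (qfact q (nat (int n + j)) * qfact q (nat (int n + - j))) * t j = g n j"
        using eventually_ge_at_top[of "nat \<bar>j\<bar>"]
      proof eventually_elim
        case (elim n)
        then have "nat (int n + j) \<le> 2 * n" "2 * n - nat (int n + j) = nat (int n + - j)" "\<bar>j\<bar> \<le> int n" by auto
        then show ?case by (simp add: g_def qbinom_def)
      qed
    qed
  qed
  have tan: "summable (\<lambda>k. norm (t (int_decode k) / euler_prod q)) \<and>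
     (\<lambda>n. \<Sum>k. g n (int_decode k)) \<longlonglongrightarrow> (\<Sum>k. t (int_decode k) / euler_prod q)"
    using tannerys_theorem[of "\<lambda>k n. g n (int_decode k)" "\<lambda>k. t (int_decode k) / euler_prod q" sequentially
        "\<lambda>k. M * norm (t (int_decode k))"] lim bound summ
    by (simp add: always_eventually)
  have fin: "(\<Sum>k. g n (int_decode k)) = (\<Prod>k<n. (1 - q ^ k * u) * (1 - q ^ Suc k / u))" for n
  proof -
    have "(\<Sum>k. g n (int_decode k)) = (\<Sum>k\<in>int_encode ` {- int n..int n}. g n (int_decode k))"
      by (rule suminf_finite) (auto simp: g_def abs_le_iff image_iff, metis atLeastAtMost_iff int_decode_inverse minus_le_iff)
    also have "\<dots> = (\<Sum>j = - int n..int n. g n j)"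
      by (subst sum.reindex) (auto simp: inj_int_encode)
    also have "\<dots> = (\<Sum>j = - int n..int n. qbinom q (2 * n) (nat (int n + j)) * ((- u) powi j * q ^ nat (j * (j - 1) div 2)))"
      by (intro sum.cong) (auto simp: g_def t_def)
    finally show ?thesis using theta_partial_prod[OF q u] by simp
  qed
  have th: "(\<lambda>n. \<Prod>k<n. (1 - q ^ k * u) * (1 - q ^ Suc k / u)) \<longlonglongrightarrow> theta_prod q u"
  proof -
    have "convergent_prod (\<lambda>k. (1 - q ^ k * u) * (1 - q ^ Suc k / u))"
      using convergent_prod_mult[OF convergent_prod_one_minus[OF q(1), of u] convergent_prod_one_minus[OF q(1), of "q / u"]]
      by (simp add: mult_ac)
    from convergent_prod_LIMSEQ[OF this] show ?thesis
      unfolding theta_prod_def by (subst (asm) lessThan_Suc_atMost[symmetric]) (rule LIMSEQ_imp_Suc)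
  qed
  have "theta_prod q u = (\<Sum>k. t (int_decode k) / euler_prod q)"
    using LIMSEQ_unique[OF th] conjunct2[OF tan] unfolding fin by blast
  moreover have sm: "summable (\<lambda>k. norm (t (int_decode k)))"
    using summable_mult[OF conjunct1[OF tan], of "norm (euler_prod q)"] E by (simp add: norm_divide)
  ultimately have "euler_prod q * theta_prod q u = (\<Sum>k. t (int_decode k))"
    using E summable_norm_cancel[OF sm] by (simp add: suminf_divide)
  moreover have "((\<lambda>k. t (int_decode k)) has_sum (\<Sum>k. t (int_decode k))) UNIV"
    by (rule norm_summable_imp_has_sum[OF sm summable_sums[OF summable_norm_cancel[OF sm]]])
  ultimately show ?thesis
    using has_sum_reindex_bij_betw[OF bij, of t] unfolding t_def by simp
qed

section \<open>The theta function of a lattice\<close>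

text \<open>All zeros of g are simple and shared by f, so each singularity of f / g is removable;
  the quotient of derivatives is the value forced there.\<close>

lemma entire_quotient:
  fixes f g :: "complex \<Rightarrow> complex"
  assumes f: "f holomorphic_on UNIV" and g: "g holomorphic_on UNIV"
    and z: "\<And>z. g z = 0 \<Longrightarrow> f z = 0 \<and> deriv g z \<noteq> 0"
  obtains h where "h holomorphic_on UNIV" "\<And>z. f z = h z * g z"
proof
  define h where "h z = (if g z = 0 then deriv f z / deriv g z else f z / g z)" for z
  have eq: "f z = h z * g z" for z using z[of z] by (simp add: h_def)
  then show "f z = h z * g z" for z .
  have df: "(f has_field_derivative deriv f z) (at z)" and dg: "(g has_field_derivative deriv g z) (at z)" for z
    using f g by (auto intro: holomorphic_derivI)
  have cg: "open (- {z. g z = 0})"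
  proof -
    have "closed (g -` {0})"
      by (rule continuous_closed_vimage) (use dg in \<open>auto intro: DERIV_isCont\<close>)
    then show ?thesis by (simp add: vimage_def open_Compl)
  qed
  have off: "h holomorphic_on - {z. g z = 0}"
  proof (rule holomorphic_transform)
    show "(\<lambda>z. f z / g z) holomorphic_on - {z. g z = 0}"
      by (intro holomorphic_intros holomorphic_on_subset[OF f] holomorphic_on_subset[OF g]) auto
  qed (auto simp: h_def)
  have "h field_differentiable at w" for w
  proof (cases "g w = 0")
    case False
    then show ?thesis using off cg holomorphic_on_imp_differentiable_at by blast
  next
    case True
    have lg: "((\<lambda>z. g z / (z - w)) \<longlongrightarrow> deriv g w) (at w)"
      using dg[of w] True by (simp add: has_field_derivative_iff)
    have lf: "((\<lambda>z. f z / (z - w)) \<longlongrightarrow> deriv f w) (at w)"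
      using df[of w] z[OF True] by (simp add: has_field_derivative_iff)
    have "\<forall>\<^sub>F t in at w. g t / (t - w) \<noteq> 0"
      by (rule tendsto_imp_eventually_ne[OF lg]) (use z[OF True] in auto)
    then have ev: "\<forall>\<^sub>F t in at w. g t \<noteq> 0" by eventually_elim auto
    then obtain S where S: "open S" "w \<in> S" "\<And>t. t \<in> S \<Longrightarrow> t \<noteq> w \<Longrightarrow> g t \<noteq> 0"
      by (auto simp: eventually_at_topological)
    have "((\<lambda>z. (f z / (z - w)) / (g z / (z - w))) \<longlongrightarrow> deriv f w / deriv g w) (at w)"
      by (intro tendsto_intros lf lg) (use z[OF True] in auto)
    moreover have "\<forall>\<^sub>F t in at w. (f t / (t - w)) / (g t / (t - w)) = h t"
      using ev eventually_neq_at_within[of w w] by eventually_elim (simp add: h_def)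
    ultimately have "(h \<longlongrightarrow> deriv f w / deriv g w) (at w)"
      by (rule Lim_transform_eventually)
    then have "(h \<longlongrightarrow> h w) (at w within S)"
      using True by (simp add: h_def Lim_at_imp_Lim_at_within)
    then have lim: "(h \<longlongrightarrow> h z) (at z within S)" if "z \<in> {w}" for z using that by simp
    have "h holomorphic_on S - {w}" by (rule holomorphic_on_subset[OF off]) (use S(3) in blast)
    from no_isolated_singularity'[OF lim this S(1)] have "h holomorphic_on S" by simp
    then show ?thesis using S holomorphic_on_imp_differentiable_at by blast
  qed
  then show "h holomorphic_on UNIV"
    by (simp add: holomorphic_on_def field_differentiable_at_within)
qed

text \<open>Every value is already taken on the compact period parallelogram, so f is bounded and
  Liouville's theorem applies.\<close>

lemma entire_elliptic_constant:
  fixes f :: "complex \<Rightarrow> complex"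
  assumes f: "f holomorphic_on UNIV" and \<tau>: "Im \<tau> > 0"
    and p1: "\<And>x. f (x + 1) = f x" and pt: "\<And>x. f (x + \<tau>) = f x"
  obtains c where "\<And>x. f x = c"
proof -
  have p1n: "f (x + of_nat n) = f x" for x n
    by (induction n) (use p1 in \<open>simp_all add: add.assoc[symmetric] add.commute[of 1]\<close>)
  have ptn: "f (x + of_nat n * \<tau>) = f x" for x n
  proof (induction n)
    case (Suc n)
    show ?case using pt[of "x + of_nat n * \<tau>"] Suc by (simp add: algebra_simps)
  qed simp
  have p1i: "f (x + of_int n) = f x" for x n
    using p1n[of x "nat n"] p1n[of "x + of_int n" "nat (- n)"] by (cases "n \<ge> 0") auto
  have pti: "f (x + of_int n * \<tau>) = f x" for x n
    using ptn[of x "nat n"] ptn[of "x + of_int n * \<tau>" "nat (- n)"] by (cases "n \<ge> 0") auto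
  define K where "K = (\<lambda>(a, b). of_real a + of_real b * \<tau>) ` ({0..1} \<times> {0..1 :: real})"
  have "compact K" unfolding K_def
    by (intro compact_continuous_image compact_Times compact_Icc)
       (auto intro!: continuous_intros simp: case_prod_beta)
  then have "compact (f ` K)"
    using f by (intro compact_continuous_image) (auto intro: holomorphic_on_imp_continuous_on holomorphic_on_subset)
  moreover have "range f \<subseteq> f ` K"
  proof safe
    fix x
    define b where "b = Im x / Im \<tau>"
    define a where "a = Re x - b * Re \<tau>"
    have x: "x = of_real a + of_real b * \<tau>" using \<tau> by (simp add: complex_eq_iff a_def b_def)
    have fx: "f (x + of_int (- \<lfloor>a\<rfloor>) + of_int (- \<lfloor>b\<rfloor>) * \<tau>) = f x" by (simp only: p1i pti)
    have "x + of_int (- \<lfloor>a\<rfloor>) + of_int (- \<lfloor>b\<rfloor>) * \<tau> = of_real (frac a) + of_real (frac b) * \<tau>"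
      by (simp add: x frac_def algebra_simps)
    also have "\<dots> \<in> K" unfolding K_def
      using frac_lt_1[of a] frac_lt_1[of b]
      by (intro image_eqI[where x = "(frac a, frac b)"]) (auto intro: less_imp_le)
    finally have k: "x + of_int (- \<lfloor>a\<rfloor>) + of_int (- \<lfloor>b\<rfloor>) * \<tau> \<in> K" .
    show "f x \<in> f ` K" using imageI[OF k, of f] unfolding fx .
  qed
  ultimately have "bounded (range f)" using bounded_subset compact_imp_bounded by blast
  from Liouville_theorem[OF f this] show thesis using that by (auto simp: constant_on_def)
qed

section \<open>Infinite products, zeros and quasi-periods of theta\<close>

definition qpoch :: "complex \<Rightarrow> complex \<Rightarrow> complex" where
  "qpoch q u = (\<Prod>n. 1 - q ^ n * u)"

lemma convergent_prod_qpoch: "norm q < 1 \<Longrightarrow> convergent_prod (\<lambda>n. 1 - q ^ n * u)"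
  for q u :: complex
  using convergent_prod_one_minus[of q u] by (simp add: mult.commute)

lemma qpoch_LIMSEQ:
  assumes "norm q < 1"
  shows "(\<lambda>N. \<Prod>n<N. 1 - q ^ n * u) \<longlonglongrightarrow> qpoch q u"
  using convergent_prod_LIMSEQ[OF convergent_prod_qpoch[OF assms, of u]]
  unfolding qpoch_def by (subst (asm) lessThan_Suc_atMost[symmetric]) (rule LIMSEQ_imp_Suc)

lemma qpoch_uniform_limit:
  assumes "norm q < 1"
  shows "uniform_limit (cball 0 R) (\<lambda>N u. \<Prod>n<N. 1 - q ^ n * u) (qpoch q) sequentially"
proof -
  have "uniformly_convergent_on (cball 0 R) (\<lambda>N u. \<Prod>n<N. 1 - q ^ n * u)"
  proof (rule uniformly_convergent_on_prod')
    show "uniformly_convergent_on (cball 0 R) (\<lambda>N u. \<Sum>n<N. norm (1 - q ^ n * u - 1))"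
    proof (rule Weierstrass_m_test'[where M = "\<lambda>n. norm q ^ n * \<bar>R\<bar>"])
      show "summable (\<lambda>n. norm q ^ n * \<bar>R\<bar>)"
        by (intro summable_mult2 summable_geometric) (use assms in auto)
    qed (auto simp: norm_mult norm_power intro!: mult_left_mono)
  qed (auto intro!: continuous_intros)
  then have "uniform_limit (cball 0 R) (\<lambda>N u. \<Prod>n<N. 1 - q ^ n * u)
      (\<lambda>u. lim (\<lambda>N. \<Prod>n<N. 1 - q ^ n * u)) sequentially"
    by (simp add: uniformly_convergent_uniform_limit_iff)
  moreover have "lim (\<lambda>N. \<Prod>n<N. 1 - q ^ n * u) = qpoch q u" for u
    by (intro limI qpoch_LIMSEQ assms)
  ultimately show ?thesis by simp
qed

lemma qpoch_holomorphic:
  assumes "norm q < 1"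
  shows "qpoch q holomorphic_on UNIV"
proof (rule holomorphic_uniform_sequence[where f = "\<lambda>N u. \<Prod>n<N. 1 - q ^ n * u"])
  fix x :: complex
  have "cball x 1 \<subseteq> cball 0 (norm x + 1)"
    by (auto simp: dist_norm) (metis add.commute add_le_cancel_left norm_minus_commute norm_triangle_sub order_trans)
  then show "\<exists>d>0. cball x d \<subseteq> UNIV \<and> uniform_limit (cball x d) (\<lambda>N u. \<Prod>n<N. 1 - q ^ n * u) (qpoch q) sequentially"
    using uniform_limit_on_subset[OF qpoch_uniform_limit[OF assms]] by (intro exI[of _ 1]) auto
qed (auto intro!: holomorphic_intros)

lemma qpoch_shift:
  assumes "norm q < 1"
  shows "qpoch q u = (1 - u) * qpoch q (q * u)"
proof -
  have "(\<lambda>N. (1 - u) * (\<Prod>n<N. 1 - q ^ n * (q * u))) \<longlonglongrightarrow> (1 - u) * qpoch q (q * u)"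
    by (intro tendsto_intros qpoch_LIMSEQ assms)
  moreover have "(\<Prod>n<Suc N. 1 - q ^ n * u) = (1 - u) * (\<Prod>n<N. 1 - q ^ n * (q * u))" for N
    by (subst prod.lessThan_Suc_shift) (simp add: mult_ac)
  ultimately have "(\<lambda>N. \<Prod>n<Suc N. 1 - q ^ n * u) \<longlonglongrightarrow> (1 - u) * qpoch q (q * u)"
    by simp
  then show ?thesis using LIMSEQ_unique LIMSEQ_Suc[OF qpoch_LIMSEQ[OF assms, of u]] by blast
qed

lemma qpoch_eq_0_iff:
  assumes "norm q < 1"
  shows "qpoch q u = 0 \<longleftrightarrow> (\<exists>n. q ^ n * u = 1)"
proof
  assume "qpoch q u = 0"
  then show "\<exists>n. q ^ n * u = 1"
    using prodinf_nonzero[OF convergent_prod_qpoch[OF assms, of u]] by (auto simp: qpoch_def)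
next
  assume "\<exists>n. q ^ n * u = 1"
  then obtain n where "q ^ n * u = 1" by blast
  moreover have "q ^ n * u = 1 \<Longrightarrow> qpoch q u = 0" for n u
  proof (induction n arbitrary: u)
    case 0
    then show ?case using qpoch_shift[OF assms, of u] by simp
  next
    case (Suc n)
    then show ?case using qpoch_shift[OF assms, of u] Suc.IH[of "q * u"] by (simp add: mult_ac)
  qed
  ultimately show "qpoch q u = 0" by blast
qed

lemma qpoch_self: "qpoch q q = euler_prod q"
  by (simp add: qpoch_def euler_prod_def mult.commute)

lemma theta_prod_eq_qpoch:
  assumes "norm q < 1"
  shows "theta_prod q u = qpoch q u * qpoch q (q / u)"
  unfolding theta_prod_def qpoch_def
  using prodinf_mult[OF convergent_prod_qpoch[OF assms, of u] convergent_prod_qpoch[OF assms, of "q / u"]]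
  by (simp add: mult_ac)

text \<open>Isolates the zero at u = 1. The remaining factor is invariant under u -> 1/u, which
  yields the inversion law, and its value at u = 1 will give theta'(0).\<close>

lemma theta_prod_factor:
  assumes "norm q < 1"
  shows "theta_prod q u = (1 - u) * (qpoch q (q * u) * qpoch q (q / u))"
  using qpoch_shift[OF assms, of u] by (simp add: theta_prod_eq_qpoch[OF assms] mult_ac)

lemma theta_prod_inverse:
  assumes "norm q < 1" "u \<noteq> 0"
  shows "theta_prod q (1 / u) = - theta_prod q u / u"
  using assms by (simp add: theta_prod_factor field_simps)

lemma theta_prod_mult_q:
  assumes "norm q < 1" "u \<noteq> 0" "q \<noteq> 0"
  shows "theta_prod q (q * u) = - theta_prod q u / u"
proof -
  have "theta_prod q (q * u) = qpoch q (q * u) * qpoch q (1 / u)"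
    using assms by (simp add: theta_prod_eq_qpoch)
  also have "qpoch q (1 / u) = (1 - 1 / u) * qpoch q (q / u)"
    using qpoch_shift[OF assms(1), of "1 / u"] by simp
  finally show ?thesis using assms by (simp add: theta_prod_factor[of q u] field_simps)
qed

lemma nome_add: "nome (x + y) = nome x * nome y"
  by (simp add: nome_def exp_add ring_distribs)

lemma nome_minus: "nome (- x) = inverse (nome x)"
  by (simp add: nome_def exp_minus)

lemma nome_nonzero [simp]: "nome x \<noteq> 0" by (simp add: nome_def)

lemma nome_eq_1_iff: "nome x = 1 \<longleftrightarrow> (\<exists>n. x = of_int n)"
  unfolding nome_def exp_eq_1 by (auto simp: complex_eq_iff)

lemma nome_of_int [simp]: "nome (of_int n) = 1"
  by (auto simp: nome_eq_1_iff)

lemma nome_0 [simp]: "nome 0 = 1" by (simp add: nome_def)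

lemma nome_mult_of_nat: "nome (of_nat n * x) = nome x ^ n"
  by (simp add: nome_def mult_ac flip: exp_of_nat_mult)

lemma norm_nome_less_1: "Im \<tau> > 0 \<Longrightarrow> norm (nome \<tau>) < 1"
  by (simp add: nome_def)

lemma nome_has_field_derivative [derivative_intros]:
  assumes "(f has_field_derivative f') (at x within A)"
  shows "((\<lambda>x. nome (f x)) has_field_derivative (2 * of_real pi * \<i> * f' * nome (f x))) (at x within A)"
  unfolding nome_def using assms by (auto intro!: derivative_eq_intros)

lemma nome_holomorphic [holomorphic_intros]: "f holomorphic_on A \<Longrightarrow> (\<lambda>x. nome (f x)) holomorphic_on A"
  unfolding nome_def by (intro holomorphic_intros)

text \<open>The classical odd theta function without its exponential prefactor. Period 1 thus holds
  exactly, at the price of theta(-x) = - \<open>nome (- x)\<close> theta(x); the stray 2 pi i in the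
  addition formula comes from this.\<close>

definition theta_fun :: "complex \<Rightarrow> complex \<Rightarrow> complex" where
  "theta_fun \<tau> x = theta_prod (nome \<tau>) (nome x)"

context
  fixes \<tau> :: complex
  assumes \<tau>: "Im \<tau> > 0"
begin

lemma norm_q: "norm (nome \<tau>) < 1" using \<tau> by (rule norm_nome_less_1)

lemma theta_fun_holomorphic: "theta_fun \<tau> holomorphic_on UNIV"
proof -
  have "(qpoch (nome \<tau>) \<circ> nome) holomorphic_on UNIV" "(qpoch (nome \<tau>) \<circ> (\<lambda>x. nome \<tau> / nome x)) holomorphic_on UNIV"
    by (rule holomorphic_on_compose_gen[OF _ qpoch_holomorphic[OF norm_q]];
        auto intro!: holomorphic_intros)+
  then show ?thesis
    unfolding theta_fun_def theta_prod_eq_qpoch[OF norm_q] o_def by (intro holomorphic_intros)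
qed

lemma theta_fun_has_field_derivative:
  "(theta_fun \<tau> has_field_derivative deriv (theta_fun \<tau>) x) (at x within A)"
  using theta_fun_holomorphic by (rule holomorphic_derivI) auto

lemma theta_fun_add_1: "theta_fun \<tau> (x + 1) = theta_fun \<tau> x"
  using nome_of_int[of 1] by (simp add: theta_fun_def nome_add)

lemma theta_fun_add_tau: "theta_fun \<tau> (x + \<tau>) = - nome (- x) * theta_fun \<tau> x"
  using theta_prod_mult_q[OF norm_q, of "nome x"]
  by (simp add: theta_fun_def nome_add nome_minus mult.commute divide_inverse)

lemma theta_fun_minus: "theta_fun \<tau> (- x) = - nome (- x) * theta_fun \<tau> x"
  using theta_prod_inverse[OF norm_q, of "nome x"]
  by (simp add: theta_fun_def nome_minus divide_inverse mult.commute)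

text \<open>The product in u supplies the lattice points with n <= 0, the product in q / u those
  with n > 0.\<close>

lemma theta_fun_eq_0_iff: "theta_fun \<tau> x = 0 \<longleftrightarrow> (\<exists>m n. x = of_int m + of_int n * \<tau>)"
proof
  assume "theta_fun \<tau> x = 0"
  then have "(\<exists>n. nome \<tau> ^ n * nome x = 1) \<or> (\<exists>n. nome \<tau> ^ n * (nome \<tau> / nome x) = 1)"
    by (simp add: theta_fun_def theta_prod_eq_qpoch norm_q qpoch_eq_0_iff)
  then show "\<exists>m n. x = of_int m + of_int n * \<tau>"
  proof (elim disjE exE)
    fix n assume "nome \<tau> ^ n * nome x = 1"
    then have "nome (of_nat n * \<tau> + x) = 1" by (simp add: nome_add nome_mult_of_nat)
    then obtain m where "of_nat n * \<tau> + x = of_int m" by (auto simp: nome_eq_1_iff)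
    then have "x = of_int m + of_int (- int n) * \<tau>" by (simp add: algebra_simps)
    then show ?thesis by blast
  next
    fix n assume "nome \<tau> ^ n * (nome \<tau> / nome x) = 1"
    then have "nome (of_nat (Suc n) * \<tau> + - x) = 1"
      unfolding nome_add nome_mult_of_nat nome_minus by (simp add: divide_inverse mult_ac)
    then obtain m where m: "of_nat (Suc n) * \<tau> + - x = of_int m" unfolding nome_eq_1_iff by blast
    have "x = of_nat (Suc n) * \<tau> - (of_nat (Suc n) * \<tau> + - x)" by simp
    also have "\<dots> = of_int (- m) + of_int (int (Suc n)) * \<tau>" unfolding m by simp
    finally show ?thesis by blast
  qed
next
  have zero: "theta_fun \<tau> 0 = 0" by (simp add: theta_fun_def theta_prod_factor norm_q)
  have "theta_fun \<tau> (x + \<tau>) = 0 \<longleftrightarrow> theta_fun \<tau> x = 0" for x by (simp add: theta_fun_add_tau)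
  then have s: "theta_fun \<tau> (of_int n * \<tau>) = 0" for n
  proof (induction n rule: int_induct[where k = 0])
    case (step1 i)
    then show ?case using step1(3)[of "of_int i * \<tau>"] by (simp add: algebra_simps)
  next
    case (step2 i)
    then show ?case using step2(3)[of "of_int (i - 1) * \<tau>"] by (simp add: algebra_simps)
  qed (simp add: zero)
  assume "\<exists>m n. x = of_int m + of_int n * \<tau>"
  then show "theta_fun \<tau> x = 0" using s by (auto simp: theta_fun_def nome_add)
qed

lemma deriv_theta_fun_0: "deriv (theta_fun \<tau>) 0 = - (2 * of_real pi * \<i>) * euler_prod (nome \<tau>) ^ 2"
proof -
  let ?q = "nome \<tau>"
  have dq: "(qpoch ?q has_field_derivative deriv (qpoch ?q) u) (at u within A)" for u A
    by (rule holomorphic_derivI[OF qpoch_holomorphic[OF norm_q]]) auto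
  define R where "R x = qpoch ?q (?q * nome x) * qpoch ?q (?q / nome x)" for x
  have "R holomorphic_on UNIV"
  proof -
    have "(qpoch ?q \<circ> (\<lambda>x. ?q * nome x)) holomorphic_on UNIV" "(qpoch ?q \<circ> (\<lambda>x. ?q / nome x)) holomorphic_on UNIV"
      by (rule holomorphic_on_compose_gen[OF _ qpoch_holomorphic[OF norm_q]];
          auto intro!: holomorphic_intros)+
    then show ?thesis unfolding R_def o_def by (intro holomorphic_intros)
  qed
  then have dR: "(R has_field_derivative deriv R 0) (at 0)" by (rule holomorphic_derivI) auto
  have "theta_fun \<tau> = (\<lambda>x. (1 - nome x) * R x)"
    by (simp add: fun_eq_iff theta_fun_def theta_prod_factor norm_q R_def)
  moreover have "((\<lambda>x. (1 - nome x) * R x) has_field_derivative (- (2 * of_real pi * \<i>) * R 0)) (at 0)"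
    by (auto intro!: derivative_eq_intros dR)
  moreover have "R 0 = euler_prod ?q ^ 2" by (simp add: R_def qpoch_self power2_eq_square)
  ultimately show ?thesis by (simp add: DERIV_imp_deriv)
qed

text \<open>Later arguments only use that the multiplier is the exponential of an affine function,
  so its coefficients stay existential.\<close>

lemma theta_fun_quasiperiod:
  "\<exists>a b. \<forall>x. theta_fun \<tau> (x + of_int m + of_int n * \<tau>) = exp (a + b * x) * theta_fun \<tau> x"
proof (induction n rule: int_induct[where k = 0])
  case base
  show ?case by (intro exI[of _ 0]) (simp add: theta_fun_def nome_add)
next
  case (step1 i)
  then obtain a b where ab: "theta_fun \<tau> (x + of_int m + of_int i * \<tau>) = exp (a + b * x) * theta_fun \<tau> x" for x by blast
  show ?case
  proof (intro exI allI)
    fix x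
    have "theta_fun \<tau> (x + of_int m + of_int (i + 1) * \<tau>) = theta_fun \<tau> ((x + of_int m + of_int i * \<tau>) + \<tau>)"
      by (simp add: algebra_simps)
    \<comment> \<open>The sign -1 is written as exp(pi i), so that it can be absorbed into the
      exponent.\<close>
    also have "\<dots> = exp (of_real pi * \<i>) * exp (- (2 * of_real pi * \<i>) * (x + of_int m + of_int i * \<tau>)) * (exp (a + b * x) * theta_fun \<tau> x)"
      unfolding theta_fun_add_tau ab nome_def minus_mult_commute by simp
    also have "\<dots> = exp (of_real pi * \<i> + - (2 * of_real pi * \<i>) * (x + of_int m + of_int i * \<tau>) + (a + b * x)) * theta_fun \<tau> x"
      by (simp only: exp_add mult.assoc)
    also have "of_real pi * \<i> + - (2 * of_real pi * \<i>) * (x + of_int m + of_int i * \<tau>) + (a + b * x) =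
        (of_real pi * \<i> + a - 2 * of_real pi * \<i> * (of_int m + of_int i * \<tau>)) + (b - 2 * of_real pi * \<i>) * x"
      by (simp add: algebra_simps)
    finally show "theta_fun \<tau> (x + of_int m + of_int (i + 1) * \<tau>) = exp ((of_real pi * \<i> + a - 2 * of_real pi * \<i> * (of_int m + of_int i * \<tau>)) + (b - 2 * of_real pi * \<i>) * x) * theta_fun \<tau> x" .
  qed
next
  case (step2 i)
  then obtain a b where ab: "theta_fun \<tau> (x + of_int m + of_int i * \<tau>) = exp (a + b * x) * theta_fun \<tau> x" for x by blast
  show ?case
  proof (intro exI allI)
    fix x
    define y where "y = x + of_int m + of_int (i - 1) * \<tau>"
    have "theta_fun \<tau> (y + \<tau>) = exp (a + b * x) * theta_fun \<tau> x"
      using ab[of x] by (simp add: y_def algebra_simps)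
    then have e: "- nome (- y) * theta_fun \<tau> y = exp (a + b * x) * theta_fun \<tau> x"
      unfolding theta_fun_add_tau .
    have "theta_fun \<tau> y = - nome y * (exp (a + b * x) * theta_fun \<tau> x)"
      unfolding e[symmetric] by (simp add: nome_minus)
    also have "\<dots> = exp (of_real pi * \<i>) * exp (2 * of_real pi * \<i> * y) * (exp (a + b * x) * theta_fun \<tau> x)"
      by (simp add: nome_def)
    also have "\<dots> = exp (of_real pi * \<i> + 2 * of_real pi * \<i> * y + (a + b * x)) * theta_fun \<tau> x"
      by (simp only: exp_add mult.assoc)
    also have "of_real pi * \<i> + 2 * of_real pi * \<i> * y + (a + b * x) =
        (of_real pi * \<i> + a + 2 * of_real pi * \<i> * (of_int m + of_int (i - 1) * \<tau>)) + (b + 2 * of_real pi * \<i>) * x"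
      by (simp add: y_def algebra_simps)
    finally show "theta_fun \<tau> (x + of_int m + of_int (i - 1) * \<tau>) = exp ((of_real pi * \<i> + a + 2 * of_real pi * \<i> * (of_int m + of_int (i - 1) * \<tau>)) + (b + 2 * of_real pi * \<i>) * x) * theta_fun \<tau> x"
      by (simp add: y_def)
  qed
qed

text \<open>Quasi-periodicity transports the derivative from 0, where it is a multiple of the
  squared Euler product, to every lattice point.\<close>

lemma theta_fun_simple_zeros:
  assumes "theta_fun \<tau> x = 0"
  shows "deriv (theta_fun \<tau>) x \<noteq> 0"
proof -
  obtain m n where x: "x = of_int m + of_int n * \<tau>" using assms theta_fun_eq_0_iff by blast
  obtain a b where ab: "theta_fun \<tau> (t + of_int m + of_int n * \<tau>) = exp (a + b * t) * theta_fun \<tau> t" for t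
    using theta_fun_quasiperiod by blast
  have zero: "theta_fun \<tau> 0 = 0" by (simp add: theta_fun_def theta_prod_factor norm_q)
  have "((\<lambda>t. theta_fun \<tau> (t + x)) has_field_derivative deriv (theta_fun \<tau>) x) (at 0)"
    using theta_fun_has_field_derivative[of x UNIV] by (simp flip: DERIV_shift)
  moreover have e: "(\<lambda>t. theta_fun \<tau> (t + x)) = (\<lambda>t. exp (a + b * t) * theta_fun \<tau> t)"
    using ab by (simp add: x add.assoc)
  moreover have d: "((\<lambda>t. exp (a + b * t) * theta_fun \<tau> t) has_field_derivative exp a * deriv (theta_fun \<tau>) 0) (at 0)"
    by (auto intro!: derivative_eq_intros theta_fun_has_field_derivative simp: zero)
  ultimately have "deriv (theta_fun \<tau>) x = exp a * deriv (theta_fun \<tau>) 0"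
    by (intro DERIV_unique[OF _ d]) (simp only:)
  then show ?thesis using qfact_tendsto(2)[OF norm_q] by (simp add: deriv_theta_fun_0)
qed

end

section \<open>Modular transformations\<close>

text \<open>The logarithmic derivative of h is entire and changes by constants under both periods,
  so its own derivative is elliptic and hence constant. Integrating twice gives a quadratic
  exponent.\<close>

lemma entire_gaussian:
  fixes h :: "complex \<Rightarrow> complex"
  assumes h: "h holomorphic_on UNIV" and nz: "\<And>x. h x \<noteq> 0" and \<tau>: "Im \<tau> > 0"
    and h1: "\<And>x. h (x + 1) = exp (a + b * x) * h x"
    and ht: "\<And>x. h (x + \<tau>) = exp (a' + b' * x) * h x"
  obtains \<alpha> \<beta> c where "c \<noteq> 0" "\<And>x. h x = c * exp (\<alpha> * x\<^sup>2 + \<beta> * x)"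
proof -
  define l where "l x = deriv h x / h x" for x
  have dh: "(h has_field_derivative deriv h x) (at x)" for x
    using h by (rule holomorphic_derivI) auto
  have lh: "l holomorphic_on UNIV" unfolding l_def
    by (intro holomorphic_intros h nz holomorphic_deriv) auto
  have shift: "l (x + t) = l x + b" if ht: "\<And>x. h (x + t) = exp (a + b * x) * h x" for x t a b
  proof -
    have d1: "((\<lambda>x. h (x + t)) has_field_derivative deriv h (x + t)) (at x)"
      using dh[of "x + t"] by (simp add: DERIV_shift)
    have d2: "((\<lambda>x. exp (a + b * x) * h x) has_field_derivative
        (exp (a + b * x) * b * h x + exp (a + b * x) * deriv h x)) (at x)"
      by (auto intro!: derivative_eq_intros dh)
    have "deriv h (x + t) = exp (a + b * x) * b * h x + exp (a + b * x) * deriv h x"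
      by (rule DERIV_unique[OF d1[unfolded ht] d2])
    then have "l (x + t) = (exp (a + b * x) * b * h x + exp (a + b * x) * deriv h x) / (exp (a + b * x) * h x)"
      by (simp only: l_def ht)
    also have "\<dots> = l x + b" using nz[of x] by (simp add: l_def field_simps)
    finally show ?thesis .
  qed
  have dl: "(l has_field_derivative deriv l x) (at x)" for x
    using lh by (rule holomorphic_derivI) auto
  have dshift: "deriv l (x + t) = deriv l x" if "\<And>x. l (x + t) = l x + b" for x t b
  proof -
    have "((\<lambda>x. l (x + t)) has_field_derivative deriv l (x + t)) (at x)"
      using dl[of "x + t"] by (simp add: DERIV_shift)
    moreover have "((\<lambda>x. l x + b) has_field_derivative deriv l x) (at x)"
      by (auto intro!: derivative_eq_intros dl)
    ultimately show ?thesis unfolding that by (rule DERIV_unique)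
  qed
  have "deriv l holomorphic_on UNIV" using lh by (intro holomorphic_deriv) auto
  then obtain k where k: "\<And>x. deriv l x = k"
    using entire_elliptic_constant[OF _ \<tau>, of "deriv l"] dshift[OF shift[OF h1]] dshift[OF shift[OF ht]] by blast
  have "\<exists>\<beta>. \<forall>x\<in>UNIV. l x - k * x = \<beta>"
    by (rule has_field_derivative_zero_constant)
       (auto intro!: derivative_eq_intros dl simp: k)
  then obtain \<beta> where l: "\<And>x. l x = k * x + \<beta>" by (metis UNIV_I add.commute diff_add_cancel)
  have "\<exists>c. \<forall>x\<in>UNIV. h x * exp (- (k / 2 * x\<^sup>2 + \<beta> * x)) = c"
  proof (rule has_field_derivative_zero_constant)
    fix x
    have "deriv h x = (k * x + \<beta>) * h x" using l[of x] nz[of x] by (simp add: l_def field_simps)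
    then show "((\<lambda>x. h x * exp (- (k / 2 * x\<^sup>2 + \<beta> * x))) has_field_derivative 0) (at x within UNIV)"
      by (auto intro!: derivative_eq_intros dh simp: algebra_simps)
  qed simp
  then obtain c where c: "\<And>x. h x * exp (- (k / 2 * x\<^sup>2 + \<beta> * x)) = c" by blast
  have "h x = c * exp (k / 2 * x\<^sup>2 + \<beta> * x)" for x
    unfolding c[of x, symmetric] by (simp only: mult.assoc exp_add[symmetric]) simp
  moreover from this nz[of 0] have "c \<noteq> 0" by auto
  ultimately show thesis using that by blast
qed

lemma Im_moebius_pos:
  fixes A B C D :: int
  assumes "Im \<tau> > 0" "A * D - B * C = 1"
  shows "of_int C * \<tau> + of_int D \<noteq> 0" "Im ((of_int A * \<tau> + of_int B) / (of_int C * \<tau> + of_int D)) > 0"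
proof -
  let ?j = "of_int C * \<tau> + of_int D :: complex"
  show j: "?j \<noteq> 0"
  proof
    assume j0: "?j = 0"
    then have "Im ?j = 0" "Re ?j = 0" by (simp_all only: zero_complex.sel)
    then have "C = 0" "D = 0" using assms(1) by (auto simp: )
    then show False using assms(2) by simp
  qed
  have "Im ((of_int A * \<tau> + of_int B) / ?j) = (of_int (A * D - B * C) * Im \<tau>) / (norm ?j)\<^sup>2"
    by (simp add: Im_divide cmod_power2 algebra_simps)
  also have "\<dots> > 0" using assms j by simp
  finally show "Im ((of_int A * \<tau> + of_int B) / ?j) > 0" .
qed

text \<open>After scaling by j both theta functions belong to the same lattice, so they share their
  simple zeros. Their quotient is entire, nowhere zero and quasi-periodic, hence Gaussian. Comparing
  derivatives at 0 ties its constant to the Euler products; nothing else about it is ever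
  computed.\<close>

lemma theta_fun_moebius:
  fixes A B C D :: int
  assumes \<tau>: "Im \<tau> > 0" and det: "A * D - B * C = 1"
  defines "j \<equiv> of_int C * \<tau> + of_int D"
  defines "\<tau>' \<equiv> (of_int A * \<tau> + of_int B) / j"
  obtains c \<alpha> \<beta> where "\<And>x. theta_fun \<tau>' (x / j) = c * exp (\<alpha> * x\<^sup>2 + \<beta> * x) * theta_fun \<tau> x"
    "c \<noteq> 0" "euler_prod (nome \<tau>') ^ 2 = c * j * euler_prod (nome \<tau>) ^ 2"
proof -
  have j: "j \<noteq> 0" and \<tau>': "Im \<tau>' > 0"
    using Im_moebius_pos[OF \<tau> det] by (auto simp: j_def \<tau>'_def)
  have jt: "\<tau>' * j = of_int A * \<tau> + of_int B" using j by (simp add: \<tau>'_def)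
  have detc: "of_int A * of_int D - of_int B * of_int C = (1 :: complex)"
    using det by (metis of_int_1 of_int_diff of_int_mult)
  \<comment> \<open>This and the next equation express 1 and tau in the basis j, tau' j by the
    inverse matrix, which shows that the lattices coincide.\<close>
  have one: "of_int A * j - of_int C * (\<tau>' * j) = 1"
    unfolding jt unfolding j_def using detc by (simp add: algebra_simps)
  have tau: "of_int D * (\<tau>' * j) - of_int B * j = \<tau>"
  proof -
    have "of_int D * (\<tau>' * j) - of_int B * j = (of_int A * of_int D - of_int B * of_int C) * \<tau>"
      unfolding jt unfolding j_def by (simp add: algebra_simps)
    then show ?thesis using detc by simp
  qed
  define F where "F x = theta_fun \<tau>' (x / j)" for x
  have dF: "(F has_field_derivative deriv (theta_fun \<tau>') (x / j) / j) (at x)" for x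
  proof -
    have "((theta_fun \<tau>' \<circ> (\<lambda>x. x / j)) has_field_derivative deriv (theta_fun \<tau>') (x / j) * (1 / j)) (at x)"
      by (rule DERIV_chain) (auto intro!: derivative_eq_intros theta_fun_has_field_derivative[OF \<tau>'] simp: j)
    moreover have "F = theta_fun \<tau>' \<circ> (\<lambda>x. x / j)" by (simp add: F_def fun_eq_iff)
    ultimately show ?thesis by simp
  qed
  have Fh: "F holomorphic_on UNIV" using dF by (auto simp: holomorphic_on_open field_differentiable_def)
  have Gh: "theta_fun \<tau> holomorphic_on UNIV" by (rule theta_fun_holomorphic[OF \<tau>])
  have zero_iff: "F x = 0 \<longleftrightarrow> theta_fun \<tau> x = 0" for x
  proof
    assume "F x = 0"
    then obtain m n where "x / j = of_int m + of_int n * \<tau>'"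
      using theta_fun_eq_0_iff[OF \<tau>'] by (auto simp: F_def)
    then have "x = of_int m * j + of_int n * (\<tau>' * j)" using j by (simp add: field_simps)
    also have "\<dots> = of_int (m * D + n * B) + of_int (m * C + n * A) * \<tau>"
      unfolding jt unfolding j_def by (simp add: algebra_simps)
    finally show "theta_fun \<tau> x = 0" using theta_fun_eq_0_iff[OF \<tau>] by blast
  next
    assume "theta_fun \<tau> x = 0"
    then obtain m n where "x = of_int m + of_int n * \<tau>"
      using theta_fun_eq_0_iff[OF \<tau>] by blast
    also have "\<dots> = of_int m * (of_int A * j - of_int C * (\<tau>' * j)) + of_int n * (of_int D * (\<tau>' * j) - of_int B * j)"
      by (simp only: one tau mult_1_right)
    also have "\<dots> = (of_int (m * A - n * B) + of_int (n * D - m * C) * \<tau>') * j"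
      by (simp add: algebra_simps)
    finally have "x / j = of_int (m * A - n * B) + of_int (n * D - m * C) * \<tau>'" using j by simp
    then show "F x = 0" unfolding F_def using theta_fun_eq_0_iff[OF \<tau>'] by blast
  qed
  obtain h where h: "h holomorphic_on UNIV" and Fh_eq: "\<And>x. F x = h x * theta_fun \<tau> x"
    using entire_quotient[OF Fh Gh] zero_iff theta_fun_simple_zeros[OF \<tau>] by blast
  have dG: "(theta_fun \<tau> has_field_derivative deriv (theta_fun \<tau>) x) (at x)" for x
    by (rule theta_fun_has_field_derivative[OF \<tau>])
  have dh: "(h has_field_derivative deriv h x) (at x)" for x
    using h by (rule holomorphic_derivI) auto
  \<comment> \<open>The product rule serves twice: at the zeros of theta it shows h to be nonzero,
    and at 0 it determines the constant c.\<close>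
  have derF: "deriv (theta_fun \<tau>') (x / j) / j = deriv h x * theta_fun \<tau> x + h x * deriv (theta_fun \<tau>) x" for x
  proof (rule DERIV_unique[OF dF])
    have "((\<lambda>x. h x * theta_fun \<tau> x) has_field_derivative deriv h x * theta_fun \<tau> x + h x * deriv (theta_fun \<tau>) x) (at x)"
      by (auto intro!: derivative_eq_intros dh dG)
    then show "(F has_field_derivative deriv h x * theta_fun \<tau> x + h x * deriv (theta_fun \<tau>) x) (at x)"
      by (simp flip: Fh_eq)
  qed
  have hnz: "h x \<noteq> 0" for x
  proof (cases "theta_fun \<tau> x = 0")
    case True
    then have "theta_fun \<tau>' (x / j) = 0" using zero_iff[of x] by (simp add: F_def)
    from theta_fun_simple_zeros[OF \<tau>' this] have "deriv (theta_fun \<tau>') (x / j) / j \<noteq> 0" using j by simp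
    then show ?thesis using derF[of x] True by auto
  next
    case False
    then show ?thesis using zero_iff[of x] Fh_eq[of x] by auto
  qed
  have per: "\<exists>a b. \<forall>x. h (x + t) = exp (a + b * x) * h x"
    if t: "t / j = of_int m' + of_int n' * \<tau>'" "t = of_int m + of_int n * \<tau>" for t m n m' n'
  proof -
    obtain a b where ab: "\<And>x. theta_fun \<tau> (x + of_int m + of_int n * \<tau>) = exp (a + b * x) * theta_fun \<tau> x"
      using theta_fun_quasiperiod[OF \<tau>] by blast
    obtain a' b' where ab': "\<And>x. theta_fun \<tau>' (x + of_int m' + of_int n' * \<tau>') = exp (a' + b' * x) * theta_fun \<tau>' x"
      using theta_fun_quasiperiod[OF \<tau>'] by blast
    have F: "F (x + t) = exp (a' + b' * (x / j)) * F x" for x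
      using ab'[of "x / j"] by (simp add: F_def add_divide_distrib t(1) add.assoc)
    have G: "theta_fun \<tau> (x + t) = exp (a + b * x) * theta_fun \<tau> x" for x
      using ab[of x] by (simp add: t(2) add.assoc)
    have e: "h (x + t) = exp ((a' - a) + (b' / j - b) * x) * h x" if "theta_fun \<tau> x \<noteq> 0" for x
    proof -
      have "h (x + t) * (exp (a + b * x) * theta_fun \<tau> x) = exp (a' + b' * (x / j)) * (h x * theta_fun \<tau> x)"
        using F[of x] G[of x] Fh_eq[of x] Fh_eq[of "x + t"] by simp
      then have "h (x + t) * exp (a + b * x) = exp (a' + b' * (x / j)) * h x"
        using that by simp
      moreover have "exp (a' + b' * (x / j)) = exp ((a' - a) + (b' / j - b) * x) * exp (a + b * x)"
        by (simp add: algebra_simps flip: exp_add)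
      ultimately show ?thesis by simp
    qed
    have "h (x + t) = exp ((a' - a) + (b' / j - b) * x) * h x" for x
    proof (cases "theta_fun \<tau> x = 0")
      case False
      then show ?thesis by (rule e)
    next
      case True
      \<comment> \<open>At a zero of theta the relation cannot be divided out. It holds at all
        nearby points, because the zero is simple and thus isolated, and continuity of h extends
        it.\<close>
      let ?k = "\<lambda>y. h (y + t) - exp ((a' - a) + (b' / j - b) * y) * h y"
      have "((\<lambda>y. theta_fun \<tau> y / (y - x)) \<longlongrightarrow> deriv (theta_fun \<tau>) x) (at x)"
        using dG[of x] True by (simp add: has_field_derivative_iff)
      then have "\<forall>\<^sub>F y in at x. theta_fun \<tau> y / (y - x) \<noteq> 0"
        by (rule tendsto_imp_eventually_ne) (use theta_fun_simple_zeros[OF \<tau> True] in auto)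
      then have ev: "\<forall>\<^sub>F y in at x. ?k y = 0" by eventually_elim (use e in auto)
      have ch: "isCont h y" for y using dh DERIV_isCont by blast
      have "isCont ?k x"
        by (intro continuous_intros isCont_o2[OF _ ch] ch)
      then have "(?k \<longlongrightarrow> ?k x) (at x)" by (simp add: isCont_def)
      from tendsto_unique[OF _ this tendsto_eventually[OF ev]] have "?k x = 0" by simp
      then show ?thesis by simp
    qed
    then show ?thesis by blast
  qed
  have t1: "1 / j = of_int A + of_int (- C) * \<tau>'" and tt: "\<tau> / j = of_int (- B) + of_int D * \<tau>'"
    using one tau j by (auto simp: field_simps)
  obtain a b where h1: "\<And>x. h (x + 1) = exp (a + b * x) * h x"
    using per[OF t1, of 1 0] by auto
  obtain a' b' where ht: "\<And>x. h (x + \<tau>) = exp (a' + b' * x) * h x"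
    using per[OF tt, of 0 1] by auto
  obtain \<alpha> \<beta> c where c: "c \<noteq> 0" "\<And>x. h x = c * exp (\<alpha> * x\<^sup>2 + \<beta> * x)"
    by (rule entire_gaussian[OF h hnz \<tau> h1 ht], erule that, assumption)
  show thesis
  proof
    show "theta_fun \<tau>' (x / j) = c * exp (\<alpha> * x\<^sup>2 + \<beta> * x) * theta_fun \<tau> x" for x
      using Fh_eq[of x] c(2)[of x] by (simp add: F_def)
    show "c \<noteq> 0" by fact
    have "theta_fun \<tau> 0 = 0" using theta_fun_eq_0_iff[OF \<tau>, of 0] by (metis add.right_neutral mult_zero_left of_int_0)
    then have "deriv (theta_fun \<tau>') 0 / j = c * deriv (theta_fun \<tau>) 0"
      using derF[of 0] c(2)[of 0] by simp
    then show "euler_prod (nome \<tau>') ^ 2 = c * j * euler_prod (nome \<tau>) ^ 2"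
      using j by (simp add: deriv_theta_fun_0[OF \<tau>] deriv_theta_fun_0[OF \<tau>'] field_simps)
  qed
qed

text \<open>The function K of the overview with theta'(0) divided by -2 pi i, which by
  \<open>deriv_theta_fun_0\<close> is the squared Euler product. This normalisation gives the
  Eisenstein average exactly.\<close>

definition kronecker3 :: "complex \<Rightarrow> complex \<Rightarrow> complex \<Rightarrow> complex \<Rightarrow> complex" where
  "kronecker3 \<tau> x y z = euler_prod (nome \<tau>) ^ 2 *
     (theta_fun \<tau> (x + y) * theta_fun \<tau> (y + z) * theta_fun \<tau> (z + x)) /
     (theta_fun \<tau> x * theta_fun \<tau> y * theta_fun \<tau> z * theta_fun \<tau> (x + y + z))"

text \<open>(x+y)^2 + (y+z)^2 + (z+x)^2 = x^2 + y^2 + z^2 + (x+y+z)^2, and the linear sums agree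
  too, so all Gaussian factors cancel. The constants give c * c^3 / c^4, and only the weight factor
  j is left.\<close>

lemma kronecker3_moebius:
  fixes A B C D :: int
  assumes \<tau>: "Im \<tau> > 0" and det: "A * D - B * C = 1"
  defines "j \<equiv> of_int C * \<tau> + of_int D"
  shows "kronecker3 ((of_int A * \<tau> + of_int B) / j) (x / j) (y / j) (z / j) = j * kronecker3 \<tau> x y z"
proof -
  define \<tau>' where "\<tau>' = (of_int A * \<tau> + of_int B) / j"
  obtain c \<alpha> \<beta> where th: "\<And>x. theta_fun \<tau>' (x / j) = c * exp (\<alpha> * x\<^sup>2 + \<beta> * x) * theta_fun \<tau> x"
    and c: "c \<noteq> 0" and eu: "euler_prod (nome \<tau>') ^ 2 = c * j * euler_prod (nome \<tau>) ^ 2"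
    using theta_fun_moebius[OF \<tau> det] unfolding \<tau>'_def j_def by metis
  define E where "E x = exp (\<alpha> * x\<^sup>2 + \<beta> * x)" for x
  have E0: "E x \<noteq> 0" for x by (simp add: E_def)
  have EE: "E (x + y) * E (y + z) * E (z + x) = E x * E y * E z * E (x + y + z)"
    by (simp add: E_def power2_eq_square algebra_simps flip: exp_add)
  define N M where "N = theta_fun \<tau> (x + y) * theta_fun \<tau> (y + z) * theta_fun \<tau> (z + x)"
    and "M = theta_fun \<tau> x * theta_fun \<tau> y * theta_fun \<tau> z * theta_fun \<tau> (x + y + z)"
  have 1: "theta_fun \<tau>' (x / j + y / j) * theta_fun \<tau>' (y / j + z / j) * theta_fun \<tau>' (z / j + x / j)
     = c ^ 3 * (E (x + y) * E (y + z) * E (z + x)) * N"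
    by (simp add: th E_def N_def power3_eq_cube mult_ac flip: add_divide_distrib)
  have 2: "theta_fun \<tau>' (x / j) * theta_fun \<tau>' (y / j) * theta_fun \<tau>' (z / j) * theta_fun \<tau>' (x / j + y / j + z / j)
     = c ^ 4 * (E x * E y * E z * E (x + y + z)) * M"
    by (simp add: th E_def M_def power4_eq_xxxx mult_ac flip: add_divide_distrib)
  have "kronecker3 \<tau>' (x / j) (y / j) (z / j) =
      c * j * euler_prod (nome \<tau>) ^ 2 * (c ^ 3 * (E x * E y * E z * E (x + y + z)) * N) /
      (c ^ 4 * (E x * E y * E z * E (x + y + z)) * M)"
    unfolding kronecker3_def 1 2 eu EE ..
  also have "\<dots> = j * (euler_prod (nome \<tau>) ^ 2 * N / M) * ((c ^ 4 * (E x * E y * E z * E (x + y + z))) / (c ^ 4 * (E x * E y * E z * E (x + y + z))))"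
    by (simp add: power4_eq_xxxx power3_eq_cube mult_ac)
  also have "\<dots> = j * (euler_prod (nome \<tau>) ^ 2 * N / M)"
    using c E0 by simp
  finally show ?thesis by (simp add: kronecker3_def N_def M_def \<tau>'_def)
qed

lemma theta_fun_add_int: "theta_fun \<tau> (x + of_int m) = theta_fun \<tau> x"
  by (simp add: theta_fun_def nome_add)

section \<open>The addition formula and Lambert series\<close>

text \<open>With y and z fixed, the difference of both sides is N / M as a function of x. Both have
  the same multipliers, and N vanishes at the simple zeros of M, so the quotient is constant; one
  good point shows that it is 0.\<close>

lemma theta_fun_addition:
  assumes \<tau>: "Im \<tau> > 0"
    and nz: "theta_fun \<tau> x \<noteq> 0" "theta_fun \<tau> y \<noteq> 0" "theta_fun \<tau> z \<noteq> 0"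
      "theta_fun \<tau> (y + z) \<noteq> 0" "theta_fun \<tau> (x + y + z) \<noteq> 0"
  defines "l \<equiv> \<lambda>x. deriv (theta_fun \<tau>) x / theta_fun \<tau> x"
  shows "2 * of_real pi * \<i> * kronecker3 \<tau> x y z = 2 * of_real pi * \<i> - (l x + l y + l z - l (x + y + z))"
proof -
  define \<theta> \<theta>' where "\<theta> = theta_fun \<tau>" and "\<theta>' = deriv \<theta>"
  define s where "s = y + z"
  \<comment> \<open>With this factor the last summand of N divided by M is 2 pi i K, and N vanishes
    at 0 and at -s, the zeros of M modulo the lattice.\<close>
  define \<kappa> where "\<kappa> = 2 * of_real pi * \<i> * euler_prod (nome \<tau>) ^ 2 * \<theta> s / (\<theta> y * \<theta> z)"
  define C where "C = l y + l z - 2 * of_real pi * \<i>"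
  define N where "N x = \<theta>' x * \<theta> (x + s) - \<theta> x * \<theta>' (x + s) + C * (\<theta> x * \<theta> (x + s)) + \<kappa> * (\<theta> (x + y) * \<theta> (x + z))" for x
  define M where "M x = \<theta> x * \<theta> (x + s)" for x
  have nz': "\<theta> y \<noteq> 0" "\<theta> z \<noteq> 0" "\<theta> s \<noteq> 0" using nz by (auto simp: \<theta>_def s_def)
  have d: "(\<theta> has_field_derivative \<theta>' x) (at x)" for x
    unfolding \<theta>_def \<theta>'_def by (rule theta_fun_has_field_derivative[OF \<tau>])
  have th: "\<theta> holomorphic_on UNIV" unfolding \<theta>_def by (rule theta_fun_holomorphic[OF \<tau>])
  have th': "\<theta>' holomorphic_on UNIV" unfolding \<theta>'_def by (intro holomorphic_deriv th) auto
  have sh: "(\<lambda>x. \<theta> (x + c)) holomorphic_on UNIV" "(\<lambda>x. \<theta>' (x + c)) holomorphic_on UNIV" for c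
  proof -
    have "(\<lambda>x. g (x + c)) holomorphic_on UNIV" if "g holomorphic_on UNIV" for g
      using holomorphic_on_compose_gen[OF _ that, of "\<lambda>x. x + c" UNIV]
      by (simp add: o_def holomorphic_on_add)
    then show "(\<lambda>x. \<theta> (x + c)) holomorphic_on UNIV" "(\<lambda>x. \<theta>' (x + c)) holomorphic_on UNIV"
      using th th' by auto
  qed
  have Nh: "N holomorphic_on UNIV" unfolding N_def by (intro holomorphic_intros th th' sh)
  have Mh: "M holomorphic_on UNIV" unfolding M_def by (intro holomorphic_intros th sh)
  have dM: "deriv M x = \<theta>' x * \<theta> (x + s) + \<theta> x * \<theta>' (x + s)" for x
  proof (rule DERIV_imp_deriv)
    have "((\<lambda>x. \<theta> (x + s)) has_field_derivative \<theta>' (x + s)) (at x)"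
      using d[of "x + s"] by (simp add: DERIV_shift)
    then show "(M has_field_derivative \<theta>' x * \<theta> (x + s) + \<theta> x * \<theta>' (x + s)) (at x)"
      unfolding M_def by (auto intro!: derivative_eq_intros d)
  qed
  have q1: "\<theta> (x + 1) = \<theta> x" for x by (simp add: \<theta>_def theta_fun_add_1[OF \<tau>])
  have qt: "\<theta> (x + \<tau>) = - nome (- x) * \<theta> x" for x by (simp add: \<theta>_def theta_fun_add_tau[OF \<tau>])
  have qm: "\<theta> (- x) = - nome (- x) * \<theta> x" for x by (simp add: \<theta>_def theta_fun_minus[OF \<tau>])
  have q1': "\<theta>' (x + 1) = \<theta>' x" for x
    by (rule DERIV_unique[of \<theta> _ x]) (use d[of "x + 1"] d[of x] in \<open>simp_all add: DERIV_shift q1\<close>)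
  have qt': "\<theta>' (x + \<tau>) = - nome (- x) * (\<theta>' x - 2 * of_real pi * \<i> * \<theta> x)" for x
  proof (rule DERIV_unique)
    show "((\<lambda>x. \<theta> (x + \<tau>)) has_field_derivative \<theta>' (x + \<tau>)) (at x)"
      using d[of "x + \<tau>"] by (simp add: DERIV_shift)
    show "((\<lambda>x. \<theta> (x + \<tau>)) has_field_derivative - nome (- x) * (\<theta>' x - 2 * of_real pi * \<i> * \<theta> x)) (at x)"
      unfolding qt by (auto intro!: derivative_eq_intros d simp: algebra_simps)
  qed
  have qm': "- \<theta>' (- x) = - nome (- x) * (\<theta>' x - 2 * of_real pi * \<i> * \<theta> x)" for x
  proof (rule DERIV_unique)
    have "((\<theta> \<circ> uminus) has_field_derivative \<theta>' (- x) * (- 1)) (at x)"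
      by (rule DERIV_chain[OF d]) (auto intro!: derivative_eq_intros)
    then show "((\<lambda>x. \<theta> (- x)) has_field_derivative - \<theta>' (- x)) (at x)" by (simp add: o_def)
    show "((\<lambda>x. \<theta> (- x)) has_field_derivative - nome (- x) * (\<theta>' x - 2 * of_real pi * \<i> * \<theta> x)) (at x)"
      unfolding qm by (auto intro!: derivative_eq_intros d simp: algebra_simps)
  qed
  have N1: "N (x + 1) = N x" and M1: "M (x + 1) = M x" for x
    using q1[of "x + s"] q1'[of "x + s"] q1[of "x + y"] q1[of "x + z"]
    by (simp_all add: N_def M_def q1 q1' add.assoc add.commute[of 1])
  define \<mu> where "\<mu> x = nome (- x) * nome (- (x + s))" for x
  have Nt: "N (x + \<tau>) = \<mu> x * N x" for x
  proof -
    have "nome (- (x + y)) * nome (- (x + z)) = \<mu> x"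
      unfolding \<mu>_def s_def nome_add[symmetric] by (simp add: algebra_simps)
    moreover have e: "x + \<tau> + s = (x + s) + \<tau>" "x + \<tau> + y = (x + y) + \<tau>" "x + \<tau> + z = (x + z) + \<tau>"
      by (simp_all add: algebra_simps)
    have "N (x + \<tau>) = nome (- x) * nome (- (x + s)) * (\<theta>' x * \<theta> (x + s) - \<theta> x * \<theta>' (x + s) + C * (\<theta> x * \<theta> (x + s)))
        + \<kappa> * (nome (- (x + y)) * nome (- (x + z)) * (\<theta> (x + y) * \<theta> (x + z)))"
      unfolding N_def e qt qt' by (simp add: algebra_simps)
    ultimately show ?thesis by (simp add: N_def \<mu>_def algebra_simps)
  qed
  have Mt: "M (x + \<tau>) = \<mu> x * M x" for x
  proof -
    have e: "x + \<tau> + s = (x + s) + \<tau>" by simp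
    show ?thesis unfolding M_def e qt \<mu>_def by simp
  qed
  have \<theta>0: "\<theta> 0 = 0" unfolding \<theta>_def using theta_fun_eq_0_iff[OF \<tau>, of 0]
    by (metis add.right_neutral mult_zero_left of_int_0)
  have \<theta>0': "\<theta>' 0 = - (2 * of_real pi * \<i>) * euler_prod (nome \<tau>) ^ 2"
    by (simp add: \<theta>'_def \<theta>_def deriv_theta_fun_0[OF \<tau>])
  have N0: "N 0 = 0" using nz' by (simp add: N_def \<theta>0 \<theta>0' \<kappa>_def)
  have Ns: "N (- s) = 0"
  proof -
    have "nome (- y) * nome (- z) = nome (- s)" unfolding s_def nome_add[symmetric] by simp
    moreover have e: "- s + s = 0" "- s + y = - z" "- s + z = - y" by (auto simp: s_def)
    have "N (- s) = nome (- s) * \<theta> s * \<theta>' 0 + \<kappa> * (nome (- y) * nome (- z) * (\<theta> y * \<theta> z))"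
      unfolding N_def e qm by (simp add: \<theta>0)
    ultimately show ?thesis using nz' by (simp add: \<theta>0' \<kappa>_def)
  qed
  have Nint: "N (x + of_int m + of_int n * \<tau>) = 0" if x: "N x = 0" for x m n
  proof -
    have "N (x + of_int m) = N x" for x m
      by (induction m rule: int_induct[where k = 0])
        (use N1 in \<open>simp_all add: add.assoc[symmetric]\<close>, metis N1 add_diff_eq diff_add_cancel)
    moreover have "N (x + of_int n * \<tau>) = 0" if "N x = 0" for x n
    proof (induction n rule: int_induct[where k = 0])
      case (step1 i)
      then show ?case using Nt[of "x + of_int i * \<tau>"] by (simp add: algebra_simps)
    next
      case (step2 i)
      then show ?case using Nt[of "x + of_int (i - 1) * \<tau>"] by (simp add: algebra_simps \<mu>_def)
    qed (use that in simp)
    ultimately show ?thesis using x by simp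
  qed
  have vanish: "N x = 0 \<and> deriv M x \<noteq> 0" if "M x = 0" for x
  proof (cases "\<theta> x = 0")
    case True
    then obtain m n where x: "x = of_int m + of_int n * \<tau>"
      unfolding \<theta>_def theta_fun_eq_0_iff[OF \<tau>] by blast
    have "\<theta> (x + s) \<noteq> 0"
    proof
      assume "\<theta> (x + s) = 0"
      then obtain m' n' where "x + s = of_int m' + of_int n' * \<tau>"
        unfolding \<theta>_def theta_fun_eq_0_iff[OF \<tau>] by blast
      then have "s = of_int m' + of_int n' * \<tau> - x" by (metis add_diff_cancel_left')
      then have "s = of_int (m' - m) + of_int (n' - n) * \<tau>" unfolding x by (simp add: algebra_simps)
      then show False using nz'(3) unfolding \<theta>_def theta_fun_eq_0_iff[OF \<tau>] by blast
    qed
    moreover have "\<theta>' x \<noteq> 0"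
      using theta_fun_simple_zeros[OF \<tau>] True unfolding \<theta>_def \<theta>'_def by blast
    ultimately show ?thesis using Nint[OF N0, of m n] True by (simp add: dM x add.assoc)
  next
    case False
    then have z: "\<theta> (x + s) = 0" using that by (simp add: M_def)
    then obtain m n where "x + s = of_int m + of_int n * \<tau>"
      unfolding \<theta>_def theta_fun_eq_0_iff[OF \<tau>] by blast
    then have x: "x = - s + of_int m + of_int n * \<tau>" by (simp add: algebra_simps)
    have "\<theta>' (x + s) \<noteq> 0"
      using theta_fun_simple_zeros[OF \<tau>] z unfolding \<theta>_def \<theta>'_def by blast
    then show ?thesis using Nint[OF Ns, of m n] False z by (simp add: dM x)
  qed
  obtain h where h: "h holomorphic_on UNIV" "\<And>x. N x = h x * M x"
    using entire_quotient[OF Nh Mh vanish] by blast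
  have hper: "h (x + t) = h x" if Nt: "\<And>x. N (x + t) = w x * N x" and Mt: "\<And>x. M (x + t) = w x * M x" and w: "\<And>x. w x \<noteq> 0"
    for x t w
  proof (cases "M x = 0")
    case False
    then show ?thesis using h(2)[of x] h(2)[of "x + t"] Nt[of x] Mt[of x] w[of x] by simp
  next
    case True
    have dM: "(M has_field_derivative deriv M x) (at x)" using Mh by (rule holomorphic_derivI) auto
    have dh: "(h has_field_derivative deriv h x) (at x)" for x using h(1) by (rule holomorphic_derivI) auto
    let ?k = "\<lambda>y. h (y + t) - h y"
    have "((\<lambda>y. M y / (y - x)) \<longlongrightarrow> deriv M x) (at x)"
      using dM True by (simp add: has_field_derivative_iff)
    then have "\<forall>\<^sub>F y in at x. M y / (y - x) \<noteq> 0"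
      by (rule tendsto_imp_eventually_ne) (use vanish[OF True] in auto)
    then have ev: "\<forall>\<^sub>F y in at x. ?k y = 0"
    proof eventually_elim
      case (elim y)
      then have "M y \<noteq> 0" by auto
      then show ?case using h(2)[of y] h(2)[of "y + t"] Nt[of y] Mt[of y] w[of y] by simp
    qed
    have ch: "isCont h y" for y using dh DERIV_isCont by blast
    have "isCont ?k x" by (intro continuous_intros isCont_o2[OF _ ch] ch)
    then have "(?k \<longlongrightarrow> ?k x) (at x)" by (simp add: isCont_def)
    from tendsto_unique[OF _ this tendsto_eventually[OF ev]] show ?thesis by simp
  qed
  have h1: "h (x + 1) = h x" for x by (rule hper[of 1 "\<lambda>_. 1"]) (simp_all add: N1 M1)
  have ht: "h (x + \<tau>) = h x" for x by (rule hper[of \<tau> \<mu>]) (simp_all add: Nt Mt, simp add: \<mu>_def)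
  obtain c where c: "\<And>x. h x = c" using entire_elliptic_constant[OF h(1) \<tau> h1 ht] by blast
  have "c = 0"
  proof -
    \<comment> \<open>The test point is x = -y: the theta product in N vanishes there, the
      logarithmic derivatives cancel against C, and M is not 0.\<close>
    have e: "- y + s = z" "- y + y = 0" by (simp_all add: s_def)
    have "\<theta> (- y) \<noteq> 0" using qm[of y] nz' by simp
    then have "M (- y) \<noteq> 0" using nz' unfolding M_def e by simp
    moreover have "N (- y) = 0"
    proof -
      have t: "\<theta>' (- y) = nome (- y) * (\<theta>' y - 2 * of_real pi * \<i> * \<theta> y)"
        using qm'[of y] by (metis minus_minus mult_minus_left)
      have "N (- y) = nome (- y) * ((\<theta>' y - 2 * of_real pi * \<i> * \<theta> y) * \<theta> z + \<theta> y * \<theta>' z - C * (\<theta> y * \<theta> z))"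
        unfolding N_def e qm t \<theta>0 by (simp add: algebra_simps)
      also have "C * (\<theta> y * \<theta> z) = \<theta>' y * \<theta> z + \<theta> y * \<theta>' z - 2 * of_real pi * \<i> * \<theta> y * \<theta> z"
        using nz' unfolding C_def l_def \<theta>_def[symmetric] \<theta>'_def[symmetric] by (simp add: field_simps)
      finally show ?thesis by (simp add: algebra_simps)
    qed
    ultimately show ?thesis using h(2)[of "- y"] c by simp
  qed
  then have "N x = 0" using h(2)[of x] c by simp
  moreover have e: "x + s = x + y + z" by (simp add: s_def)
  have nzx: "\<theta> x \<noteq> 0" "\<theta> (x + y + z) \<noteq> 0" using nz by (auto simp: \<theta>_def)
  have "N x / (\<theta> x * \<theta> (x + y + z)) = l x - l (x + y + z) + C + \<kappa> * (\<theta> (x + y) * \<theta> (z + x)) / (\<theta> x * \<theta> (x + y + z))"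
    using nzx unfolding N_def e l_def \<theta>_def[symmetric] \<theta>'_def[symmetric] by (simp add: field_simps add.commute[of z])
  moreover have "\<kappa> * (\<theta> (x + y) * \<theta> (z + x)) / (\<theta> x * \<theta> (x + y + z)) = 2 * of_real pi * \<i> * kronecker3 \<tau> x y z"
    by (simp add: \<kappa>_def kronecker3_def s_def \<theta>_def mult_ac)
  ultimately have "l x - l (x + y + z) + C + 2 * of_real pi * \<i> * kronecker3 \<tau> x y z = 0" by simp
  then have "2 * of_real pi * \<i> * kronecker3 \<tau> x y z = - (l x - l (x + y + z) + C)"
    by (rule minus_unique[symmetric])
  then show ?thesis unfolding C_def by simp
qed

lemma qpoch_logderiv:
  assumes q: "norm q < 1" and nz: "qpoch q u \<noteq> 0"
  shows "(\<lambda>n. - (q ^ n / (1 - q ^ n * u))) sums (deriv (qpoch q) u / qpoch q u)"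
proof -
  have "(\<lambda>k. deriv (\<lambda>u. 1 - q ^ k * u) u / (1 - q ^ k * u)) sums (deriv (qpoch q) u / qpoch q u)"
  proof (rule logderiv_prodinf_complex_uniform_limit[where A = "ball 0 (norm u + 1)"])
    show "uniform_limit (ball 0 (norm u + 1)) (\<lambda>n x. \<Prod>k<n. 1 - q ^ k * x) (qpoch q) sequentially"
      by (rule uniform_limit_on_subset[OF qpoch_uniform_limit[OF q, of "norm u + 1"]]) auto
  qed (use nz in \<open>auto intro!: holomorphic_intros\<close>)
  moreover have "deriv (\<lambda>u. 1 - q ^ k * u) u = - (q ^ k)" for k
    by (rule DERIV_imp_deriv) (auto intro!: derivative_eq_intros)
  ultimately show ?thesis by simp
qed

lemma theta_fun_logderiv:
  assumes \<tau>: "Im \<tau> > 0" and nz: "theta_fun \<tau> x \<noteq> 0"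
  defines "q \<equiv> nome \<tau>" and "u \<equiv> nome x"
  shows "(\<lambda>n. q ^ n * u / (1 - q ^ n * u) - q ^ n * (q / u) / (1 - q ^ n * (q / u))) sums
    (- (deriv (theta_fun \<tau>) x / theta_fun \<tau> x) / (2 * of_real pi * \<i>))"
proof -
  have q: "norm q < 1" unfolding q_def by (rule norm_nome_less_1[OF \<tau>])
  have u: "u \<noteq> 0" by (simp add: u_def)
  have th: "theta_fun \<tau> x = qpoch q u * qpoch q (q / u)"
    by (simp add: theta_fun_def theta_prod_eq_qpoch q_def u_def norm_nome_less_1[OF \<tau>])
  have nz': "qpoch q u \<noteq> 0" "qpoch q (q / u) \<noteq> 0" using nz unfolding th by auto
  have dq: "(qpoch q has_field_derivative deriv (qpoch q) v) (at v within A)" for v A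
    by (rule holomorphic_derivI[OF qpoch_holomorphic[OF q]]) auto
  have "((qpoch q \<circ> nome) has_field_derivative deriv (qpoch q) (nome x) * (2 * of_real pi * \<i> * u)) (at x)"
    by (rule DERIV_chain[OF dq]) (auto intro!: derivative_eq_intros simp: u_def)
  moreover have "((qpoch q \<circ> (\<lambda>x. q / nome x)) has_field_derivative deriv (qpoch q) (q / nome x) * (- (2 * of_real pi * \<i> * q / u))) (at x)"
    by (rule DERIV_chain[OF dq]) (auto intro!: derivative_eq_intros simp: u_def field_simps)
  ultimately have "((\<lambda>x. qpoch q (nome x) * qpoch q (q / nome x)) has_field_derivative
     deriv (qpoch q) u * (2 * of_real pi * \<i> * u) * qpoch q (q / u) + deriv (qpoch q) (q / u) * (- (2 * of_real pi * \<i> * q / u)) * qpoch q u) (at x)"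
    unfolding o_def u_def by (rule DERIV_mult)
  moreover have "theta_fun \<tau> = (\<lambda>x. qpoch q (nome x) * qpoch q (q / nome x))"
    by (simp add: fun_eq_iff theta_fun_def theta_prod_eq_qpoch q_def norm_nome_less_1[OF \<tau>])
  ultimately have "deriv (theta_fun \<tau>) x = deriv (qpoch q) u * (2 * of_real pi * \<i> * u) * qpoch q (q / u) +
      deriv (qpoch q) (q / u) * (- (2 * of_real pi * \<i> * q / u)) * qpoch q u"
    by (simp add: DERIV_imp_deriv)
  then have e: "- (deriv (theta_fun \<tau>) x / theta_fun \<tau> x) / (2 * of_real pi * \<i>) =
      - u * (deriv (qpoch q) u / qpoch q u) - - (q / u) * (deriv (qpoch q) (q / u) / qpoch q (q / u))"
    unfolding th using nz' u by (simp add: field_simps)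
  have "(\<lambda>n. - u * - (q ^ n / (1 - q ^ n * u)) - - (q / u) * - (q ^ n / (1 - q ^ n * (q / u)))) sums
      (- u * (deriv (qpoch q) u / qpoch q u) - - (q / u) * (deriv (qpoch q) (q / u) / qpoch q (q / u)))"
    by (intro sums_diff sums_mult qpoch_logderiv q nz')
  then show ?thesis unfolding e by (simp add: mult_ac)
qed

text \<open>Regroups a Lambert series by residues. Index m carries the term \<open>Suc m\<close>, so
  the block starting at n p covers the integers n p + 1, ..., n p + p, exactly one of which has
  residue r.\<close>

lemma sum_residue_class:
  fixes F :: "nat \<Rightarrow> complex"
  assumes "0 < r" "r < p"
  shows "(\<Sum>m = n * p..<n * p + p. of_bool [int (Suc m) = int r] (mod int p) * F (Suc m)) = F (n * p + r)"
proof -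
  have "[int (Suc m) = int r] (mod int p) \<longleftrightarrow> m = n * p + r - 1" if "m \<in> {n * p..<n * p + p}" for m
  proof -
    define k where "k = m - n * p"
    have k: "m = n * p + k" "k < p" using that by (auto simp: k_def)
    have "[int (Suc m) = int r] (mod int p) \<longleftrightarrow> Suc m mod p = r mod p"
      unfolding cong_int_iff by (simp only: cong_def)
    also have "Suc m mod p = Suc k mod p" using k mod_mult_self3[of n p "Suc k"] by simp
    also have "\<dots> = r mod p \<longleftrightarrow> Suc k = r" using k assms by (cases "Suc k = p") auto
    finally show ?thesis using k assms by auto
  qed
  then have "(\<Sum>m = n * p..<n * p + p. of_bool [int (Suc m) = int r] (mod int p) * F (Suc m)) =
      (\<Sum>m = n * p..<n * p + p. if m = n * p + r - 1 then F (Suc m) else 0)"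
    by (intro sum.cong) auto
  also have "\<dots> = F (n * p + r)" using assms by (subst sum.delta) auto
  finally show ?thesis .
qed

lemma norm_lambert_term_le:
  fixes q :: complex
  assumes "norm q < 1"
  shows "norm (q ^ Suc n / (1 - q ^ Suc n)) \<le> norm q ^ n / (1 - norm q)"
proof -
  have "norm q ^ Suc n \<le> norm q" using assms power_decreasing[of 1 "Suc n" "norm q"] by simp
  then have "1 - norm q \<le> norm (1 - q ^ Suc n)"
    using norm_triangle_ineq2[of 1 "q ^ Suc n"] by (simp add: norm_power norm_mult)
  moreover have "norm q ^ Suc n \<le> norm q ^ n" using assms by (intro power_decreasing) auto
  ultimately show ?thesis unfolding norm_divide norm_power using assms by (intro frac_le) auto
qed

text \<open>For x = r tau and nome q^p the terms of \<open>theta_fun_logderiv\<close> involve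
  q^(np+r) and q^(np+p-r). They run through the positive integers congruent to r and -r, as in an
  Eisenstein series whose coefficients are periodic modulo p.\<close>

lemma theta_fun_logderiv_residue_class:
  fixes p r :: nat
  assumes \<tau>: "Im \<tau> > 0" and r: "0 < r" "r < p"
    and nz: "theta_fun (of_nat p * \<tau>) (of_nat r * \<tau>) \<noteq> 0"
  shows "(\<lambda>n. (of_bool [int (Suc n) = int r] (mod int p) - of_bool [int (Suc n) = - int r] (mod int p)) *
      (nome \<tau> ^ Suc n / (1 - nome \<tau> ^ Suc n))) sums
    (- (deriv (theta_fun (of_nat p * \<tau>)) (of_nat r * \<tau>) / theta_fun (of_nat p * \<tau>) (of_nat r * \<tau>)) / (2 * of_real pi * \<i>))"
    (is "?f sums ?S")
proof -
  define q where "q = nome \<tau>"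
  define F where "F n = q ^ n / (1 - q ^ n)" for n
  have q: "norm q < 1" unfolding q_def by (rule norm_nome_less_1[OF \<tau>])
  have f: "?f n = of_bool [int (Suc n) = int r] (mod int p) * F (Suc n) - of_bool [int (Suc n) = int (p - r)] (mod int p) * F (Suc n)" for n
  proof -
    have "[int (Suc n) = - int r] (mod int p) \<longleftrightarrow> [int (Suc n) = int (p - r)] (mod int p)"
      using r by (simp add: cong_def of_nat_diff)
    then show ?thesis by (simp add: F_def q_def left_diff_distrib)
  qed
  have "summable (\<lambda>n. norm q ^ n / (1 - norm q))"
    by (intro summable_divide summable_geometric) (use q in auto)
  then have "summable ?f"
  proof (rule summable_comparison_test')
    fix n
    have "norm (?f n) \<le> 1 * (norm q ^ n / (1 - norm q))"
      unfolding norm_mult q_def[symmetric] by (intro mult_mono norm_lambert_term_le q) auto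
    then show "norm (?f n) \<le> norm q ^ n / (1 - norm q)" by simp
  qed
  then have s: "?f sums suminf ?f" by (rule summable_sums)
  have "(\<lambda>n. sum ?f {n * p..<n * p + p}) sums suminf ?f"
    by (rule sums_group[OF s]) (use r in auto)
  moreover have "sum ?f {n * p..<n * p + p} = F (n * p + r) - F (n * p + (p - r))" for n
    unfolding f sum_subtractf using r by (simp only: sum_residue_class[of r p] sum_residue_class[of "p - r" p])
  ultimately have "(\<lambda>n. F (n * p + r) - F (n * p + (p - r))) sums suminf ?f" by simp
  moreover have "(\<lambda>n. F (n * p + r) - F (n * p + (p - r))) sums ?S"
  proof -
    have "Im (of_nat p * \<tau>) > 0" using \<tau> r by simp
    from theta_fun_logderiv[OF this nz]
    show ?thesis
    proof (rule back_subst[where P = "\<lambda>f. f sums _"], intro ext)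
      fix n
      have a: "nome (of_nat p * \<tau>) ^ n * nome (of_nat r * \<tau>) = q ^ (n * p + r)"
        by (simp add: nome_mult_of_nat q_def power_add power_mult mult.commute[of n])
      have "q ^ p = q ^ (p - r) * q ^ r" using r by (simp flip: power_add)
      then have "nome (of_nat p * \<tau>) / nome (of_nat r * \<tau>) = q ^ (p - r)"
        unfolding nome_mult_of_nat q_def[symmetric] by (simp add: q_def)
      then have b: "nome (of_nat p * \<tau>) ^ n * (nome (of_nat p * \<tau>) / nome (of_nat r * \<tau>)) = q ^ (n * p + (p - r))"
        by (simp add: nome_mult_of_nat q_def power_add power_mult mult.commute[of n])
      show "nome (of_nat p * \<tau>) ^ n * nome (of_nat r * \<tau>) / (1 - nome (of_nat p * \<tau>) ^ n * nome (of_nat r * \<tau>)) -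
         nome (of_nat p * \<tau>) ^ n * (nome (of_nat p * \<tau>) / nome (of_nat r * \<tau>)) /
         (1 - nome (of_nat p * \<tau>) ^ n * (nome (of_nat p * \<tau>) / nome (of_nat r * \<tau>))) =
         F (n * p + r) - F (n * p + (p - r))"
        unfolding a b F_def ..
    qed
  qed
  ultimately have "suminf ?f = ?S" by (rule sums_unique2)
  with s show ?thesis by simp
qed

section \<open>The diamond operator and Klein forms\<close>

lemma theta_fun_multiple_nonzero:
  assumes "Im \<tau> > 0" "\<not> int p dvd r" "p > 0"
  shows "theta_fun (of_nat p * \<tau>) (of_int r * \<tau>) \<noteq> 0"
proof
  have "Im (of_nat p * \<tau>) > 0" using assms by simp
  moreover assume "theta_fun (of_nat p * \<tau>) (of_int r * \<tau>) = 0"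
  ultimately obtain m n where e: "of_int r * \<tau> = of_int m + of_int n * (of_nat p * \<tau>)"
    using theta_fun_eq_0_iff by blast
  have "Im (of_int r * \<tau>) = Im (of_int m + of_int n * (of_nat p * \<tau>))" by (simp only: e)
  then have "of_int r * Im \<tau> = of_int (n * int p) * Im \<tau>" by simp
  then have "(of_int r :: real) = of_int (n * int p)" using assms(1) by (simp only: mult_cancel_right) auto
  then have "r = n * int p" by (simp only: of_int_eq_iff)
  with assms(2) show False by simp
qed

section \<open>The Eisenstein average as a value of the Kronecker function\<close>

lemma sum_mult_mod_character:
  assumes chi: "chi \<in> odd_characters p" and p: "prime p" and x: "0 < x" "x < p"
  shows "(\<Sum>m\<in>{1..<p}. of_nat m * chi (int m)) = chi (int x) * (\<Sum>t\<in>{1..<p}. of_nat (x * t mod p) * chi (int t))"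
proof -
  have dc: "dirichlet_character p chi" using chi by (simp add: odd_characters_def)
  have cx: "coprime x p" using x p by (metis coprime_commute nat_dvd_not_less prime_imp_coprime)
  have inj: "inj_on (\<lambda>t. x * t mod p) {1..<p}"
  proof (rule inj_onI)
    fix s t assume st: "s \<in> {1..<p}" "t \<in> {1..<p}" "x * s mod p = x * t mod p"
    then have "[x * s = x * t] (mod p)" by (simp add: cong_def)
    then have "[s = t] (mod p)" using cx by (simp add: cong_mult_lcancel_nat)
    then show "s = t" using st by (auto simp: cong_def)
  qed
  have sub: "(\<lambda>t. x * t mod p) ` {1..<p} \<subseteq> {1..<p}"
  proof safe
    fix t assume t: "t \<in> {1..<p}"
    have "\<not> p dvd x * t" using p x t by (auto simp: prime_dvd_mult_iff dest: dvd_imp_le)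
    then show "x * t mod p \<in> {1..<p}" using p prime_gt_0_nat[OF p] by (simp add: Suc_le_eq mod_greater_zero_iff_not_dvd)
  qed
  \<comment> \<open>Multiplication by x permutes the nonzero residues, so the first moment of chi
    can be rewritten with the factor chi(x) pulled out.\<close>
  have im: "(\<lambda>t. x * t mod p) ` {1..<p} = {1..<p}" by (rule endo_inj_surj[OF _ sub inj]) simp
  have "(\<Sum>m\<in>{1..<p}. of_nat m * chi (int m)) = (\<Sum>t\<in>{1..<p}. of_nat (x * t mod p) * chi (int (x * t mod p)))"
    by (subst im[symmetric], subst sum.reindex[OF inj]) (simp only: o_def)
  also have "\<dots> = (\<Sum>t\<in>{1..<p}. chi (int x) * (of_nat (x * t mod p) * chi (int t)))"
  proof (rule sum.cong)
    fix t
    have "chi (int (x * t mod p)) = chi (int x * int t)"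
      by (rule dirichlet_character_cong[OF dc]) (simp add: cong_def of_nat_mod)
    also have "\<dots> = chi (int x) * chi (int t)" using dc by (simp add: dirichlet_character_def)
    finally show "of_nat (x * t mod p) * chi (int (x * t mod p)) = chi (int x) * (of_nat (x * t mod p) * chi (int t))"
      by simp
  qed simp
  finally show ?thesis by (simp add: sum_distrib_left)
qed

text \<open>
  Multiplying out \<open>L(0, \<chi>)\<close> with the right-hand side gives a combination of the \<open>\<chi>(t)\<close>; the last
  hypothesis says that its coefficients are constant in \<open>t\<close> except for opposite deviations at \<open>t = \<plusminus>1\<close>.
\<close>

lemma inverse_dirichlet_L_0:
  assumes chi: "chi \<in> odd_characters p" and p: "prime p" "p > 2"
    and x: "0 < x" "0 < y" "0 < z" "x + y + z < p"
    and check: "\<forall>t\<in>{1..<p}. x * t mod p + y * t mod p + z * t mod p + (if t = 1 then p else 0) =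
      (x + y + z) * t mod p + p + (if t = p - 1 then p else 0)"
  shows "2 / dirichlet_L chi 0 = inverse (chi (int x)) + inverse (chi (int y)) + inverse (chi (int z)) - inverse (chi (int (x + y + z)))"
    (is "_ = ?D")
proof -
  have dc: "dirichlet_character p chi" using chi by (simp add: odd_characters_def)
  define W where "W = (\<Sum>m\<in>{1..<p}. of_nat m * chi (int m))"
  have "\<not> coprime (int p) (int p)" using p by simp
  moreover have "chi (int p) \<noteq> 0 \<longleftrightarrow> coprime (int p) (int p)"
    using dc unfolding dirichlet_character_def by blast
  ultimately have chip: "chi (int p) = 0" by blast
  have shift: "(\<Sum>n<p. g (Suc n)) = (\<Sum>m\<in>{1..<p}. g m) + g p" for g :: "nat \<Rightarrow> complex"
  proof -
    have "(\<Sum>n<p. g (Suc n)) = (\<Sum>m\<in>{1..<Suc p}. g m)"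
      by (simp only: lessThan_atLeast0 sum.shift_bounds_Suc_ivl One_nat_def)
    then show ?thesis using p by simp
  qed
  have L: "dirichlet_L chi 0 = - W / of_nat p"
    using dirichlet_L_0[OF chi] p shift[of "\<lambda>m. of_nat m * chi (int m)"] by (simp add: chip W_def)
  have zero: "(\<Sum>t\<in>{1..<p}. chi (int t)) = 0"
    using odd_character_sum_zero[OF chi] p shift[of "\<lambda>m. chi (int m)"] by (simp add: chip)
  have inv: "W * inverse (chi (int r)) = (\<Sum>t\<in>{1..<p}. of_nat (r * t mod p) * chi (int t))" if "0 < r" "r < p" for r
  proof -
    have "coprime (int r) (int p)" using that p by (metis coprime_commute coprime_int_iff nat_dvd_not_less prime_imp_coprime)
    then have "chi (int r) \<noteq> 0" using dc by (simp add: dirichlet_character_def)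
    then show ?thesis unfolding W_def sum_mult_mod_character[OF chi p(1) that] by simp
  qed
  have "W * ?D = (\<Sum>t\<in>{1..<p}. (of_nat (x * t mod p) + of_nat (y * t mod p) + of_nat (z * t mod p) - of_nat ((x + y + z) * t mod p)) * chi (int t))"
  proof -
    have "W * inverse (chi (int x)) = (\<Sum>t\<in>{1..<p}. of_nat (x * t mod p) * chi (int t))"
      "W * inverse (chi (int y)) = (\<Sum>t\<in>{1..<p}. of_nat (y * t mod p) * chi (int t))"
      "W * inverse (chi (int z)) = (\<Sum>t\<in>{1..<p}. of_nat (z * t mod p) * chi (int t))"
      "W * inverse (chi (int (x + y + z))) = (\<Sum>t\<in>{1..<p}. of_nat ((x + y + z) * t mod p) * chi (int t))"
      using x by (intro inv; simp)+
    note i = this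
    show ?thesis
      by (simp only: distrib_left[of W] right_diff_distrib[of W] i)
         (simp only: distrib_right[of _ _ "chi _"] left_diff_distrib[of _ _ "chi _"] sum.distrib sum_subtractf)
  qed
  \<comment> \<open>By \<open>check\<close> the coefficient is 0 at t = 1, 2p at t = p - 1 and p
    elsewhere. The constant part drops out since chi sums to 0 over a period.\<close>
  also have "\<dots> = (\<Sum>t\<in>{1..<p}. of_nat p * chi (int t) - (if t = 1 then of_nat p * chi (int t) else 0) + (if t = p - 1 then of_nat p * chi (int t) else 0))"
  proof (rule sum.cong)
    fix t assume "t \<in> {1..<p}"
    from arg_cong[OF bspec[OF check this], of "of_nat :: nat \<Rightarrow> complex"]
    have e: "of_nat (x * t mod p) + of_nat (y * t mod p) + of_nat (z * t mod p) - of_nat ((x + y + z) * t mod p) =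
      (of_nat p - (if t = 1 then of_nat p else 0) + (if t = p - 1 then of_nat p else 0) :: complex)"
      by (simp only: of_nat_add if_distrib[of of_nat] of_nat_0) (simp only: algebra_simps)
    show "(of_nat (x * t mod p) + of_nat (y * t mod p) + of_nat (z * t mod p) - of_nat ((x + y + z) * t mod p)) * chi (int t) =
        of_nat p * chi (int t) - (if t = 1 then of_nat p * chi (int t) else 0) + (if t = p - 1 then of_nat p * chi (int t) else 0)"
      unfolding e by (cases "t = 1"; cases "t = p - 1") (simp_all add: algebra_simps)
  qed simp
  also have "\<dots> = of_nat p * (\<Sum>t\<in>{1..<p}. chi (int t)) - of_nat p * chi 1 + of_nat p * chi (int (p - 1))"
    using p by (simp add: sum.distrib sum_subtractf sum.delta flip: sum_distrib_left)
  also have "chi (int (p - 1)) = chi (-1)"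
    by (rule dirichlet_character_cong[OF dc]) (use p in \<open>simp add: cong_iff_dvd_diff of_nat_diff\<close>)
  finally have WD: "W * ?D = - 2 * of_nat p"
    using chi zero dirichlet_character_1[OF dc] by (simp add: odd_characters_def)
  \<comment> \<open>This also yields that L(0, chi) is not 0, which legitimises the
    division.\<close>
  then have "dirichlet_L chi 0 * ?D = 2" unfolding L using p by (simp add: field_simps)
  then show ?thesis by (metis nonzero_mult_div_cancel_left mult_zero_left zero_neq_numeral)
qed

text \<open>Orthogonality moved from 1 to r: the inverse of chi(r) is chi(s) for s inverse to r
  modulo p. If p divides n, both sides vanish.\<close>

lemma sum_odd_characters_inverse:
  assumes p: "prime p" "p > 2" and r: "0 < r" "r < p"
  shows "(\<Sum>chi\<in>odd_characters p. inverse (chi (int r)) * chi n) =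
    of_nat ((p - 1) div 2) * (of_bool [n = int r] (mod int p) - of_bool [n = - int r] (mod int p))"
proof -
  have cr: "coprime (int r) (int p)" using r p by (metis coprime_commute coprime_int_iff nat_dvd_not_less prime_imp_coprime)
  show ?thesis
  proof (cases "coprime n (int p)")
    case False
    then have "inverse (chi (int r)) * chi n = 0" if "chi \<in> odd_characters p" for chi
      using that by (auto simp: odd_characters_def dirichlet_character_def)
    then have "(\<Sum>chi\<in>odd_characters p. inverse (chi (int r)) * chi n) = 0" by (intro sum.neutral) blast
    moreover have "\<not> [n = int r] (mod int p)" "\<not> [n = - int r] (mod int p)"
      using False cr cong_imp_coprime cong_sym by (blast, metis coprime_minus_left_iff cong_imp_coprime cong_sym)
    ultimately show ?thesis by simp
  next
    case True
    obtain s where s: "[int r * s = 1] (mod int p)" using cr cong_solve_coprime_int by blast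
    have cs: "coprime s (int p)" using s by (metis cong_imp_coprime cong_sym coprime_1_left coprime_mult_left_iff)
    have "(\<Sum>chi\<in>odd_characters p. inverse (chi (int r)) * chi n) = (\<Sum>chi\<in>odd_characters p. chi (s * n))"
    proof (rule sum.cong)
      fix chi assume "chi \<in> odd_characters p"
      then have dc: "dirichlet_character p chi" by (simp add: odd_characters_def)
      have "chi (int r) * chi s = 1"
        using dirichlet_character_cong[OF dc s] dirichlet_character_1[OF dc] dc by (simp add: dirichlet_character_def)
      then have "inverse (chi (int r)) = chi s" by (rule inverse_unique)
      then show "inverse (chi (int r)) * chi n = chi (s * n)" using dc by (simp add: dirichlet_character_def)
    qed simp
    also have "\<dots> = of_nat ((p - 1) div 2) * (of_bool [s * n = 1] (mod int p) - of_bool [s * n = -1] (mod int p))"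
      by (rule sum_odd_characters[OF p]) (use cs True in simp)
    also have "[s * n = 1] (mod int p) \<longleftrightarrow> [n = int r] (mod int p)"
    proof -
      have "[s * n = 1] (mod int p) \<longleftrightarrow> [s * n = s * int r] (mod int p)"
        using s by (simp add: cong_def mult.commute)
      then show ?thesis by (simp only: cong_mult_lcancel[OF cs])
    qed
    also have "[s * n = -1] (mod int p) \<longleftrightarrow> [n = - int r] (mod int p)"
    proof -
      have "[s * - int r = - 1] (mod int p)" using s by (simp add: cong_minus_minus_iff mult.commute)
      then have "[s * n = -1] (mod int p) \<longleftrightarrow> [s * n = s * - int r] (mod int p)"
        by (simp add: cong_def)
      then show ?thesis by (simp only: cong_mult_lcancel[OF cs])
    qed
    finally show ?thesis .
  qed
qed

text \<open>Replacing 2 / L(0, chi) by four inverse character values lets orthogonality act: the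
  averaged coefficients become signed indicators of the classes of x, y, z and x+y+z and of their
  negatives. These are the Lambert coefficients of the logarithmic derivatives, and the constant
  term 1 is the 2 pi i of the addition formula divided by 2 pi i.\<close>

lemma eisenstein_avg_eq_kronecker3:
  assumes \<tau>: "Im \<tau> > 0" and p: "prime p" "p > 2"
    and x: "0 < x" "0 < y" "0 < z" "x + y + z < p"
    and check: "\<forall>t\<in>{1..<p}. x * t mod p + y * t mod p + z * t mod p + (if t = 1 then p else 0) =
      (x + y + z) * t mod p + p + (if t = p - 1 then p else 0)"
  shows "eisenstein_avg p \<tau> = kronecker3 (of_nat p * \<tau>) (of_nat x * \<tau>) (of_nat y * \<tau>) (of_nat z * \<tau>)"
proof -
  define F where "F n = nome \<tau> ^ Suc n / (1 - nome \<tau> ^ Suc n)" for n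
  define h where "h = (p - 1) div 2"
  have hp: "of_nat p - 1 = (2 * of_nat h :: complex)" "h > 0"
  proof -
    have "p = 2 * h + 1" using p prime_odd_nat[of p] by (auto simp: h_def elim: oddE)
    then show "of_nat p - 1 = (2 * of_nat h :: complex)" by simp
    show "h > 0" using p by (simp add: h_def)
  qed
  have q: "norm (nome \<tau>) < 1" by (rule norm_nome_less_1[OF \<tau>])
  define T where "T chi r n = inverse (chi (int r)) * chi (int (Suc n))" for chi :: "int \<Rightarrow> complex" and r n
  define d where "d r n = of_bool [int (Suc n) = int r] (mod int p) - (of_bool [int (Suc n) = - int r] (mod int p) :: complex)" for r n
  have Tsum: "(\<Sum>chi\<in>odd_characters p. T chi r n) = of_nat h * d r n" if "0 < r" "r < p" for r n
    unfolding T_def d_def h_def by (rule sum_odd_characters_inverse[OF p that])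
  have char_sums: "(\<lambda>n. (T chi x n + T chi y n + T chi z n - T chi (x + y + z) n) * F n) sums (eisenstein1 chi \<tau> - 1)"
    if chi: "chi \<in> odd_characters p" for chi
  proof -
    have dc: "dirichlet_character p chi" using chi by (simp add: odd_characters_def)
    obtain B where B: "B \<ge> 0" "\<And>n. norm (chi (int (Suc n))) \<le> B"
    proof (rule periodic_bounded[of p "\<lambda>n. chi (int (Suc n))"])
      show "chi (int (Suc (n + p))) = chi (int (Suc n))" for n
        by (rule dirichlet_character_cong[OF dc]) (simp add: cong_iff_dvd_diff)
    qed (use p that in auto)
    have "summable (\<lambda>n. B * (norm (nome \<tau>) ^ n / (1 - norm (nome \<tau>))))"
      by (intro summable_mult summable_divide summable_geometric) (use q in auto)
    then have "summable (\<lambda>n. chi (int (Suc n)) * F n)"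
    proof (rule summable_comparison_test')
      show "norm (chi (int (Suc n)) * F n) \<le> B * (norm (nome \<tau>) ^ n / (1 - norm (nome \<tau>)))" for n
        unfolding norm_mult F_def by (intro mult_mono B norm_lambert_term_le q) auto
    qed
    then have "(\<lambda>n. 2 / dirichlet_L chi 0 * (chi (int (Suc n)) * F n)) sums (2 / dirichlet_L chi 0 * (\<Sum>n. chi (int (Suc n)) * F n))"
      by (intro sums_mult summable_sums)
    also have "2 / dirichlet_L chi 0 * (\<Sum>n. chi (int (Suc n)) * F n) = eisenstein1 chi \<tau> - 1"
      by (simp add: eisenstein1_def F_def)
    finally show ?thesis
      unfolding inverse_dirichlet_L_0[OF chi p x check] T_def by (simp only: algebra_simps)
  qed
  have "(\<lambda>n. \<Sum>chi\<in>odd_characters p. (T chi x n + T chi y n + T chi z n - T chi (x + y + z) n) * F n) sums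
      (\<Sum>chi\<in>odd_characters p. eisenstein1 chi \<tau> - 1)"
    by (rule sums_sum) (rule char_sums)
  also have "(\<lambda>n. \<Sum>chi\<in>odd_characters p. (T chi x n + T chi y n + T chi z n - T chi (x + y + z) n) * F n) =
      (\<lambda>n. of_nat h * ((d x n + d y n + d z n - d (x + y + z) n) * F n))"
  proof
    fix n
    have *: "(\<Sum>chi\<in>odd_characters p. T chi x n + T chi y n + T chi z n - T chi (x + y + z) n) =
        of_nat h * d x n + of_nat h * d y n + of_nat h * d z n - of_nat h * d (x + y + z) n"
      unfolding sum_subtractf sum.distrib using x by (simp add: Tsum)
    show "(\<Sum>chi\<in>odd_characters p. (T chi x n + T chi y n + T chi z n - T chi (x + y + z) n) * F n) =
        of_nat h * ((d x n + d y n + d z n - d (x + y + z) n) * F n)"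
      unfolding sum_distrib_right[symmetric] * by (simp only: algebra_simps)
  qed
  finally have 1: "(\<lambda>n. of_nat h * ((d x n + d y n + d z n - d (x + y + z) n) * F n)) sums
      (\<Sum>chi\<in>odd_characters p. eisenstein1 chi \<tau> - 1)" .
  define S where "S r = - (deriv (theta_fun (of_nat p * \<tau>)) (of_nat r * \<tau>) / theta_fun (of_nat p * \<tau>) (of_nat r * \<tau>)) / (2 * of_real pi * \<i>)" for r :: nat
  have nz: "theta_fun (of_nat p * \<tau>) (of_nat r * \<tau>) \<noteq> 0" if "0 < r" "r < p" for r
    using theta_fun_multiple_nonzero[OF \<tau>, of p "int r"] that nat_dvd_not_less[of r p] by simp
  have Ssum: "(\<lambda>n. d r n * F n) sums S r" if "0 < r" "r < p" for r
    unfolding d_def F_def S_def by (rule theta_fun_logderiv_residue_class[OF \<tau> that nz[OF that]])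
  have "(\<lambda>n. of_nat h * (d x n * F n + d y n * F n + d z n * F n - d (x + y + z) n * F n)) sums (of_nat h * (S x + S y + S z - S (x + y + z)))"
    using x by (intro sums_mult sums_add sums_diff Ssum) auto
  then have 2: "(\<lambda>n. of_nat h * ((d x n + d y n + d z n - d (x + y + z) n) * F n)) sums (of_nat h * (S x + S y + S z - S (x + y + z)))"
    by (simp only: distrib_right left_diff_distrib)
  have "(\<Sum>chi\<in>odd_characters p. eisenstein1 chi \<tau>) - of_nat h = of_nat h * (S x + S y + S z - S (x + y + z))"
    using sums_unique2[OF 1 2] card_odd_characters[OF p] by (simp add: sum_subtractf h_def)
  then have e: "(\<Sum>chi\<in>odd_characters p. eisenstein1 chi \<tau>) = of_nat h * (1 + (S x + S y + S z - S (x + y + z)))"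
    by (simp add: algebra_simps)
  have "eisenstein_avg p \<tau> = 1 + (S x + S y + S z - S (x + y + z))"
    unfolding eisenstein_avg_def e hp(1) using hp(2) by simp
  also have "\<dots> = kronecker3 (of_nat p * \<tau>) (of_nat x * \<tau>) (of_nat y * \<tau>) (of_nat z * \<tau>)"
  proof -
    have e: "of_nat y * \<tau> + of_nat z * \<tau> = of_nat (y + z) * \<tau>"
      "of_nat x * \<tau> + of_nat y * \<tau> + of_nat z * \<tau> = of_nat (x + y + z) * \<tau>" by (simp_all add: algebra_simps)
    define l where "l r = deriv (theta_fun (of_nat p * \<tau>)) (of_nat r * \<tau>) / theta_fun (of_nat p * \<tau>) (of_nat r * \<tau>)" for r :: nat
    have "2 * of_real pi * \<i> * kronecker3 (of_nat p * \<tau>) (of_nat x * \<tau>) (of_nat y * \<tau>) (of_nat z * \<tau>) =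
        2 * of_real pi * \<i> - (l x + l y + l z - l (x + y + z))"
      unfolding l_def e(2)[symmetric]
      by (rule theta_fun_addition) (use \<tau> p x nz in \<open>auto simp only: e\<close>, simp_all)
    moreover have lS: "l r = - (2 * of_real pi * \<i>) * S r" for r by (simp add: l_def S_def)
    ultimately have "2 * of_real pi * \<i> * kronecker3 (of_nat p * \<tau>) (of_nat x * \<tau>) (of_nat y * \<tau>) (of_nat z * \<tau>) =
        2 * of_real pi * \<i> * (1 + (S x + S y + S z - S (x + y + z)))"
      unfolding lS by (simp add: algebra_simps)
    then show ?thesis by simp
  qed
  finally show ?thesis .
qed

section \<open>Klein forms and theta constants\<close>

text \<open>The power of the nome makes the theta values odd and antiperiodic in \<open>r\<close> modulo \<open>p\<close>.\<close>

definition klein_form :: "nat \<Rightarrow> complex \<Rightarrow> int \<Rightarrow> complex" where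
  "klein_form p \<tau> r = nome ((of_int r ^ 2 / (2 * of_nat p) - of_int r / 2) * \<tau>) * theta_fun (of_nat p * \<tau>) (of_int r * \<tau>)"

context
  fixes p :: nat and \<tau> :: complex
  assumes p0: "p > 0" and tau: "Im \<tau> > 0"
begin

lemma ptau: "Im (of_nat p * \<tau>) > 0" using p0 tau by simp

lemma klein_form_minus: "klein_form p \<tau> (- r) = - klein_form p \<tau> r"
proof -
  have "nome ((of_int (- r) ^ 2 / (2 * of_nat p) - of_int (- r) / 2) * \<tau>) * nome (- (of_int r * \<tau>)) =
      nome ((of_int r ^ 2 / (2 * of_nat p) - of_int r / 2) * \<tau>)"
    unfolding nome_add[symmetric] by (simp add: algebra_simps)
  moreover have "theta_fun (of_nat p * \<tau>) (of_int (- r) * \<tau>) = - nome (- (of_int r * \<tau>)) * theta_fun (of_nat p * \<tau>) (of_int r * \<tau>)"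
    using theta_fun_minus[OF ptau, of "of_int r * \<tau>"] by simp
  ultimately show ?thesis by (simp add: klein_form_def mult.assoc[symmetric])
qed

lemma klein_form_add_p: "klein_form p \<tau> (r + int p) = - klein_form p \<tau> r"
proof -
  have "nome ((of_int (r + int p) ^ 2 / (2 * of_nat p) - of_int (r + int p) / 2) * \<tau>) * nome (- (of_int r * \<tau>)) =
      nome ((of_int r ^ 2 / (2 * of_nat p) - of_int r / 2) * \<tau>)"
    unfolding nome_add[symmetric] using p0
    by (intro arg_cong[where f = nome]) (simp add: field_simps power2_eq_square)
  moreover have "theta_fun (of_nat p * \<tau>) (of_int (r + int p) * \<tau>) = - nome (- (of_int r * \<tau>)) * theta_fun (of_nat p * \<tau>) (of_int r * \<tau>)"
    using theta_fun_add_tau[OF ptau, of "of_int r * \<tau>"] by (simp add: algebra_simps)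
  ultimately show ?thesis by (simp add: klein_form_def mult.assoc[symmetric])
qed

lemma klein_form_nonzero: "\<not> int p dvd r \<Longrightarrow> klein_form p \<tau> r \<noteq> 0"
  using theta_fun_multiple_nonzero[OF tau _ p0] by (simp add: klein_form_def)

lemma klein_form_add_multiple:
  "klein_form p \<tau> (r + int p * k) = (if even k then 1 else - 1) * klein_form p \<tau> r"
proof (induction k rule: int_induct[where k = 0])
  case (step1 i)
  then show ?case using klein_form_add_p[of "r + int p * i"] by (simp add: algebra_simps)
next
  case (step2 i)
  then show ?case using klein_form_add_p[of "r + int p * (i - 1)"] by (auto simp: algebra_simps split: if_splits)
qed simp

text \<open>The nome factors are again quadratic in the argument without constant term, so they
  cancel by the same equality of sums and sums of squares.\<close>

lemma kronecker3_klein_form: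
  "kronecker3 (of_nat p * \<tau>) (of_int X * \<tau>) (of_int Y * \<tau>) (of_int Z * \<tau>) =
    euler_prod (nome (of_nat p * \<tau>)) ^ 2 *
      (klein_form p \<tau> (X + Y) * klein_form p \<tau> (Y + Z) * klein_form p \<tau> (Z + X)) /
      (klein_form p \<tau> X * klein_form p \<tau> Y * klein_form p \<tau> Z * klein_form p \<tau> (X + Y + Z))"
proof -
  define e where "e r = nome ((of_int r ^ 2 / (2 * of_nat p) - of_int r / 2) * \<tau>)" for r
  define t where "t r = theta_fun (of_nat p * \<tau>) (of_int r * \<tau>)" for r
  have k: "klein_form p \<tau> r = e r * t r" for r by (simp add: klein_form_def e_def t_def)
  have ee: "e (X + Y) * e (Y + Z) * e (Z + X) = e X * e Y * e Z * e (X + Y + Z)"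
    unfolding e_def nome_add[symmetric] using p0
    by (intro arg_cong[where f = nome]) (simp add: field_simps power2_eq_square)
  have e0: "e r \<noteq> 0" for r by (simp add: e_def)
  have "euler_prod (nome (of_nat p * \<tau>)) ^ 2 *
      (klein_form p \<tau> (X + Y) * klein_form p \<tau> (Y + Z) * klein_form p \<tau> (Z + X)) /
      (klein_form p \<tau> X * klein_form p \<tau> Y * klein_form p \<tau> Z * klein_form p \<tau> (X + Y + Z)) =
    ((e (X + Y) * e (Y + Z) * e (Z + X)) * (euler_prod (nome (of_nat p * \<tau>)) ^ 2 * (t (X + Y) * t (Y + Z) * t (Z + X)))) /
    ((e X * e Y * e Z * e (X + Y + Z)) * (t X * t Y * t Z * t (X + Y + Z)))"
    unfolding k by (simp only: mult_ac)
  also have "\<dots> = euler_prod (nome (of_nat p * \<tau>)) ^ 2 * (t (X + Y) * t (Y + Z) * t (Z + X)) / (t X * t Y * t Z * t (X + Y + Z))"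
    unfolding ee using e0 by simp
  finally show ?thesis
    by (simp add: kronecker3_def t_def distrib_right)
qed

text \<open>Shifting an argument by p times k gives the sign (-1)^k. Each of the three shifts enters
  four of the seven Klein forms, so the signs cancel.\<close>

lemma kronecker3_cong:
  assumes "[X = X'] (mod int p)" "[Y = Y'] (mod int p)" "[Z = Z'] (mod int p)"
  shows "kronecker3 (of_nat p * \<tau>) (of_int X * \<tau>) (of_int Y * \<tau>) (of_int Z * \<tau>) =
    kronecker3 (of_nat p * \<tau>) (of_int X' * \<tau>) (of_int Y' * \<tau>) (of_int Z' * \<tau>)"
proof -
  obtain k l m where e: "X = X' + int p * k" "Y = Y' + int p * l" "Z = Z' + int p * m"
    using assms unfolding cong_iff_dvd_diff by (metis add_diff_cancel_left' diff_add_cancel dvdE add.commute)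
  \<comment> \<open>The left side of the last equation is half rewritten, because unfolding the
    first one already replaces X + Y inside X + Y + Z.\<close>
  have s: "X + Y = (X' + Y') + int p * (k + l)" "Y + Z = (Y' + Z') + int p * (l + m)"
    "Z + X = (Z' + X') + int p * (m + k)" "X' + Y' + int p * (k + l) + Z = (X' + Y' + Z') + int p * (k + l + m)"
    by (simp_all add: e algebra_simps)
  show ?thesis
    unfolding kronecker3_klein_form s unfolding e klein_form_add_multiple
    by (cases "even k"; cases "even l"; cases "even m") simp_all
qed

text \<open>Half the characteristic, v = (2k-1)/(2p), equals 1/2 - r/p. Expanding the square in the
  theta series therefore gives Jacobi's series with nome q^p and u = q^r; the summation index
  changes sign because v decreases in r.\<close>

lemma theta_phi_klein_form:
  assumes r: "2 * int r = int p + 1 - 2 * int k"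
  shows "exp (- (of_real pi * \<i> * (2 * of_nat k - 1) / (2 * of_nat p))) * theta_phi p k \<tau> =
    euler_prod (nome (of_nat p * \<tau>)) * nome (of_nat p * \<tau> / 8) * klein_form p \<tau> (int r)"
proof -
  define v :: complex where "v = (2 * of_nat k - 1) / (2 * of_nat p)"
  define q u where "q = nome (of_nat p * \<tau>)" and "u = nome (of_nat r * \<tau>)"
  have "of_int (2 * int r) = (of_int (int p + 1 - 2 * int k) :: complex)" using r by simp
  then have rc: "2 * of_nat r = (of_nat p + 1 - 2 * of_nat k :: complex)" by simp
  then have v: "v = 1 / 2 - of_nat r / of_nat p" using p0 by (simp add: v_def field_simps)
  \<comment> \<open>The part of the exponent that is independent of the summation index.\<close>
  define c where "c = nome (v / 2) * nome (of_nat p * v ^ 2 * \<tau> / 2)"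
  have q: "norm q < 1" unfolding q_def by (rule norm_nome_less_1[OF ptau])
  have "((\<lambda>j :: int. c * ((- u) powi j * q ^ nat (j * (j - 1) div 2))) has_sum (c * (euler_prod q * theta_prod q u))) UNIV"
    by (intro has_sum_cmult_right jacobi_triple_product q) (simp_all add: q_def u_def)
  moreover have "c * ((- u) powi j * q ^ nat (j * (j - 1) div 2)) =
      exp (2 * of_real pi * \<i> * ((of_int (- j) + v)\<^sup>2 * (of_nat p * \<tau>) / 2 + (of_int (- j) + v) / 2))" for j
  proof -
    have ev: "even (j * (j - 1))" by simp
    have "j * (j - 1) \<ge> 0" by (cases "j \<ge> 1") (auto simp: mult_nonneg_nonneg mult_nonpos_nonpos)
    moreover define m where "m = nat (j * (j - 1) div 2)"
    ultimately have "int m = j * (j - 1) div 2" by (simp add: pos_imp_zdiv_nonneg_iff)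
    moreover have "2 * (j * (j - 1) div 2) = j * (j - 1)" using ev by simp
    ultimately have "2 * int m = j * (j - 1)" by simp
    then have "(of_int (2 * int m) :: complex) = of_int (j * (j - 1))" by (simp only:)
    then have "2 * of_nat m = (of_int j * (of_int j - 1) :: complex)" by simp
    then have n: "(of_nat (nat (j * (j - 1) div 2)) :: complex) = of_int j * (of_int j - 1) / 2"
      unfolding m_def[symmetric] by (simp add: mult.commute)
    have a: "q ^ nat (j * (j - 1) div 2) = nome (of_int j * (of_int j - 1) / 2 * (of_nat p * \<tau>))"
      unfolding q_def nome_mult_of_nat[symmetric] n ..
    have "- u = nome (of_nat r * \<tau> - 1 / 2)"
      unfolding u_def diff_conv_add_uminus nome_add by (simp add: nome_def exp_minus)
    then have b: "(- u) powi j = nome (of_int j * (of_nat r * \<tau> - 1 / 2))"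
      by (simp add: nome_def exp_power_int mult_ac)
    have "c * ((- u) powi j * q ^ nat (j * (j - 1) div 2)) = nome (v / 2 + of_nat p * v ^ 2 * \<tau> / 2 + (of_int j * (of_nat r * \<tau> - 1 / 2) + of_int j * (of_int j - 1) / 2 * (of_nat p * \<tau>)))"
      unfolding a b c_def nome_add ..
    also have "v / 2 + of_nat p * v ^ 2 * \<tau> / 2 + (of_int j * (of_nat r * \<tau> - 1 / 2) + of_int j * (of_int j - 1) / 2 * (of_nat p * \<tau>)) =
      ((of_int (- j) + v)\<^sup>2 * (of_nat p * \<tau>) / 2 + (of_int (- j) + v) / 2)"
    proof -
      have r': "of_nat r = of_nat p * (1 / 2 - v)" using v p0 by (simp add: field_simps)
      show ?thesis unfolding r' by (simp add: power2_eq_square field_simps)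
    qed
    finally show ?thesis by (simp add: nome_def)
  qed
  ultimately have "((\<lambda>j :: int. exp (2 * of_real pi * \<i> * ((of_int (- j) + v)\<^sup>2 * (of_nat p * \<tau>) / 2 + (of_int (- j) + v) / 2))) has_sum (c * (euler_prod q * theta_prod q u))) UNIV"
    by simp
  moreover have bij: "bij_betw uminus (UNIV :: int set) UNIV" by (simp add: bij_uminus)
  ultimately have hs: "((\<lambda>n :: int. exp (2 * of_real pi * \<i> * ((of_int n + v)\<^sup>2 * (of_nat p * \<tau>) / 2 + (of_int n + v) / 2))) has_sum (c * (euler_prod q * theta_prod q u))) UNIV"
    using has_sum_reindex_bij_betw[OF bij, of "\<lambda>n. exp (2 * of_real pi * \<i> * ((of_int n + v)\<^sup>2 * (of_nat p * \<tau>) / 2 + (of_int n + v) / 2))"] by blast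
  have "theta_phi p k \<tau> = c * (euler_prod q * theta_prod q u)"
  proof -
    have "of_real ((2 * real k - 1) / real p) / 2 = v" by (simp add: v_def mult.commute)
    then show ?thesis
      unfolding theta_phi_def theta_char_def by (simp add: infsumI[OF hs])
  qed
  moreover have "exp (- (of_real pi * \<i> * (2 * of_nat k - 1) / (2 * of_nat p))) = nome (- (v / 2))"
  proof -
    have "2 * of_real pi * \<i> * (- (v / 2)) = - (of_real pi * \<i> * v)" by simp
    then show ?thesis unfolding nome_def by (simp only: v_def times_divide_eq_right)
  qed
  \<comment> \<open>The prefactor in the theta quotient removes \<open>nome (v / 2)\<close>, and p
    v^2 / 2 = p/8 + r^2/(2p) - r/2 splits off the Klein exponent.\<close>
  moreover have "nome (- (v / 2)) * c = nome (of_nat p * \<tau> / 8) * nome ((of_int (int r) ^ 2 / (2 * of_nat p) - of_int (int r) / 2) * \<tau>)"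
    unfolding c_def nome_add[symmetric] v using p0
    by (intro arg_cong[where f = nome]) (simp add: field_simps power2_eq_square)
  ultimately show ?thesis
    by (simp add: klein_form_def theta_fun_def q_def u_def mult_ac)
qed

text \<open>Each theta constant contributes the same factor c = E q^(p/8) besides its Klein form.
  Exponents of sum -1 leave 1/c, and eta^3 = c E^2 turns this into E^2.\<close>

lemma theta_quot_klein_form:
  assumes odd: "odd p" and b: "(\<Sum>k = 1..(p - 1) div 2. b ! (k - 1)) = - 1"
  shows "theta_quot p b \<tau> = euler_prod (nome (of_nat p * \<tau>)) ^ 2 *
    (\<Prod>k = 1..(p - 1) div 2. klein_form p \<tau> (int ((p + 1) div 2) - int k) powi (b ! (k - 1)))"
proof -
  define E where "E = euler_prod (nome (of_nat p * \<tau>))"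
  define c where "c = E * nome (of_nat p * \<tau> / 8)"
  have E0: "E \<noteq> 0" unfolding E_def by (rule qfact_tendsto[OF norm_nome_less_1[OF ptau]])
  have c0: "c \<noteq> 0" using E0 by (simp add: c_def)
  have "(\<Prod>k = 1..(p - 1) div 2. exp (- (of_real pi * \<i> * of_int (b ! (k - 1)) * (2 * of_nat k - 1) / (2 * of_nat p))) * theta_phi p k \<tau> powi (b ! (k - 1))) =
    (\<Prod>k = 1..(p - 1) div 2. c powi (b ! (k - 1)) * klein_form p \<tau> (int ((p + 1) div 2) - int k) powi (b ! (k - 1)))"
  proof (rule prod.cong)
    fix k assume k: "k \<in> {1..(p - 1) div 2}"
    define r where "r = (p + 1) div 2 - k"
    have r: "2 * int r = int p + 1 - 2 * int k" "int r = int ((p + 1) div 2) - int k"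
      using odd k by (auto simp: r_def elim!: oddE)
    have "exp (- (of_real pi * \<i> * of_int (b ! (k - 1)) * (2 * of_nat k - 1) / (2 * of_nat p))) =
        exp (- (of_real pi * \<i> * (2 * of_nat k - 1) / (2 * of_nat p))) powi (b ! (k - 1))"
      by (simp add: exp_power_int mult_ac)
    then have "exp (- (of_real pi * \<i> * of_int (b ! (k - 1)) * (2 * of_nat k - 1) / (2 * of_nat p))) * theta_phi p k \<tau> powi (b ! (k - 1)) =
      (exp (- (of_real pi * \<i> * (2 * of_nat k - 1) / (2 * of_nat p))) * theta_phi p k \<tau>) powi (b ! (k - 1))"
      by (simp add: power_int_mult_distrib)
    also have "\<dots> = c powi (b ! (k - 1)) * klein_form p \<tau> (int ((p + 1) div 2) - int k) powi (b ! (k - 1))"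
      unfolding theta_phi_klein_form[OF r(1)] r(2) by (simp add: c_def E_def power_int_mult_distrib)
    finally show "exp (- (of_real pi * \<i> * of_int (b ! (k - 1)) * (2 * of_nat k - 1) / (2 * of_nat p))) * theta_phi p k \<tau> powi (b ! (k - 1)) =
      c powi (b ! (k - 1)) * klein_form p \<tau> (int ((p + 1) div 2) - int k) powi (b ! (k - 1))" .
  qed simp
  moreover have "(\<Prod>k\<in>K. c powi f k) = c powi (\<Sum>k\<in>K. f k)" if "finite K" for K :: "nat set" and f
    using that c0 by (induction K rule: finite_induct) (simp_all add: power_int_add)
  moreover have "dedekind_eta (of_nat p * \<tau>) ^ 3 = c * E ^ 2"
  proof -
    have "dedekind_eta (of_nat p * \<tau>) = nome (of_nat p * \<tau> / 24) * E"
      by (simp add: dedekind_eta_def nome_def E_def euler_prod_def)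
    moreover have "nome (of_nat p * \<tau> / 24) ^ 3 = nome (of_nat p * \<tau> / 8)"
      using nome_mult_of_nat[of 3 "of_nat p * \<tau> / 24"] by (simp add: mult.commute)
    ultimately show ?thesis by (simp add: c_def power_mult_distrib) (simp add: power3_eq_cube power2_eq_square)
  qed
  ultimately show ?thesis
    using c0 b by (simp add: theta_quot_def prod.distrib E_def power_int_minus)
qed

end

text \<open>Every admissible matrix gives the same value, as required by \<open>THE\<close>: the
  transformation law of K removes the automorphy factor, integer translations disappear by
  periodicity, and only the upper left entry modulo p matters.\<close>

lemma diamond_eisenstein_avg:
  assumes \<tau>: "Im \<tau> > 0" and p: "prime p" "p > 2"
    and x: "0 < x" "0 < y" "0 < z" "x + y + z < p"
    and check: "\<forall>t\<in>{1..<p}. x * t mod p + y * t mod p + z * t mod p + (if t = 1 then p else 0) =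
      (x + y + z) * t mod p + p + (if t = p - 1 then p else 0)"
    and a: "coprime a (int p)"
    and X: "[a * X = int x] (mod int p)" "[a * Y = int y] (mod int p)" "[a * Z = int z] (mod int p)"
  shows "diamond p a (eisenstein_avg p) \<tau> =
    kronecker3 (of_nat p * \<tau>) (of_int X * \<tau>) (of_int Y * \<tau>) (of_int Z * \<tau>)"
proof -
  have val: "inverse (automorphy \<gamma> \<tau>) * eisenstein_avg p (sl2_act \<gamma> \<tau>) =
      kronecker3 (of_nat p * \<tau>) (of_int X * \<tau>) (of_int Y * \<tau>) (of_int Z * \<tau>)"
    if g: "det \<gamma> = 1" "[\<gamma> $ 2 $ 1 = 0] (mod int p)" "[\<gamma> $ 2 $ 2 = a] (mod int p)" for \<gamma> :: "int^2^2"
  proof -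
    define A B D where "A = \<gamma> $ 1 $ 1" and "B = \<gamma> $ 1 $ 2" and "D = \<gamma> $ 2 $ 2"
    obtain C where C: "\<gamma> $ 2 $ 1 = int p * C" using g(2) by (auto simp: cong_0_iff)
    have det: "A * D - (int p * B) * C = 1" using g(1) by (simp add: det_2 A_def B_def D_def C mult_ac)
    define j where "j = automorphy \<gamma> \<tau>"
    have j: "j = of_int (int p * C) * \<tau> + of_int D" by (simp add: j_def automorphy_def C D_def)
    have act: "sl2_act \<gamma> \<tau> = (of_int A * \<tau> + of_int B) / j"
      by (simp add: sl2_act_def j_def A_def B_def)
    have det1: "A * D - B * (int p * C) = 1" using det by (simp add: mult_ac)
    have j0: "j \<noteq> 0" and Im: "Im (sl2_act \<gamma> \<tau>) > 0"
      using Im_moebius_pos[OF \<tau> det1] by (simp_all add: act j)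
    define t where "t = sl2_act \<gamma> \<tau>"
    \<comment> \<open>p times the image of tau is the image of p tau under the matrix with rows (A,
      pB) and (C, D), integral because p divides the lower left entry.\<close>
    have pt: "of_nat p * t = (of_int A * (of_nat p * \<tau>) + of_int (int p * B)) / j"
      by (simp add: t_def act algebra_simps)
    have rt: "of_nat r * t = (of_int (int r * A) * \<tau> + of_int (int r * B)) / j" for r
      by (simp add: t_def act algebra_simps)
    have j': "j = of_int C * (of_nat p * \<tau>) + of_int D" by (simp add: j mult_ac)
    have ptau: "Im (of_nat p * \<tau>) > 0" using \<tau> p by simp
    have "eisenstein_avg p t = kronecker3 (of_nat p * t) (of_nat x * t) (of_nat y * t) (of_nat z * t)"
      by (rule eisenstein_avg_eq_kronecker3[OF Im[folded t_def] p x check])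
    also have "\<dots> = j * kronecker3 (of_nat p * \<tau>) (of_int (int x * A) * \<tau> + of_int (int x * B))
        (of_int (int y * A) * \<tau> + of_int (int y * B)) (of_int (int z * A) * \<tau> + of_int (int z * B))"
      unfolding pt unfolding rt unfolding j' by (rule kronecker3_moebius[OF ptau det])
    also have "kronecker3 (of_nat p * \<tau>) (of_int (int x * A) * \<tau> + of_int (int x * B))
        (of_int (int y * A) * \<tau> + of_int (int y * B)) (of_int (int z * A) * \<tau> + of_int (int z * B)) =
      kronecker3 (of_nat p * \<tau>) (of_int (int x * A) * \<tau>) (of_int (int y * A) * \<tau>) (of_int (int z * A) * \<tau>)"
    proof -
      have "kronecker3 \<sigma> (u + of_int k) (v + of_int l) (w + of_int m) = kronecker3 \<sigma> u v w" for \<sigma> u v w k l m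
      proof -
        have "u + of_int k + (v + of_int l) = u + v + of_int (k + l)" "v + of_int l + (w + of_int m) = v + w + of_int (l + m)"
          "w + of_int m + (u + of_int k) = w + u + of_int (m + k)" "u + v + of_int (k + l) + (w + of_int m) = u + v + w + of_int (k + l + m)"
          by simp_all
        then show ?thesis unfolding kronecker3_def by (simp only: theta_fun_add_int)
      qed
      then show ?thesis .
    qed
    also have "\<dots> = kronecker3 (of_nat p * \<tau>) (of_int X * \<tau>) (of_int Y * \<tau>) (of_int Z * \<tau>)"
    proof -
      \<comment> \<open>The upper left entry is inverse to D, hence to a; this is how the triple
        gets divided by a.\<close>
      have "[A * D = 1] (mod int p)" using det by (simp add: cong_iff_dvd_diff algebra_simps)
      then have Aa: "[A * a = 1] (mod int p)" using g(3) unfolding D_def by (metis cong_scalar_left cong_sym cong_trans)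
      have "[int r * A = R] (mod int p)" if "[a * R = int r] (mod int p)" for r R
      proof -
        have "[int r * A = (a * R) * A] (mod int p)" using that cong_scalar_right cong_sym by blast
        also have "(a * R) * A = (A * a) * R" by simp
        also have "[(A * a) * R = 1 * R] (mod int p)" using Aa by (rule cong_scalar_right)
        finally show ?thesis by simp
      qed
      then show ?thesis by (intro kronecker3_cong) (use p \<tau> X in auto)
    qed
    finally show ?thesis using j0 by (simp add: t_def j_def)
  qed
  \<comment> \<open>\<open>THE\<close> also needs one admissible matrix; it is built from an inverse
    of a modulo p.\<close>
  obtain a' where "[a * a' = 1] (mod int p)" using a cong_solve_coprime_int by blast
  then have "int p dvd a * a' - 1" by (simp add: cong_iff_dvd_diff)
  then obtain k where k: "a * a' - 1 = int p * k" by blast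
  define \<gamma> :: "int^2^2" where "\<gamma> = vector [vector [a', k], vector [int p, a]]"
  have "det \<gamma> = 1" using k by (simp add: det_2 \<gamma>_def algebra_simps)
  moreover have "[\<gamma> $ 2 $ 1 = 0] (mod int p)" "[\<gamma> $ 2 $ 2 = a] (mod int p)" by (simp_all add: \<gamma>_def cong_def)
  ultimately show ?thesis
    unfolding diamond_def using val by (intro the_equality) auto
qed

section \<open>The table\<close>

text \<open>A recursion that the simplifier can unroll on a concrete row. The argument falls along
  the list since b_k belongs to the Klein form at (p+1)/2 - k.\<close>

primrec power_int_list :: "(int \<Rightarrow> complex) \<Rightarrow> int \<Rightarrow> int list \<Rightarrow> complex" where
  "power_int_list f r [] = 1"
| "power_int_list f r (c # cs) = f r powi c * power_int_list f (r - 1) cs"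

lemma prod_power_int_list:
  "(\<Prod>k = 1..length b. f (r - int k) powi (b ! (k - 1))) = power_int_list f (r - 1) b"
proof (induction b arbitrary: r)
  case (Cons c cs)
  have "(\<Prod>k = 1..length (c # cs). f (r - int k) powi ((c # cs) ! (k - 1))) =
      f (r - 1) powi c * (\<Prod>k = Suc 1..Suc (length cs). f (r - int k) powi ((c # cs) ! (k - 1)))"
    by (subst prod.atLeast_Suc_atMost) auto
  also have "(\<Prod>k = Suc 1..Suc (length cs). f (r - int k) powi ((c # cs) ! (k - 1))) =
      (\<Prod>k = 1..length cs. f (r - 1 - int k) powi (cs ! (k - 1)))"
    unfolding prod.shift_bounds_cl_Suc_ivl
    by (rule prod.cong) (auto simp: nth_Cons' algebra_simps)
  finally show ?case using Cons[of "r - 1"] by simp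
qed simp

lemma sum_nth_pred: "(\<Sum>k = 1..length b. b ! (k - 1)) = sum_list b" for b :: "int list"
  unfolding One_nat_def sum.atLeast1_atMost_eq by (simp add: sum_list_sum_nth atLeast0LessThan)

text \<open>
  Comparing the two products of Klein forms only needs their symmetries in \<open>r\<close>, so it is stated
  for an arbitrary function with these symmetries.
\<close>

lemma diamond_theta_quot:
  assumes \<tau>: "Im \<tau> > 0" and p: "prime p" "p > 2"
    and x: "0 < x" "0 < y" "0 < z" "x + y + z < p"
    and check: "\<forall>t\<in>{1..<p}. x * t mod p + y * t mod p + z * t mod p + (if t = 1 then p else 0) =
      (x + y + z) * t mod p + p + (if t = p - 1 then p else 0)"
    and X: "[a * X = int x] (mod int p)" "[a * Y = int y] (mod int p)" "[a * Z = int z] (mod int p)"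
    and b: "length b = (p - 1) div 2" "sum_list b = - 1"
    and alg: "\<And>f. (\<And>r. 0 < r \<Longrightarrow> r < int p \<Longrightarrow> f r \<noteq> 0) \<Longrightarrow>
      (\<And>r. int p \<le> r \<Longrightarrow> f r = - f (r - int p)) \<Longrightarrow>
      (\<And>r. int p < 2 * r \<Longrightarrow> r < int p \<Longrightarrow> f r = f (int p - r)) \<Longrightarrow>
      f (X + Y) * f (Y + Z) * f (Z + X) / (f X * f Y * f Z * f (X + Y + Z)) =
      power_int_list f (int ((p - 1) div 2)) b"
  shows "diamond p a (eisenstein_avg p) \<tau> = theta_quot p b \<tau>"
proof -
  have p0: "p > 0" using p by simp
  have odd: "odd p" using p prime_odd_nat by auto
  have "coprime (int x) (int p)"
    using x p by (metis add_lessD1 coprime_commute coprime_int_iff nat_dvd_not_less prime_imp_coprime)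
  then have "coprime (a * X) (int p)" using cong_imp_coprime[OF cong_sym[OF X(1)]] by simp
  then have a: "coprime a (int p)" by simp
  let ?f = "klein_form p \<tau>" and ?E = "euler_prod (nome (of_nat p * \<tau>)) ^ 2"
  have red: "?f r = - ?f (r - int p)" for r
    using klein_form_add_p[OF p0 \<tau>, of "r - int p"] by simp
  have "diamond p a (eisenstein_avg p) \<tau> = kronecker3 (of_nat p * \<tau>) (of_int X * \<tau>) (of_int Y * \<tau>) (of_int Z * \<tau>)"
    by (rule diamond_eisenstein_avg[OF \<tau> p x check a X])
  also have "\<dots> = ?E * (?f (X + Y) * ?f (Y + Z) * ?f (Z + X) / (?f X * ?f Y * ?f Z * ?f (X + Y + Z)))"
    unfolding kronecker3_klein_form[OF p0 \<tau>] by simp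
  also have "?f (X + Y) * ?f (Y + Z) * ?f (Z + X) / (?f X * ?f Y * ?f Z * ?f (X + Y + Z)) =
      power_int_list ?f (int ((p - 1) div 2)) b"
  \<comment> \<open>The guards in \<open>alg\<close> orient the symmetries as terminating rewrite
    rules that bring arguments into the range 1, ..., (p-1)/2. The Klein form satisfies both
    symmetries for all r.\<close>
  proof (rule alg)
    fix r
    show "?f r \<noteq> 0" if "0 < r" "r < int p"
      using that by (intro klein_form_nonzero[OF p0 \<tau>]) (auto dest: zdvd_imp_le)
    show "?f r = - ?f (r - int p)" by (rule red)
    show "?f r = ?f (int p - r)"
      using red[of r] klein_form_minus[OF p0 \<tau>, of "r - int p"] by simp
  qed
  also have "int ((p - 1) div 2) = int ((p + 1) div 2) - 1" using odd by (auto elim: oddE)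
  also have "?E * power_int_list ?f \<dots> b = theta_quot p b \<tau>"
    using theta_quot_klein_form[OF p0 \<tau> odd, of b] sum_nth_pred[of b] b
      prod_power_int_list[of ?f "int ((p + 1) div 2)" b] by simp
  finally show ?thesis .
qed

text \<open>Products such as \<open>1 * t\<close> and the sum \<open>1 + 1 + 1\<close> are left
  unevaluated, so that resolution against \<open>check\<close> reads off p and the triple. The same
  holds for the other primes.\<close>

lemma residue_sum_5:
  "\<forall>t\<in>{1..<5}. 1 * t mod 5 + 1 * t mod 5 + 1 * t mod 5 + (if t = 1 then 5 else 0) =
    (1 + 1 + 1) * t mod 5 + 5 + (if t = 5 - 1 then 5 else (0::nat))"
  by code_simp

lemma residue_sum_7:
  "\<forall>t\<in>{1..<7}. 1 * t mod 7 + 1 * t mod 7 + 2 * t mod 7 + (if t = 1 then 7 else 0) =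
    (1 + 1 + 2) * t mod 7 + 7 + (if t = 7 - 1 then 7 else (0::nat))"
  by code_simp

lemma residue_sum_11:
  "\<forall>t\<in>{1..<11}. 1 * t mod 11 + 2 * t mod 11 + 3 * t mod 11 + (if t = 1 then 11 else 0) =
    (1 + 2 + 3) * t mod 11 + 11 + (if t = 11 - 1 then 11 else (0::nat))"
  by code_simp

lemma residue_sum_13:
  "\<forall>t\<in>{1..<13}. 1 * t mod 13 + 3 * t mod 13 + 4 * t mod 13 + (if t = 1 then 13 else 0) =
    (1 + 3 + 4) * t mod 13 + 13 + (if t = 13 - 1 then 13 else (0::nat))"
  by code_simp

lemma residue_sum_17:
  "\<forall>t\<in>{1..<17}. 2 * t mod 17 + 3 * t mod 17 + 5 * t mod 17 + (if t = 1 then 17 else 0) =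
    (2 + 3 + 5) * t mod 17 + 17 + (if t = 17 - 1 then 17 else (0::nat))"
  by code_simp

lemma residue_sum_19:
  "\<forall>t\<in>{1..<19}. 3 * t mod 19 + 4 * t mod 19 + 5 * t mod 19 + (if t = 1 then 19 else 0) =
    (3 + 4 + 5) * t mod 19 + 19 + (if t = 19 - 1 then 19 else (0::nat))"
  by code_simp

theorem theorem3p4:
  fixes p :: nat and a :: int and b :: "int list" and \<tau> :: complex
  assumes "Im \<tau> > 0"
    and "(p, a, b) \<in> {
       (5, 1, [2, - 3]),
       (5, 2, [- 3, 2]),
       (7, 1, [1, 0, - 2]),
       (7, 2, [- 2, 1, 0]),
       (7, 3, [0, - 2, 1]),
       (11, 1, [0, 1, 0, - 1, - 1]),
       (11, 2, [- 1, 0, 0, 1, - 1]),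
       (11, 3, [1, - 1, - 1, 0, 0]),
       (11, 5, [0, - 1, 1, - 1, 0]),
       (11, 7, [- 1, 0, - 1, 0, 1]),
       (13, 1, [1, 0, 0, - 1, 0, - 1]),
       (13, 2, [- 1, - 1, 0, 1, 0, 0]),
       (13, 3, [0, 0, - 1, 0, 1, - 1]),
       (13, 4, [0, 1, - 1, - 1, 0, 0]),
       (13, 5, [0, - 1, 1, 0, - 1, 0]),
       (13, 7, [- 1, 0, 0, 0, - 1, 1]),
       (17, 1, [1, 0, 0, 0, 0, - 1, - 1, 0]),
       (17, 2, [0, - 1, 0, 0, 1, 0, 0, - 1]),
       (17, 3, [0, 0, 0, - 1, 0, 1, 0, - 1]),
       (17, 5, [0, 0, 0, 1, - 1, - 1, 0, 0]),
       (17, 7, [0, - 1, 1, 0, 0, 0, - 1, 0]),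
       (17, 8, [0, 0, - 1, 0, - 1, 0, 0, 1]),
       (17, 11, [- 1, 1, - 1, 0, 0, 0, 0, 0]),
       (17, 13, [- 1, 0, 0, - 1, 0, 0, 1, 0]),
       (19, 1, [1, 1, 0, 0, - 1, - 1, - 1, 0, 0]),
       (19, 2, [0, - 1, - 1, 0, 1, 1, 0, - 1, 0]),
       (19, 3, [1, - 1, 0, 0, - 1, 0, 1, 0, - 1]),
       (19, 4, [0, 0, 1, - 1, 0, - 1, 0, 1, - 1]),
       (19, 5, [0, 0, - 1, 1, 0, 0, - 1, 1, - 1]),
       (19, 7, [0, 0, 1, - 1, - 1, 1, 0, - 1, 0]),
       (19, 9, [- 1, - 1, 0, - 1, 0, 0, 1, 0, 1]),
       (19, 11, [- 1, 0, 0, 1, 0, 0, - 1, - 1, 1]),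
       (19, 13, [- 1, 1, - 1, 0, 1, - 1, 0, 0, 0])}"
  shows "diamond p a (eisenstein_avg p) \<tau> = theta_quot p b \<tau>"
proof -
  note row5 = diamond_theta_quot[OF assms(1) _ _ _ _ _ _ residue_sum_5]
  note row7 = diamond_theta_quot[OF assms(1) _ _ _ _ _ _ residue_sum_7]
  note row11 = diamond_theta_quot[OF assms(1) _ _ _ _ _ _ residue_sum_11]
  note row13 = diamond_theta_quot[OF assms(1) _ _ _ _ _ _ residue_sum_13]
  note row17 = diamond_theta_quot[OF assms(1) _ _ _ _ _ _ residue_sum_17]
  note row19 = diamond_theta_quot[OF assms(1) _ _ _ _ _ _ residue_sum_19]
  from assms(2) show ?thesis
    \<comment> \<open>In each row X, Y, Z are the residues between 1 and p - 1 of the triple divided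
      by a modulo p; the remaining identity is cancellation among values of f in the range 1, ...,
      (p-1)/2.\<close>
    apply (elim insertE emptyE)
    subgoal by (clarsimp, rule row5[where X = 1 and Y = 1 and Z = 1]) (simp_all add: cong_def field_simps power_int_minus power2_eq_square power3_eq_cube)
    subgoal by (clarsimp, rule row5[where X = 3 and Y = 3 and Z = 3]) (simp_all add: cong_def field_simps power_int_minus power2_eq_square power3_eq_cube)
    subgoal by (clarsimp, rule row7[where X = 1 and Y = 1 and Z = 2]) (simp_all add: cong_def field_simps power_int_minus power2_eq_square power3_eq_cube)
    subgoal by (clarsimp, rule row7[where X = 4 and Y = 4 and Z = 1]) (simp_all add: cong_def field_simps power_int_minus power2_eq_square power3_eq_cube)
    subgoal by (clarsimp, rule row7[where X = 5 and Y = 5 and Z = 3]) (simp_all add: cong_def field_simps power_int_minus power2_eq_square power3_eq_cube)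
    subgoal by (clarsimp, rule row11[where X = 1 and Y = 2 and Z = 3]) (simp_all add: cong_def field_simps power_int_minus power2_eq_square power3_eq_cube)
    subgoal by (clarsimp, rule row11[where X = 6 and Y = 1 and Z = 7]) (simp_all add: cong_def field_simps power_int_minus power2_eq_square power3_eq_cube)
    subgoal by (clarsimp, rule row11[where X = 4 and Y = 8 and Z = 1]) (simp_all add: cong_def field_simps power_int_minus power2_eq_square power3_eq_cube)
    subgoal by (clarsimp, rule row11[where X = 9 and Y = 7 and Z = 5]) (simp_all add: cong_def field_simps power_int_minus power2_eq_square power3_eq_cube)
    subgoal by (clarsimp, rule row11[where X = 8 and Y = 5 and Z = 2]) (simp_all add: cong_def field_simps power_int_minus power2_eq_square power3_eq_cube)
    subgoal by (clarsimp, rule row13[where X = 1 and Y = 3 and Z = 4]) (simp_all add: cong_def field_simps power_int_minus power2_eq_square power3_eq_cube)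
    subgoal by (clarsimp, rule row13[where X = 7 and Y = 8 and Z = 2]) (simp_all add: cong_def field_simps power_int_minus power2_eq_square power3_eq_cube)
    subgoal by (clarsimp, rule row13[where X = 9 and Y = 1 and Z = 10]) (simp_all add: cong_def field_simps power_int_minus power2_eq_square power3_eq_cube)
    subgoal by (clarsimp, rule row13[where X = 10 and Y = 4 and Z = 1]) (simp_all add: cong_def field_simps power_int_minus power2_eq_square power3_eq_cube)
    subgoal by (clarsimp, rule row13[where X = 8 and Y = 11 and Z = 6]) (simp_all add: cong_def field_simps power_int_minus power2_eq_square power3_eq_cube)
    subgoal by (clarsimp, rule row13[where X = 2 and Y = 6 and Z = 8]) (simp_all add: cong_def field_simps power_int_minus power2_eq_square power3_eq_cube)
    subgoal by (clarsimp, rule row17[where X = 2 and Y = 3 and Z = 5]) (simp_all add: cong_def field_simps power_int_minus power2_eq_square power3_eq_cube)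
    subgoal by (clarsimp, rule row17[where X = 1 and Y = 10 and Z = 11]) (simp_all add: cong_def field_simps power_int_minus power2_eq_square power3_eq_cube)
    subgoal by (clarsimp, rule row17[where X = 12 and Y = 1 and Z = 13]) (simp_all add: cong_def field_simps power_int_minus power2_eq_square power3_eq_cube)
    subgoal by (clarsimp, rule row17[where X = 14 and Y = 4 and Z = 1]) (simp_all add: cong_def field_simps power_int_minus power2_eq_square power3_eq_cube)
    subgoal by (clarsimp, rule row17[where X = 10 and Y = 15 and Z = 8]) (simp_all add: cong_def field_simps power_int_minus power2_eq_square power3_eq_cube)
    subgoal by (clarsimp, rule row17[where X = 13 and Y = 11 and Z = 7]) (simp_all add: cong_def field_simps power_int_minus power2_eq_square power3_eq_cube)
    subgoal by (clarsimp, rule row17[where X = 11 and Y = 8 and Z = 2]) (simp_all add: cong_def field_simps power_int_minus power2_eq_square power3_eq_cube)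
    subgoal by (clarsimp, rule row17[where X = 8 and Y = 12 and Z = 3]) (simp_all add: cong_def field_simps power_int_minus power2_eq_square power3_eq_cube)
    subgoal by (clarsimp, rule row19[where X = 3 and Y = 4 and Z = 5]) (simp_all add: cong_def field_simps power_int_minus power2_eq_square power3_eq_cube)
    subgoal by (clarsimp, rule row19[where X = 11 and Y = 2 and Z = 12]) (simp_all add: cong_def field_simps power_int_minus power2_eq_square power3_eq_cube)
    subgoal by (clarsimp, rule row19[where X = 1 and Y = 14 and Z = 8]) (simp_all add: cong_def field_simps power_int_minus power2_eq_square power3_eq_cube)
    subgoal by (clarsimp, rule row19[where X = 15 and Y = 1 and Z = 6]) (simp_all add: cong_def field_simps power_int_minus power2_eq_square power3_eq_cube)
    subgoal by (clarsimp, rule row19[where X = 12 and Y = 16 and Z = 1]) (simp_all add: cong_def field_simps power_int_minus power2_eq_square power3_eq_cube)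
    subgoal by (clarsimp, rule row19[where X = 14 and Y = 6 and Z = 17]) (simp_all add: cong_def field_simps power_int_minus power2_eq_square power3_eq_cube)
    subgoal by (clarsimp, rule row19[where X = 13 and Y = 11 and Z = 9]) (simp_all add: cong_def field_simps power_int_minus power2_eq_square power3_eq_cube)
    subgoal by (clarsimp, rule row19[where X = 2 and Y = 9 and Z = 16]) (simp_all add: cong_def field_simps power_int_minus power2_eq_square power3_eq_cube)
    subgoal by (clarsimp, rule row19[where X = 9 and Y = 12 and Z = 15]) (simp_all add: cong_def field_simps power_int_minus power2_eq_square power3_eq_cube)
    done
qed

end
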